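(* Let $d=1$, $D=[0,1]$, let $I_H$ be the nodal interpolation operator (with $m=0$, i.e. correctors localized to single coarse elements), and let $A$ be any realization of the randomly perturbed coefficient described in the context. Let $\mathfrak{b}$ be the multiscale (PG-LOD) bilinear form associated with $A$, and $\tilde{\mathfrak{b}}$ the combined offline-online bilinear form. Then for all $v,w\in V_H$ $$|(\mathfrak{b}-\tilde{\mathfrak{b}})(v,w)|\leq \frac{\beta}{\alpha}\Bigl(\frac{\beta-\alpha}{\alpha}\Bigr)^2 |Q|^2\Bigl(\frac{\varepsilon}{H}\,\theta_{\mathrm{def}}+2\,\theta_{\mathrm{def}}^2\Bigr)\, \|v\|_A\, \|w\|_A .$$
   Context: **Coefficient.** Let $\varepsilon=1/n$ with $n\in\mathbb{N}$. Let $A_{\mathrm{per}},B_{\mathrm{per}}\in L^\infty(\mathbb{R})$ be real-valued and $1$-periodic, with constants $0<\alpha\le\beta<\infty$ such that $\alpha\le A_{\mathrm{per}}\le\beta$ and $\alpha\le A_{\mathrm{per}}+B_{\mathrm{per}}\le\beta$ a.e. Put $A_\varepsilon(x)=A_{\mathrm{per}}(x/\varepsilon)$, $B_\varepsilon(x)=B_{\mathrm{per}}(x/\varepsilon)$. Let $Q\subseteq[0,1]$ be measurable with positive Lebesgue measure $|Q|$ and $I=\{k\in\mathbb{Z} : \varepsilon(k+Q)\subset D\}$. A realization of the coefficient is $$A(x)=A_\varepsilon(x)+\sum_{j\in I}\hat b^j\,\chi_{\varepsilon(j+Q)}(x)\,B_\varepsilon(x),\qquad \hat b^j\in\{0,1\},$$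 where $\chi_S$ is the characteristic function of $S$ (the $\hat b^j$ are values of independent Bernoulli random variables with parameter $p$; the result is for a fixed arbitrary realization). An index $j$ with $\hat b^j=1$ is called a defect. **Mesh and spaces.** $D$ is regarded as a torus (periodic boundary conditions). $\mathcal{T}_H$ is the partition of $D$ into intervals of length $H$, with $1/H\in\mathbb{N}$, nodes $0,H,2H,\dots$, and $H$ an integer multiple of $\varepsilon$. $V_H$ is the space of continuous, periodic, $\mathcal{T}_H$-piecewise affine functions on $D$ with mean zero. Let $W$ be either the space of all periodic $H^1(D)$ functions, or the space of continuous periodic piecewise affine functions on a refinement $\mathcal{T}_h$ of $\mathcal{T}_H$ that resolves the coefficients, i.e. $A_\varepsilon$, $B_\varepsilon$ and every $\chi_{\varepsilon(j+Q)}$ are constant on each element of $\mathcal{T}_h$. For $T\in\mathcal{T}_H$ the fine-scale space (kernel of nodal interpolation, restricted to $T$) is $V^{\mathrm f}(T)=\{v\in W : v=0 \text{ at all nodes of } \mathcal{T}_H,\ v|_{D\setminus T}=0\}$. **Energy norm.** $\|v\|_A^2=\int_D A\,|\nabla v|^2\,dx$. **Correctors and bilinear forms.** For a coefficient $a\in L^\infty(T)$ with $\alpha\le a\le\beta$ a.e. and $v\in V_H$, $\mathcal{C}_T(a)v\in V^{\mathrm f}(T)$ is the unique solution of $$\int_T a\,\nabla(\mathcal{C}_T(a)v)\cdot\nabla v^{\mathrm f}\,dx=\int_T a\,\nabla v\cdot\nabla v^{\mathrm f}\,dx\quad\text{for all } v^{\mathrm f}\in V^{\mathrm f}(T).$$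 Set $\mathfrak{b}_T[a](v,w)=\int_T a\,(\nabla v-\nabla \mathcal{C}_T(a)v)\cdot\nabla w\,dx$ and $\mathfrak{b}(v,w)=\sum_{T\in\mathcal{T}_H}\mathfrak{b}_T[A|_T](v,w)$. **Offline-online form.** For $T\in\mathcal{T}_H$ let $J_T=\{k\in\mathbb{Z} : \varepsilon(k+Q)\subset T\}$, which has cardinality $N=H/\varepsilon$, and let $\sigma_T:\{1,\dots,N\}\to J_T$ be a bijection. Define the offline coefficients on $T$ by $A_0^T=A_\varepsilon|_T$ and $A_i^T=A_\varepsilon|_T+\chi_{\varepsilon(\sigma_T(i)+Q)}B_\varepsilon$ for $i=1,\dots,N$ (by periodicity these coincide, up to translation, for all $T$). Let $\mu_i^T=\hat b^{\sigma_T(i)}\in\{0,1\}$ for $i=1,\dots,N$, let $N_{\mathrm{def},T}=\sum_{i=1}^N\mu_i^T$ be the number of defects in $T$, and let $\mu_0^T=1-N_{\mathrm{def},T}$; then $\sum_{i=0}^N\mu_i^T=1$ and $A|_T=\sum_{i=0}^N\mu_i^TA_i^T$. Set $$\tilde{\mathfrak{b}}(v,w)=\sum_{T\in\mathcal{T}_H}\sum_{i=0}^N\mu_i^T\,\mathfrak{b}_T[A_i^T](v,w).$$ **Defect fraction.** $\theta_{\mathrm{def},T}=N_{\mathrm{def},T}/N$ and $\theta_{\mathrm{def}}=\max_{T\in\mathcal{T}_H}\theta_{\mathrm{def},T}$. *)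

theory Defs
  imports "HOL-Analysis.Analysis"
begin

text \<open>Functions on the torus \<open>D = [0,1]\<close> are represented by 1-periodic functions on the real line.\<close>

definition periodic1 :: "(real \<Rightarrow> real) \<Rightarrow> bool" where
  "periodic1 f \<longleftrightarrow> (\<forall>x. f (x + 1) = f x)"

definition smooth :: "(real \<Rightarrow> real) \<Rightarrow> bool" where
  "smooth f \<longleftrightarrow> (\<forall>k x. (deriv ^^ k) f differentiable (at x))"

definition L2 :: "(real \<Rightarrow> real) \<Rightarrow> bool" where
  "L2 g \<longleftrightarrow> set_borel_measurable lebesgue {0..1} g \<and>
     set_integrable lebesgue {0..1} (\<lambda>x. (g x)\<^sup>2)"

text \<open>\<open>g\<close> is a weak gradient of \<open>v\<close> on the torus, so the test functions are the smooth
  1-periodic functions. Only the values of \<open>g\<close> on \<open>[0,1]\<close> matter, up to null sets.\<close>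

definition weak_grad :: "(real \<Rightarrow> real) \<Rightarrow> (real \<Rightarrow> real) \<Rightarrow> bool" where
  "weak_grad v g \<longleftrightarrow> L2 g \<and>
     (\<forall>\<phi>. smooth \<phi> \<and> periodic1 \<phi> \<longrightarrow>
        (LINT x:{0..1}|lebesgue. v x * deriv \<phi> x) = - (LINT x:{0..1}|lebesgue. g x * \<phi> x))"

text \<open>Some representative of the weak gradient; it is determined almost everywhere on \<open>[0,1]\<close>,
  and it is used only under integrals over subsets of \<open>[0,1]\<close>.\<close>

definition grad :: "(real \<Rightarrow> real) \<Rightarrow> real \<Rightarrow> real" where
  "grad v = (SOME g. weak_grad v g)"

text \<open>Elements of periodic \<open>H\<^sup>1(D)\<close> are represented by their continuous representatives, for which
  nodal values make sense.\<close>

definition H1_per :: "(real \<Rightarrow> real) set" where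
  "H1_per = {v. periodic1 v \<and> continuous_on UNIV v \<and> (\<exists>g. weak_grad v g)}"


subsection \<open>Coefficient\<close>

definition L_infty :: "(real \<Rightarrow> real) \<Rightarrow> bool" where
  "L_infty f \<longleftrightarrow> f \<in> borel_measurable lebesgue \<and> (\<exists>C. AE x in lebesgue. \<bar>f x\<bar> \<le> C)"

text \<open>The set \<open>\<epsilon>(k + Q)\<close>.\<close>

definition cell :: "real set \<Rightarrow> real \<Rightarrow> int \<Rightarrow> real set" where
  "cell Q \<epsilon> k = (\<lambda>y. \<epsilon> * (real_of_int k + y)) ` Q"

text \<open>With \<open>S = D\<close> this is the index set \<open>I\<close>, and with \<open>S = T\<close> it is \<open>J\<^sub>T\<close>.\<close>

definition cells_in :: "real set \<Rightarrow> real \<Rightarrow> real set \<Rightarrow> int set" where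
  "cells_in Q \<epsilon> S = {k. cell Q \<epsilon> k \<subseteq> S}"

definition rescale :: "(real \<Rightarrow> real) \<Rightarrow> real \<Rightarrow> real \<Rightarrow> real" where
  "rescale f \<epsilon> x = f (x / \<epsilon>)"

definition coeff ::
  "(real \<Rightarrow> real) \<Rightarrow> (real \<Rightarrow> real) \<Rightarrow> real set \<Rightarrow> real \<Rightarrow> (int \<Rightarrow> real) \<Rightarrow> real \<Rightarrow> real" where
  "coeff Aper Bper Q \<epsilon> b x = rescale Aper \<epsilon> x +
     (\<Sum>j\<in>cells_in Q \<epsilon> {0..1}. b j * indicat_real (cell Q \<epsilon> j) x * rescale Bper \<epsilon> x)"


subsection \<open>Mesh and spaces\<close>

text \<open>Meshes are sets of closed elements.\<close>

definition is_mesh :: "real set set \<Rightarrow> bool" where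
  "is_mesh \<T> \<longleftrightarrow> \<T> division_of {0..1} \<and> (\<forall>K\<in>\<T>. interior K \<noteq> {})"

definition coarse_mesh :: "real \<Rightarrow> real set set" where
  "coarse_mesh H = {{real t * H..real (Suc t) * H} | t. real (Suc t) * H \<le> 1}"

definition coarse_nodes :: "real \<Rightarrow> real set" where
  "coarse_nodes H = {real t * H | t. real t * H \<le> 1}"

definition P1_per :: "real set set \<Rightarrow> (real \<Rightarrow> real) set" where
  "P1_per \<T> = {v. periodic1 v \<and> continuous_on UNIV v \<and>
     (\<forall>K\<in>\<T>. \<exists>c d. \<forall>x\<in>K. v x = c + d * x)}"

definition V_coarse :: "real \<Rightarrow> (real \<Rightarrow> real) set" where
  "V_coarse H = {v \<in> P1_per (coarse_mesh H). (LINT x:{0..1}|lebesgue. v x) = 0}"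

text \<open>The coefficients are almost-everywhere classes, so constancy on an element is meant almost
  everywhere.\<close>

definition const_on_elements :: "real set set \<Rightarrow> (real \<Rightarrow> real) \<Rightarrow> bool" where
  "const_on_elements \<T> f \<longleftrightarrow> (\<forall>K\<in>\<T>. \<exists>c. AE x in lebesgue. x \<in> K \<longrightarrow> f x = c)"

definition resolving_refinement ::
  "(real \<Rightarrow> real) \<Rightarrow> (real \<Rightarrow> real) \<Rightarrow> real set \<Rightarrow> real \<Rightarrow> real \<Rightarrow> real set set \<Rightarrow> bool" where
  "resolving_refinement Aper Bper Q \<epsilon> H \<T> \<longleftrightarrow>
     is_mesh \<T> \<and> (\<forall>K\<in>\<T>. \<exists>T\<in>coarse_mesh H. K \<subseteq> T) \<and>
     const_on_elements \<T> (rescale Aper \<epsilon>) \<and>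
     const_on_elements \<T> (rescale Bper \<epsilon>) \<and>
     (\<forall>j\<in>cells_in Q \<epsilon> {0..1}. const_on_elements \<T> (indicat_real (cell Q \<epsilon> j)))"

definition V_fine :: "(real \<Rightarrow> real) set \<Rightarrow> real \<Rightarrow> real set \<Rightarrow> (real \<Rightarrow> real) set" where
  "V_fine W H T = {v \<in> W. (\<forall>x\<in>coarse_nodes H. v x = 0) \<and> (\<forall>x\<in>{0..1} - T. v x = 0)}"

definition energy_norm :: "(real \<Rightarrow> real) \<Rightarrow> (real \<Rightarrow> real) \<Rightarrow> real" where
  "energy_norm A v = sqrt (LINT x:{0..1}|lebesgue. A x * (grad v x)\<^sup>2)"


subsection \<open>Correctors and bilinear forms\<close>

text \<open>A coefficient on \<open>T\<close> is represented by a function on the real line of which only the values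
  on \<open>T\<close> enter, so restrictions to \<open>T\<close> are not written.\<close>

definition corrector ::
  "(real \<Rightarrow> real) set \<Rightarrow> real \<Rightarrow> real set \<Rightarrow> (real \<Rightarrow> real) \<Rightarrow> (real \<Rightarrow> real) \<Rightarrow> real \<Rightarrow> real" where
  "corrector W H T a v = (THE u. u \<in> V_fine W H T \<and>
     (\<forall>vf\<in>V_fine W H T.
        (LINT x:T|lebesgue. a x * grad u x * grad vf x) =
        (LINT x:T|lebesgue. a x * grad v x * grad vf x)))"

definition form_elem ::
  "(real \<Rightarrow> real) set \<Rightarrow> real \<Rightarrow> real set \<Rightarrow> (real \<Rightarrow> real) \<Rightarrow>
   (real \<Rightarrow> real) \<Rightarrow> (real \<Rightarrow> real) \<Rightarrow> real" where
  "form_elem W H T a v w =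
     (LINT x:T|lebesgue. a x * (grad v x - grad (corrector W H T a v) x) * grad w x)"

definition form_lod ::
  "(real \<Rightarrow> real) set \<Rightarrow> real \<Rightarrow> (real \<Rightarrow> real) \<Rightarrow> (real \<Rightarrow> real) \<Rightarrow> (real \<Rightarrow> real) \<Rightarrow> real" where
  "form_lod W H A v w = (\<Sum>T\<in>coarse_mesh H. form_elem W H T A v w)"


subsection \<open>Offline-online form\<close>

text \<open>The enumeration \<open>\<sigma> T\<close> maps \<open>{1..N}\<close> to \<open>J\<^sub>T\<close>; the index \<open>0\<close> stands for the defect-free
  coefficient.\<close>

definition offline_coeff ::
  "(real \<Rightarrow> real) \<Rightarrow> (real \<Rightarrow> real) \<Rightarrow> real set \<Rightarrow> real \<Rightarrow> (real set \<Rightarrow> nat \<Rightarrow> int) \<Rightarrow>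
   real set \<Rightarrow> nat \<Rightarrow> real \<Rightarrow> real" where
  "offline_coeff Aper Bper Q \<epsilon> \<sigma> T i x =
     (if i = 0 then rescale Aper \<epsilon> x
      else rescale Aper \<epsilon> x + indicat_real (cell Q \<epsilon> (\<sigma> T i)) x * rescale Bper \<epsilon> x)"

definition n_defects ::
  "nat \<Rightarrow> (int \<Rightarrow> real) \<Rightarrow> (real set \<Rightarrow> nat \<Rightarrow> int) \<Rightarrow> real set \<Rightarrow> real" where
  "n_defects N b \<sigma> T = (\<Sum>i=1..N. b (\<sigma> T i))"

definition offline_weight ::
  "nat \<Rightarrow> (int \<Rightarrow> real) \<Rightarrow> (real set \<Rightarrow> nat \<Rightarrow> int) \<Rightarrow> real set \<Rightarrow> nat \<Rightarrow> real" where
  "offline_weight N b \<sigma> T i = (if i = 0 then 1 - n_defects N b \<sigma> T else b (\<sigma> T i))"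

definition form_offon ::
  "(real \<Rightarrow> real) \<Rightarrow> (real \<Rightarrow> real) \<Rightarrow> real set \<Rightarrow> real \<Rightarrow> (int \<Rightarrow> real) \<Rightarrow>
   (real set \<Rightarrow> nat \<Rightarrow> int) \<Rightarrow> nat \<Rightarrow> (real \<Rightarrow> real) set \<Rightarrow> real \<Rightarrow>
   (real \<Rightarrow> real) \<Rightarrow> (real \<Rightarrow> real) \<Rightarrow> real" where
  "form_offon Aper Bper Q \<epsilon> b \<sigma> N W H v w =
     (\<Sum>T\<in>coarse_mesh H. \<Sum>i=0..N.
        offline_weight N b \<sigma> T i * form_elem W H T (offline_coeff Aper Bper Q \<epsilon> \<sigma> T i) v w)"

definition max_defect_frac ::
  "nat \<Rightarrow> (int \<Rightarrow> real) \<Rightarrow> (real set \<Rightarrow> nat \<Rightarrow> int) \<Rightarrow> real \<Rightarrow> real" where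
  "max_defect_frac N b \<sigma> H = Max ((\<lambda>T. n_defects N b \<sigma> T / real N) ` coarse_mesh H)"

end

theory Submission
  imports Defs
begin

text \<open>In one space dimension the local problems can be solved by hand. The gradients of functions in
\<open>V_fine W H T\<close> have mean zero over \<open>T\<close>, so they are orthogonal to constants, and \<open>C v\<close> solves the
corrector equation as soon as the corrected flux \<open>a (grad v - grad (C v))\<close> is constant on \<open>T\<close>.
If \<open>v\<close> has slope \<open>s\<close> on \<open>T\<close>, the zero
end values of the corrector force the constant to be \<open>s H / R(a)\<close> with the resistance
\<open>R(a) = \<integral>\<^sub>T 1 / a\<close>. Hence the local form of two coarse functions with slopes \<open>s\<close> and \<open>r\<close> is
\<open>s r H\<^sup>2 / R(a)\<close> (\<open>form_elem_eq\<close>). This holds for both fine spaces, because on a mesh that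
resolves the coefficient the primitive of \<open>s - s H / (R(a) a)\<close> is piecewise affine.

Resistances in series add up. A defect in cell \<open>j\<close> changes the resistance of \<open>T\<close> by a number
\<open>d\<^sub>j\<close> with \<open>\<bar>d\<^sub>j\<bar> \<le> \<epsilon> |Q| (\<beta> - \<alpha>) / (\<alpha> \<beta>)\<close>, independently of the other defects
(\<open>masked_resistance\<close>, \<open>cell_jump_bound\<close>). With \<open>R\<close> the defect-free resistance and \<open>D\<close> the sum
of the \<open>d\<^sub>j\<close> over the defects in \<open>T\<close>, the true form contains \<open>1 / (R + D)\<close>, and the
offline-online form replaces this by \<open>1 / R\<close> plus the sum of the single-defect changes
\<open>1 / (R + d\<^sub>j) - 1 / R\<close>. The difference is the sum of
\<open>d\<^sub>j (D - d\<^sub>j) / (R (R + D) (R + d\<^sub>j))\<close>, in which only products of two distinct defects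
occur. All resistances are at least \<open>H / \<beta>\<close>, so the error on \<open>T\<close> is at most
\<open>H |s r|\<close> times the square of the defect fraction, up to the constant of the theorem
(\<open>resistance_expansion_error\<close>, \<open>element_error\<close>). The Cauchy-Schwarz inequality and
\<open>\<alpha> \<Sum>\<^sub>T H s\<^sub>T\<^sup>2 \<le> \<parallel>v\<parallel>\<^sub>A\<^sup>2\<close> sum this over the elements, and \<open>\<theta>\<^sup>2\<close> is at most
\<open>\<epsilon> / H \<theta> + 2 \<theta>\<^sup>2\<close>.

What has to be supplied from analysis is the calculus of the weak gradient. It is given by test
functions and an arbitrary choice of representative, so three facts carry the computation: it is
unique almost everywhere (\<open>weak_grad_unique\<close>), a continuous function is recovered from it by
integration (\<open>weak_grad_FTC\<close>), and a periodic primitive of a square-integrable function has that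
function as weak gradient (\<open>weak_grad_periodic_primitive\<close>). The first two rest on the fact that
smooth periodic functions separate integrable functions (\<open>smooth_periodic_separate\<close>), and the
third is integration by parts, proved with Fubini's theorem.\<close>

section \<open>Integration over intervals\<close>

lemma LINT_cong_AE:
  fixes f g :: "'a \<Rightarrow> real"
  assumes "set_borel_measurable M A f" "set_borel_measurable M A g"
    and "AE x in M. x \<in> A \<longrightarrow> f x = g x"
  shows "(LINT x:A|M. f x) = (LINT x:A|M. g x)"
  using assms unfolding set_borel_measurable_def set_lebesgue_integral_def
  by (intro integral_cong_AE) (auto elim!: eventually_mono simp: indicator_def)

lemma set_borel_measurable_mult:
  fixes f g :: "'a \<Rightarrow> real"
  assumes "set_borel_measurable M S f" "set_borel_measurable M S g"
  shows "set_borel_measurable M S (\<lambda>x. f x * g x)"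
proof -
  have "(\<lambda>x. indicator S x *\<^sub>R (f x * g x)) = (\<lambda>x. (indicator S x *\<^sub>R f x) * (indicator S x *\<^sub>R g x))"
    by (auto simp: indicator_def)
  then show ?thesis
    using borel_measurable_times[OF assms[unfolded set_borel_measurable_def]]
    unfolding set_borel_measurable_def by simp
qed

lemma set_borel_measurable_diff:
  fixes f g :: "'a \<Rightarrow> real"
  assumes "set_borel_measurable M S f" "set_borel_measurable M S g"
  shows "set_borel_measurable M S (\<lambda>x. f x - g x)"
  using borel_measurable_diff[OF assms[unfolded set_borel_measurable_def]]
  unfolding set_borel_measurable_def by (simp add: right_diff_distrib)

lemma set_borel_measurable_of_measurable:
  fixes f :: "'a \<Rightarrow> real"
  assumes "f \<in> borel_measurable M" "S \<in> sets M" shows "set_borel_measurable M S f"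
  using assms unfolding set_borel_measurable_def by (intro borel_measurable_scaleR borel_measurable_indicator)

lemma set_integrable_mult_bounded:
  fixes f h :: "'a \<Rightarrow> real"
  assumes f: "set_integrable M S f" and h: "set_borel_measurable M S h"
    and bd: "AE x in M. x \<in> S \<longrightarrow> \<bar>h x\<bar> \<le> C"
  shows "set_integrable M S (\<lambda>x. h x * f x)"
  unfolding set_integrable_def
proof (rule Bochner_Integration.integrable_bound)
  show "integrable M (\<lambda>x. C * (indicator S x *\<^sub>R f x))"
    using f unfolding set_integrable_def by (rule integrable_mult_right)
  have "(\<lambda>x. indicator S x *\<^sub>R (h x * f x)) = (\<lambda>x. (indicator S x *\<^sub>R h x) * (indicator S x *\<^sub>R f x))"
    by (auto simp: indicator_def)
  then show "(\<lambda>x. indicator S x *\<^sub>R (h x * f x)) \<in> borel_measurable M"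
    using borel_measurable_times[OF h[unfolded set_borel_measurable_def]
        borel_measurable_integrable[OF f[unfolded set_integrable_def]]] by simp
  show "AE x in M. norm (indicator S x *\<^sub>R (h x * f x)) \<le> norm (C * (indicator S x *\<^sub>R f x))"
    using bd
  proof eventually_elim
    case (elim x)
    then show ?case
      by (cases "x \<in> S") (auto simp: abs_mult intro!: mult_right_mono)
  qed
qed

lemma set_integrable_const_lmeasurable:
  assumes "S \<in> lmeasurable" shows "set_integrable lebesgue S (\<lambda>x. k :: real)"
proof -
  have "integrable lebesgue (indicat_real S)"
    using assms by (intro integrable_real_indicator) (auto simp: fmeasurable_def)
  then show ?thesis unfolding set_integrable_def by (simp only: real_scaleR_def integrable_mult_left)
qed

lemma AE_avoiding_finite:
  assumes "finite S" "\<And>x. x \<notin> S \<Longrightarrow> P x"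
  shows "AE x :: real in lebesgue. P x"
proof -
  have "AE x in lebesgue. x \<notin> S"
    using assms(1) by (intro AE_not_in) (auto intro: finite_imp_null_set_lborel null_sets_completionI)
  then show ?thesis by eventually_elim (rule assms(2))
qed

lemma LINT_singleton: "(LINT t:{a..a}|lebesgue. g t) = (0 :: real)" for a :: real
proof -
  have "AE t in lebesgue. indicator {a..a} t *\<^sub>R g t = 0"
    by (rule AE_avoiding_finite[of "{a}"]) auto
  then show ?thesis unfolding set_lebesgue_integral_def by (rule integral_eq_zero_AE)
qed

lemma continuous_set_integrable:
  fixes f :: "real \<Rightarrow> real"
  assumes "continuous_on {a..b} f" shows "set_integrable lebesgue {a..b} f"
  using absolutely_integrable_continuous_real[OF assms] .

lemma continuous_set_borel_measurable:
  fixes f :: "real \<Rightarrow> real"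
  assumes "continuous_on {a..b} f" shows "set_borel_measurable lebesgue {a..b} f"
  using continuous_set_integrable[OF assms]
  by (auto simp: set_borel_measurable_def set_integrable_def)

lemma set_integrable_mult_continuous:
  fixes f g :: "real \<Rightarrow> real"
  assumes "set_integrable lebesgue {a..b} f" "continuous_on {a..b} g"
  shows "set_integrable lebesgue {a..b} (\<lambda>x. g x * f x)"
proof -
  have "compact (g ` {a..b})" using assms(2) by (intro compact_continuous_image) auto
  then obtain C where "\<forall>y\<in>g ` {a..b}. norm y \<le> C" using compact_imp_bounded bounded_iff by metis
  then show ?thesis
    by (intro set_integrable_mult_bounded[of _ _ _ _ C] assms continuous_set_borel_measurable) auto
qed

lemma LINT_const: "p \<le> q \<Longrightarrow> (LINT x:{p..q}|lebesgue. k) = k * (q - p)" for k :: real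
  by (simp add: set_lebesgue_integral_def)

lemma LINT_combine:
  fixes f :: "real \<Rightarrow> real"
  assumes "set_integrable lebesgue {a..c} f" "a \<le> b" "b \<le> c"
  shows "(LINT x:{a..b}|lebesgue. f x) + (LINT x:{b..c}|lebesgue. f x) = (LINT x:{a..c}|lebesgue. f x)"
proof -
  have "set_integrable lebesgue {a..b} f" "set_integrable lebesgue {b..c} f"
    using assms by (auto intro: set_integrable_subset)
  then show ?thesis
    using assms by (simp add: set_lebesgue_integral_eq_integral Henstock_Kurzweil_Integration.integral_combine)
qed

lemma LINT_FTC:
  fixes F f :: "real \<Rightarrow> real"
  assumes "a \<le> b" "continuous_on {a..b} f" "\<And>x. x \<in> {a..b} \<Longrightarrow> (F has_real_derivative f x) (at x)"
  shows "(LINT x:{a..b}|lebesgue. f x) = F b - F a"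
proof -
  have "(f has_integral (F b - F a)) {a..b}"
    using assms by (intro fundamental_theorem_of_calculus)
      (auto simp: has_real_derivative_iff_has_vector_derivative intro: has_vector_derivative_at_within)
  then show ?thesis
    using continuous_set_integrable[OF assms(2)] by (simp add: set_lebesgue_integral_eq_integral integral_unique)
qed

lemma LINT_uniform_partition:
  fixes f :: "real \<Rightarrow> real"
  assumes f: "set_integrable lebesgue {0..1} f" and H: "0 \<le> H" and m: "real m * H \<le> 1"
  shows "(LINT x:{0..real m * H}|lebesgue. f x) = (\<Sum>t<m. LINT x:{real t * H..real (Suc t) * H}|lebesgue. f x)"
  using m
proof (induction m)
  case 0
  then show ?case using LINT_singleton[of 0 f] by simp
next
  case (Suc m)
  have le: "real m * H \<le> real (Suc m) * H" using H by (intro mult_right_mono) auto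
  have "set_integrable lebesgue {0..real (Suc m) * H} f"
    using Suc.prems by (intro set_integrable_subset[OF f]) auto
  from LINT_combine[OF this _ le] have "(LINT x:{0..real (Suc m) * H}|lebesgue. f x)
      = (LINT x:{0..real m * H}|lebesgue. f x) + (LINT x:{real m * H..real (Suc m) * H}|lebesgue. f x)"
    using H by simp
  then show ?case using Suc.IH le Suc.prems by simp
qed

lemma AE_lebesgue_rescale:
  assumes "c \<noteq> 0" "AE x in lebesgue. P x" shows "AE x in lebesgue. P (c * x :: real)"
proof -
  have m: "(\<lambda>x. 0 + c * x) \<in> lebesgue \<rightarrow>\<^sub>M lebesgue"
    using lebesgue_affine_measurable[where c = "\<lambda>x::real. c" and t = 0] assms(1) by simp
  have "AE x in density (distr lebesgue lebesgue (\<lambda>x. 0 + c * x)) (\<lambda>_. ennreal \<bar>c\<bar>). P x"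
    using assms(2) lebesgue_real_affine[OF assms(1), of 0] by metis
  then have "AE x in distr lebesgue lebesgue (\<lambda>x. 0 + c * x). P x"
    using assms(1) by (subst (asm) AE_density) auto
  then have "AE x in lebesgue. P (0 + c * x)" by (rule AE_distrD[OF m])
  then show ?thesis by simp
qed

text \<open>Completions inherit sigma-finiteness; this instance gives access to \<open>density_zero\<close> for
Lebesgue measurable functions.\<close>

lemma sigma_finite_lebesgue: "sigma_finite_measure (lebesgue :: real measure)"
proof
  show "\<exists>A::real set set. countable A \<and> A \<subseteq> sets lebesgue \<and> \<Union>A = space lebesgue
      \<and> (\<forall>a\<in>A. emeasure lebesgue a \<noteq> \<infinity>)"
  proof (intro exI[of _ "range (\<lambda>n. {- real n..real n})"] conjI)
    have "\<exists>n. x \<in> {- real n..real n}" for x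
    proof -
      obtain n :: nat where "\<bar>x\<bar> \<le> real n" using real_arch_simple by blast
      then show ?thesis by (intro exI[of _ n]) auto
    qed
    then show "(\<Union>n. {- real n..real n}) = space lebesgue" by auto
  qed auto
qed

text \<open>The sets over which \<open>h\<close> integrates to zero form a Dynkin system, and the half-lines generate the
Borel sets; a Lebesgue set differs from a Borel set by a null set.\<close>

lemma integrals_zero_imp_AE_zero:
  fixes h :: "real \<Rightarrow> real"
  assumes int: "set_integrable lebesgue {0..1} h"
    and zero: "\<And>b. 0 \<le> b \<Longrightarrow> b \<le> 1 \<Longrightarrow> (LINT x:{0..b}|lebesgue. h x) = 0"
  shows "AE x in lebesgue. x \<in> {0..1} \<longrightarrow> h x = 0"
proof -
  have sI: "set_integrable lebesgue (S \<inter> {0..1}) h" if "S \<in> sets borel" for S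
    using int that by (intro set_integrable_subset[OF int]) auto
  have borel: "(LINT x:S \<inter> {0..1}|lebesgue. h x) = 0" if "S \<in> sets borel" for S :: "real set"
  proof -
    have G: "sets (borel :: real measure) = sigma_sets UNIV (range (\<lambda>a. {..<a}))"
      by (subst borel_Iio) simp
    have "{..<a} \<inter> {..<b} = {..<min a b}" for a b :: real by auto
    then have "Int_stable (range (\<lambda>a::real. {..<a}))"
      unfolding Int_stable_def by blast
    moreover have "range (\<lambda>a::real. {..<a}) \<subseteq> Pow UNIV" by simp
    moreover have "S \<in> sigma_sets UNIV (range (\<lambda>a. {..<a}))" using that G by simp
    ultimately show ?thesis
    proof (induction rule: sigma_sets_induct_disjoint)
      case (basic A)
      then obtain a where A: "A = {..<a}" by auto
      show ?case
      proof (cases "a \<le> 0")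
        case True
        then have "A \<inter> {0..1} = {}" using A by auto
        then show ?thesis by (simp add: set_lebesgue_integral_def)
      next
        case False
        have "(LINT x:A \<inter> {0..1}|lebesgue. h x) = (LINT x:{0..min a 1}|lebesgue. h x)"
        proof (rule set_integral_cong_set[symmetric])
          show "set_borel_measurable lebesgue (A \<inter> {0..1}) h"
            using sI[of A] A by (auto simp: set_integrable_def set_borel_measurable_def)
          have "{0..min a 1} = {..min a 1} \<inter> {0..1}" by auto
          then show "set_borel_measurable lebesgue {0..min a 1} h"
            using sI[of "{..min a 1}"] by (auto simp: set_integrable_def set_borel_measurable_def)
          show "AE x in lebesgue. (x \<in> A \<inter> {0..1}) = (x \<in> {0..min a 1})"
            by (rule AE_avoiding_finite[of "{a}"]) (auto simp: A)
        qed
        also have "\<dots> = 0" using False by (intro zero) auto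
        finally show ?thesis .
      qed
    next
      case empty
      show ?case by (simp add: set_lebesgue_integral_def)
    next
      case (compl A)
      have b: "A \<in> sets borel" using compl G by simp
      have "(LINT x:(A \<inter> {0..1}) \<union> ((UNIV - A) \<inter> {0..1})|lebesgue. h x)
          = (LINT x:A \<inter> {0..1}|lebesgue. h x) + (LINT x:(UNIV - A) \<inter> {0..1}|lebesgue. h x)"
        using b by (intro set_integral_Un sI) auto
      moreover have "(A \<inter> {0..1}) \<union> ((UNIV - A) \<inter> {0..1}) = {0..1}" by auto
      ultimately show ?case using zero[of 1] compl by simp
    next
      case (union A)
      have b: "A i \<in> sets borel" for i using union G by auto
      have "(LINT x:(\<Union>i. A i \<inter> {0..1})|lebesgue. h x) = (\<Sum>i. (LINT x:(A i \<inter> {0..1})|lebesgue. h x))"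
      proof (rule lebesgue_integral_countable_add)
        show "A i \<inter> {0..1} \<in> sets lebesgue" for i using b[of i] by auto
        show "A i \<inter> {0..1} \<inter> (A j \<inter> {0..1}) = {}" if "i \<noteq> j" for i j
          using union(1) that by (auto simp: disjoint_family_on_def)
        have "(\<Union>i. A i \<inter> {0..1}) = (\<Union>i. A i) \<inter> {0..1}" by auto
        then show "set_integrable lebesgue (\<Union>i. A i \<inter> {0..1}) h" using sI[of "\<Union>i. A i"] b by auto
      qed
      moreover have "(\<Union>i. A i \<inter> {0..1}) = (\<Union>i. A i) \<inter> {0..1}" by auto
      ultimately show ?case using union by simp
    qed
  qed
  have "AE x in lebesgue. indicator {0..1} x *\<^sub>R h x = 0"
  proof (rule sigma_finite_measure.density_zero[OF sigma_finite_lebesgue])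
    show "integrable lebesgue (\<lambda>x. indicator {0..1} x *\<^sub>R h x)"
      using int by (simp add: set_integrable_def)
    fix A :: "real set" assume A: "A \<in> sets lebesgue"
    obtain B where B: "B \<in> sets borel" "AE x in lebesgue. (x \<in> A) = (x \<in> B)"
    proof -
      have "A \<in> sets (completion lborel)" using A by simp
      then obtain S N N' where S: "A = S \<union> N" "N \<subseteq> N'" "N' \<in> null_sets lborel" "S \<in> sets lborel"
        by (rule sets_completionE)
      have "AE x in lebesgue. x \<notin> N'" using S(3) by (intro AE_not_in null_sets_completionI)
      then have "AE x in lebesgue. (x \<in> A) = (x \<in> S)" by eventually_elim (use S in auto)
      with S(4) show ?thesis by (intro that[of S]) auto
    qed
    have "(LINT x:A|lebesgue. indicator {0..1} x *\<^sub>R h x) = (LINT x:A \<inter> {0..1}|lebesgue. h x)"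
      unfolding set_lebesgue_integral_def by (intro Bochner_Integration.integral_cong) (auto simp: indicator_def)
    also have "\<dots> = (LINT x:B \<inter> {0..1}|lebesgue. h x)"
    proof (rule set_integral_cong_set[symmetric])
      have "set_integrable lebesgue (A \<inter> {0..1}) h"
        using A by (intro set_integrable_subset[OF int]) auto
      then show "set_borel_measurable lebesgue (A \<inter> {0..1}) h"
        by (auto simp: set_integrable_def set_borel_measurable_def)
      show "set_borel_measurable lebesgue (B \<inter> {0..1}) h"
        using sI[OF B(1)] by (auto simp: set_integrable_def set_borel_measurable_def)
      show "AE x in lebesgue. (x \<in> A \<inter> {0..1}) = (x \<in> B \<inter> {0..1})"
        using B(2) by eventually_elim auto
    qed
    finally show "(LINT x:A|lebesgue. indicator {0..1} x *\<^sub>R h x) = 0"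
      using borel[OF B(1)] by simp
  qed
  then show ?thesis by eventually_elim (auto simp: indicator_def)
qed

section \<open>Smooth periodic functions separate integrable functions\<close>

text \<open>A class of functions that is closed under differentiation, so that all its members are smooth, and
that is rich enough to contain the bumps used below. The shift in the sine makes a separate rule
for the cosine superfluous.\<close>

inductive elementary :: "(real \<Rightarrow> real) \<Rightarrow> bool" where
  elementary_const: "elementary (\<lambda>x. c)"
| elementary_sin: "elementary (\<lambda>x. sin (a * x + b))"
| elementary_add: "elementary f \<Longrightarrow> elementary g \<Longrightarrow> elementary (\<lambda>x. f x + g x)"
| elementary_mult: "elementary f \<Longrightarrow> elementary g \<Longrightarrow> elementary (\<lambda>x. f x * g x)"
| elementary_exp: "elementary f \<Longrightarrow> elementary (\<lambda>x. exp (f x))"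

lemma elementary_has_derivative:
  "elementary f \<Longrightarrow> \<exists>f'. elementary f' \<and> (\<forall>x. (f has_real_derivative f' x) (at x))"
proof (induction rule: elementary.induct)
  case (elementary_const c)
  show ?case by (intro exI[of _ "\<lambda>x. 0"]) (auto intro: elementary.intros)
next
  case (elementary_sin a b)
  have "elementary (\<lambda>x. a * sin (a * x + (b + pi / 2)))"
    by (intro elementary.intros)
  moreover have "sin (a * x + (b + pi / 2)) = cos (a * x + b)" for x
    using sin_add[of "a * x + b" "pi / 2"] by (simp add: add.assoc)
  ultimately have "elementary (\<lambda>x. a * cos (a * x + b))" by simp
  then show ?case
    by (intro exI[of _ "\<lambda>x. a * cos (a * x + b)"]) (auto intro!: derivative_eq_intros)
next
  case (elementary_add f g)
  then obtain f' g' where "elementary f'" "elementary g'"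
    "\<forall>x. (f has_real_derivative f' x) (at x)" "\<forall>x. (g has_real_derivative g' x) (at x)" by blast
  then show ?case
    by (intro exI[of _ "\<lambda>x. f' x + g' x"]) (auto intro!: elementary.intros derivative_intros)
next
  case (elementary_mult f g)
  then obtain f' g' where *: "elementary f'" "elementary g'"
    "\<forall>x. (f has_real_derivative f' x) (at x)" "\<forall>x. (g has_real_derivative g' x) (at x)" by blast
  have "elementary (\<lambda>x. f' x * g x + g' x * f x)"
    using * elementary_mult by (intro elementary.intros) auto
  then show ?case
    using * by (intro exI[of _ "\<lambda>x. f' x * g x + g' x * f x"]) (auto intro!: DERIV_mult)
next
  case (elementary_exp f)
  then obtain f' where *: "elementary f'" "\<forall>x. (f has_real_derivative f' x) (at x)" by blast
  have "elementary (\<lambda>x. exp (f x) * f' x)"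
    using * elementary_exp by (intro elementary.intros) auto
  then show ?case
    using * by (intro exI[of _ "\<lambda>x. exp (f x) * f' x"]) (auto intro!: DERIV_fun_exp)
qed

lemma elementary_deriv: assumes "elementary f" shows "elementary (deriv f)"
proof -
  obtain f' where "elementary f'" "\<And>x. (f has_real_derivative f' x) (at x)"
    using elementary_has_derivative[OF assms] by blast
  moreover from this(2) have "deriv f = f'" by (intro ext DERIV_imp_deriv)
  ultimately show ?thesis by simp
qed

lemma elementary_smooth: assumes "elementary f" shows "smooth f"
proof -
  have "elementary ((deriv ^^ k) f)" for k
    by (induction k) (auto intro: assms elementary_deriv)
  then show ?thesis
    unfolding smooth_def using elementary_has_derivative real_differentiable_def by blast
qed

lemma smooth_const: "smooth (\<lambda>x. c)"
  by (intro elementary_smooth elementary_const)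

lemma smooth_deriv: "smooth f \<Longrightarrow> smooth (deriv f)"
  unfolding smooth_def by (metis comp_apply funpow_Suc_right)

text \<open>With \<open>smooth_deriv\<close>, this reduces smoothness of a function to smoothness of its derivative, whose
iterated derivatives are the same up to a shift of the index.\<close>

lemma smooth_of_deriv:
  assumes "\<And>x. f differentiable (at x)" "smooth (deriv f)"
  shows "smooth f"
  unfolding smooth_def
proof (intro allI)
  fix k x show "(deriv ^^ k) f differentiable (at x)"
    using assms by (cases k) (auto simp: smooth_def funpow_Suc_right simp del: funpow.simps)
qed

lemma smooth_DERIV: "smooth f \<Longrightarrow> (f has_real_derivative deriv f x) (at x)"
  unfolding smooth_def by (metis DERIV_deriv_iff_real_differentiable funpow_0)

lemma smooth_continuous: "smooth f \<Longrightarrow> continuous_on S f"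
  by (meson smooth_DERIV DERIV_isCont continuous_at_imp_continuous_on)

lemma smooth_continuous_deriv: "smooth f \<Longrightarrow> continuous_on S (deriv f)"
  by (simp add: smooth_continuous smooth_deriv)

lemma smooth_diff_const: assumes "smooth f" shows "smooth (\<lambda>x. f x - c)"
proof (rule smooth_of_deriv)
  have D: "((\<lambda>x. f x - c) has_real_derivative deriv f x) (at x)" for x
    using smooth_DERIV[OF assms, of x] by (auto intro!: derivative_eq_intros)
  show "(\<lambda>x. f x - c) differentiable (at x)" for x
    using D real_differentiable_def by blast
  have "deriv (\<lambda>x. f x - c) = deriv f" using D by (intro ext DERIV_imp_deriv)
  then show "smooth (deriv (\<lambda>x. f x - c))" using smooth_deriv[OF assms] by simp
qed

text \<open>An entire function that approximates the indicator of \<open>{0..b}\<close> on the torus. By the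
product-to-sum formula \<open>2 sin (\<pi> x) sin (\<pi> (b - x)) = cos (\<pi> (2 x - b)) - cos (\<pi> b)\<close>, so the
product of the two sines is 1-periodic; on \<open>(0, 1)\<close> it has the sign of \<open>b - x\<close>. The outer function
\<open>exp (- exp (- y))\<close> is a smooth step from \<open>0\<close> to \<open>1\<close>.\<close>

definition gumbel_bump :: "real \<Rightarrow> nat \<Rightarrow> real \<Rightarrow> real" where
  "gumbel_bump b n x = exp (- exp (- (real n * (sin (pi * x) * sin (pi * (b - x))))))"

lemma smooth_gumbel_bump: "smooth (gumbel_bump b n)"
proof (rule elementary_smooth)
  have "elementary (\<lambda>x. exp ((-1) * exp ((- real n) * (sin (pi * x + 0) * sin ((-pi) * x + pi * b)))))"
    by (intro elementary.intros)
  then show "elementary (gumbel_bump b n)"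
    unfolding gumbel_bump_def by (simp add: algebra_simps)
qed

lemma periodic_gumbel_bump: "periodic1 (gumbel_bump b n)"
proof -
  have "sin (pi * (x + 1)) * sin (pi * (b - (x + 1))) = sin (pi * x) * sin (pi * (b - x))" for x
  proof -
    have "pi * (x + 1) = pi * x + pi" "pi * (b - (x + 1)) = pi * (b - x) - pi"
      by (simp_all add: algebra_simps)
    then show ?thesis by (simp add: sin_diff)
  qed
  then show ?thesis unfolding periodic1_def gumbel_bump_def by simp
qed

lemma gumbel_bump_limit:
  assumes "0 < x" "x < 1" "0 \<le> b" "b \<le> 1" "x \<noteq> b"
  shows "(\<lambda>n. gumbel_bump b n x) \<longlonglongrightarrow> indicator {0..b} x"
proof -
  define p where "p = sin (pi * x) * sin (pi * (b - x))"
  have s: "sin (pi * x) > 0" using assms by (intro sin_gt_zero) auto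
  show ?thesis
  proof (cases "x < b")
    case True
    have "sin (pi * (b - x)) > 0" using assms True by (intro sin_gt_zero) auto
    then have "p > 0" using s by (simp add: p_def)
    then have "filterlim (\<lambda>n. real n * p) at_top sequentially"
      by (intro filterlim_tendsto_pos_mult_at_top[OF tendsto_const, of p, unfolded mult.commute[of p]]
          filterlim_real_sequentially)
    then have "filterlim (\<lambda>n. - (real n * p)) at_bot sequentially"
      by (simp add: filterlim_uminus_at_top)
    then have "(\<lambda>n. exp (- (real n * p))) \<longlonglongrightarrow> 0"
      by (rule filterlim_compose[OF exp_at_bot])
    then have "(\<lambda>n. exp (- exp (- (real n * p)))) \<longlonglongrightarrow> exp (- 0)"
      by (intro tendsto_intros)
    then show ?thesis using True assms unfolding gumbel_bump_def p_def by simp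
  next
    case False
    have "sin (pi * (x - b)) > 0" using assms False by (intro sin_gt_zero) auto
    then have "sin (pi * (b - x)) < 0"
      using sin_minus[of "pi * (x - b)"] by (simp add: algebra_simps)
    then have "- p > 0" using s by (simp add: p_def mult_less_0_iff)
    then have "filterlim (\<lambda>n. real n * (- p)) at_top sequentially"
      by (intro filterlim_tendsto_pos_mult_at_top[OF tendsto_const, of "-p", unfolded mult.commute[of "-p"]]
          filterlim_real_sequentially)
    then have "filterlim (\<lambda>n. exp (- (real n * p))) at_top sequentially"
      by (intro filterlim_compose[OF exp_at_top]) simp
    then have "filterlim (\<lambda>n. - exp (- (real n * p))) at_bot sequentially"
      by (simp add: filterlim_uminus_at_top)
    then have "(\<lambda>n. exp (- exp (- (real n * p)))) \<longlonglongrightarrow> 0"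
      by (rule filterlim_compose[OF exp_at_bot])
    then show ?thesis using False assms unfolding gumbel_bump_def p_def by simp
  qed
qed

lemma gumbel_bump_bounds: "0 \<le> gumbel_bump b n x" "gumbel_bump b n x \<le> 1"
  by (simp_all add: gumbel_bump_def)

text \<open>Testing with the bumps and passing to the limit by dominated convergence shows that the integral
of \<open>h\<close> over each \<open>{0..b}\<close> vanishes.\<close>

lemma smooth_periodic_separate:
  fixes h :: "real \<Rightarrow> real"
  assumes int: "set_integrable lebesgue {0..1} h"
    and zero: "\<And>\<phi>. smooth \<phi> \<Longrightarrow> periodic1 \<phi> \<Longrightarrow> (LINT x:{0..1}|lebesgue. h x * \<phi> x) = 0"
  shows "AE x in lebesgue. x \<in> {0..1} \<longrightarrow> h x = 0"
proof (rule integrals_zero_imp_AE_zero[OF int])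
  fix b :: real assume b: "0 \<le> b" "b \<le> 1"
  have hm: "(\<lambda>x. indicator {0..1} x *\<^sub>R h x) \<in> borel_measurable lebesgue"
    using int by (simp add: set_integrable_def)
  have "(\<lambda>n. LINT x|lebesgue. indicator {0..1} x *\<^sub>R (h x * gumbel_bump b n x))
      \<longlonglongrightarrow> (LINT x|lebesgue. indicator {0..b} x *\<^sub>R h x)"
  proof (rule integral_dominated_convergence[where w = "\<lambda>x. \<bar>indicator {0..1} x *\<^sub>R h x\<bar>"])
    have bm: "gumbel_bump b n \<in> borel_measurable lebesgue" for n
      by (intro measurable_completion)
        (use smooth_continuous[OF smooth_gumbel_bump, of UNIV b n] in
          \<open>simp add: borel_measurable_continuous_onI\<close>)
    have "(\<lambda>x. (indicator {0..1} x *\<^sub>R h x) * gumbel_bump b n x) \<in> borel_measurable lebesgue" for n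
      using hm bm by (intro borel_measurable_times)
    then show "(\<lambda>x. indicator {0..1} x *\<^sub>R (h x * gumbel_bump b n x)) \<in> borel_measurable lebesgue" for n
      by (simp add: mult.assoc)
    have "set_integrable lebesgue {0..b} h"
      using b by (intro set_integrable_subset[OF int]) auto
    then show "(\<lambda>x. indicator {0..b} x *\<^sub>R h x) \<in> borel_measurable lebesgue"
      by (simp add: set_integrable_def)
    show "integrable lebesgue (\<lambda>x. \<bar>indicator {0..1} x *\<^sub>R h x\<bar>)"
      using int unfolding set_integrable_def by (rule integrable_abs)
    show "AE x in lebesgue. norm (indicator {0..1} x *\<^sub>R (h x * gumbel_bump b n x))
        \<le> \<bar>indicator {0..1} x *\<^sub>R h x\<bar>" for n
      using gumbel_bump_bounds[of b n]
      by (intro AE_I2) (auto simp: indicator_def abs_mult intro!: mult_left_le)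
    show "AE x in lebesgue. (\<lambda>n. indicator {0..1} x *\<^sub>R (h x * gumbel_bump b n x))
        \<longlonglongrightarrow> indicator {0..b} x *\<^sub>R h x"
    proof (rule AE_avoiding_finite[of "{0, 1, b}"], simp)
      fix x :: real assume elim: "x \<notin> {0, 1, b}"
      show "(\<lambda>n. indicator {0..1} x *\<^sub>R (h x * gumbel_bump b n x)) \<longlonglongrightarrow> indicator {0..b} x *\<^sub>R h x"
      proof (cases "x \<in> {0..1}")
        case True
        then have "(\<lambda>n. h x * gumbel_bump b n x) \<longlonglongrightarrow> h x * indicator {0..b} x"
          using elim b by (intro tendsto_mult tendsto_const gumbel_bump_limit) auto
        then show ?thesis using True by (simp add: mult.commute)
      next
        case False
        then show ?thesis using b by (auto simp: indicator_def)
      qed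
    qed
  qed
  moreover have "(LINT x|lebesgue. indicator {0..1} x *\<^sub>R (h x * gumbel_bump b n x)) = 0" for n
    using zero[OF smooth_gumbel_bump periodic_gumbel_bump, of b n]
    by (simp add: set_lebesgue_integral_def)
  ultimately show "(LINT x:{0..b}|lebesgue. h x) = 0"
    by (simp add: set_lebesgue_integral_def LIMSEQ_const_iff)
qed

text \<open>The increment of an antiderivative over a period is constant in \<open>x\<close>, and it equals the integral
of \<open>\<psi>\<close> over \<open>{0..1}\<close>.\<close>

lemma smooth_periodic_antiderivative:
  assumes "smooth \<psi>" "periodic1 \<psi>" "(LINT x:{0..1}|lebesgue. \<psi> x) = 0"
  obtains \<phi> where "smooth \<phi>" "periodic1 \<phi>" "deriv \<phi> = \<psi>"
proof -
  have "\<exists>F. \<forall>x::real. -\<infinity> < ereal x \<longrightarrow> ereal x < \<infinity> \<longrightarrow> (F has_vector_derivative \<psi> x) (at x)"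
    using DERIV_isCont[OF smooth_DERIV[OF assms(1)]] by (intro einterval_antiderivative) simp_all
  then have "\<exists>F. \<forall>x. (F has_vector_derivative \<psi> x) (at x)" by simp
  then obtain F where F: "\<And>x. (F has_real_derivative \<psi> x) (at x)"
    unfolding has_real_derivative_iff_has_vector_derivative by blast
  have dF: "deriv F = \<psi>" using F by (intro ext DERIV_imp_deriv)
  have "F differentiable (at x)" for x unfolding real_differentiable_def by (intro exI[of _ "\<psi> x"] F)
  then have "smooth F" by (rule smooth_of_deriv) (use assms(1) dF in simp)
  moreover have "periodic1 F"
    unfolding periodic1_def
  proof
    fix x
    have "((\<lambda>x. F (x + 1) - F x) has_real_derivative 0) (at x)" for x
    proof -
      have "((\<lambda>x. F (x + 1)) has_real_derivative \<psi> (x + 1)) (at x)"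
        using F[of "x + 1"] by (rule DERIV_shift[THEN iffD1])
      then have "((\<lambda>x. F (x + 1) - F x) has_real_derivative \<psi> (x + 1) - \<psi> x) (at x)"
        by (intro DERIV_diff F)
      then show ?thesis using assms(2) by (simp add: periodic1_def)
    qed
    then have "\<forall>x. ((\<lambda>x. F (x + 1) - F x) has_real_derivative 0) (at x)" by blast
    from DERIV_isconst_all[OF this, of x 0] have "F (x + 1) - F x = F 1 - F 0" by simp
    moreover have "F 1 - F 0 = 0"
      using LINT_FTC[OF zero_le_one smooth_continuous[OF assms(1)] F] assms(3) by simp
    ultimately show "F (x + 1) = F x" by simp
  qed
  ultimately show ?thesis by (rule that[OF _ _ dF])
qed

section \<open>Weak gradients and primitives\<close>

lemma L2_integrable: assumes "L2 g" shows "set_integrable lebesgue {0..1} g"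
proof -
  have "set_integrable lebesgue {0..1} (\<lambda>x. 1 + (g x)\<^sup>2)"
    using assms by (intro set_integral_add) (auto simp: L2_def)
  then show ?thesis
  proof (rule set_integrable_bound)
    show "set_borel_measurable lebesgue {0..1} g" using assms by (simp add: L2_def)
    have "\<bar>y\<bar> \<le> 1 + y\<^sup>2" for y :: real
      using zero_le_power2[of "\<bar>y\<bar> - 1"] by (simp add: power2_diff)
    then show "AE x in lebesgue. x \<in> {0..1} \<longrightarrow> norm (g x) \<le> norm (1 + (g x)\<^sup>2)"
      by (auto intro: order_trans)
  qed
qed

lemma L2_diff: assumes "L2 g" "L2 h" shows "L2 (\<lambda>x. g x - h x)"
  unfolding L2_def
proof
  have "(\<lambda>x. indicator {0..1} x *\<^sub>R g x - indicator {0..1} x *\<^sub>R h x) \<in> borel_measurable lebesgue"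
    using assms unfolding L2_def set_borel_measurable_def by (intro borel_measurable_diff) auto
  then show m: "set_borel_measurable lebesgue {0..1} (\<lambda>x. g x - h x)"
    unfolding set_borel_measurable_def by (simp add: right_diff_distrib)
  have "set_integrable lebesgue {0..1} (\<lambda>x. 2 * (g x)\<^sup>2 + 2 * (h x)\<^sup>2)"
    using assms by (intro set_integral_add set_integrable_mult_right) (auto simp: L2_def)
  then show "set_integrable lebesgue {0..1} (\<lambda>x. (g x - h x)\<^sup>2)"
  proof (rule set_integrable_bound)
    have "(\<lambda>x. (indicator {0..1} x *\<^sub>R (g x - h x))\<^sup>2) \<in> borel_measurable lebesgue"
      using m unfolding set_borel_measurable_def by (rule borel_measurable_power)
    moreover have "(\<lambda>x. (indicator {0..1} x *\<^sub>R (g x - h x))\<^sup>2)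
        = (\<lambda>x. indicator {0..1::real} x *\<^sub>R (g x - h x)\<^sup>2)"
      by (auto simp: indicator_def)
    ultimately show "set_borel_measurable lebesgue {0..1} (\<lambda>x. (g x - h x)\<^sup>2)"
      unfolding set_borel_measurable_def by simp
    have "(a - b)\<^sup>2 \<le> 2 * a\<^sup>2 + 2 * b\<^sup>2" for a b :: real
      using zero_le_power2[of "a + b"] by (simp add: power2_diff power2_sum)
    then show "AE x in lebesgue. x \<in> {0..1} \<longrightarrow> norm ((g x - h x)\<^sup>2) \<le> norm (2 * (g x)\<^sup>2 + 2 * (h x)\<^sup>2)"
      by simp
  qed
qed

lemma L2_mult_integrable:
  assumes "L2 g" "L2 h" shows "set_integrable lebesgue {0..1} (\<lambda>x. g x * h x)"
proof (rule set_integrable_bound)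
  show "set_integrable lebesgue {0..1} (\<lambda>x. (g x)\<^sup>2 + (h x)\<^sup>2)"
    using assms unfolding L2_def by (intro set_integral_add) auto
  show "set_borel_measurable lebesgue {0..1} (\<lambda>x. g x * h x)"
    using assms unfolding L2_def by (intro set_borel_measurable_mult) auto
  have "\<bar>a * b\<bar> \<le> a\<^sup>2 + b\<^sup>2" for a b :: real
  proof -
    have "2 * (\<bar>a\<bar> * \<bar>b\<bar>) \<le> a\<^sup>2 + b\<^sup>2"
      using zero_le_power2[of "\<bar>a\<bar> - \<bar>b\<bar>"] by (simp add: power2_diff)
    moreover have "0 \<le> \<bar>a\<bar> * \<bar>b\<bar>" by simp
    ultimately show ?thesis unfolding abs_mult by linarith
  qed
  then show "AE x in lebesgue. x \<in> {0..1} \<longrightarrow> norm (g x * h x) \<le> norm ((g x)\<^sup>2 + (h x)\<^sup>2)" by simp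
qed

lemma continuous_primitive:
  fixes g :: "real \<Rightarrow> real"
  assumes "set_integrable lebesgue {0..1} g"
  shows "continuous_on {0..1} (\<lambda>x. LINT t:{0..x}|lebesgue. g t)"
proof -
  have "continuous_on {0..1} (\<lambda>x. integral {0..x} g)"
    using assms by (intro indefinite_integral_continuous_1 set_lebesgue_integral_eq_integral(1))
  moreover have "integral {0..x} g = (LINT t:{0..x}|lebesgue. g t)" if "x \<in> {0..1}" for x
  proof -
    have "set_integrable lebesgue {0..x} g" using that by (intro set_integrable_subset[OF assms]) auto
    then show ?thesis by (simp add: set_lebesgue_integral_eq_integral)
  qed
  ultimately show ?thesis by (metis (no_types, lifting) continuous_on_cong)
qed

text \<open>Both sides are the integral of \<open>g t * \<phi>' x\<close> over the triangle \<open>0 \<le> t \<le> x \<le> 1\<close>, computed in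
the two orders. Fubini's theorem needs functions that are measurable on the product of two Borel
measures, so \<open>g\<close> is first replaced by a Borel function that agrees with it almost everywhere.\<close>

lemma primitive_integration_by_parts:
  fixes g \<phi> \<phi>' :: "real \<Rightarrow> real"
  assumes g: "set_integrable lebesgue {0..1} g"
    and D: "\<And>x. (\<phi> has_real_derivative \<phi>' x) (at x)" and c: "continuous_on UNIV \<phi>'"
  shows "(LINT x:{0..1}|lebesgue. (LINT t:{0..x}|lebesgue. g t) * \<phi>' x)
    = (LINT t:{0..1}|lebesgue. g t) * \<phi> 1 - (LINT t:{0..1}|lebesgue. g t * \<phi> t)"
proof -
  have "(\<lambda>t. indicator {0..1} t *\<^sub>R g t) \<in> borel_measurable (completion lborel)"
    using g unfolding set_integrable_def by (rule borel_measurable_integrable)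
  then obtain f' where f': "f' \<in> borel_measurable lborel"
    "AE t in lborel. indicator {0..1} t *\<^sub>R g t = f' t"
    using completion_ex_borel_measurable_real by blast
  define f where "f t = indicator {0..1} t * f' t" for t :: real
  have f_meas [measurable]: "f \<in> borel_measurable borel" using f'(1) unfolding f_def by simp
  have f_eq: "AE t in lebesgue. indicator {0..1} t * g t = f t"
    using AE_completion[OF f'(2)] 
  proof eventually_elim
    case (elim t)
    then show ?case by (cases "t \<in> {0..1}") (auto simp: f_def)
  qed
  have [measurable]: "\<phi>' \<in> borel_measurable borel" using c by (rule borel_measurable_continuous_onI)
  have contphi: "continuous_on S \<phi>" for S
    by (meson D DERIV_isCont continuous_at_imp_continuous_on)
  have [measurable]: "\<phi> \<in> borel_measurable borel" using contphi by (rule borel_measurable_continuous_onI)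
  have f_int: "integrable lborel f"
  proof -
    have "integrable lebesgue f"
      using g f_eq unfolding set_integrable_def
      by (subst integrable_cong_AE[symmetric]) (auto simp: set_integrable_def intro: measurable_completion)
    then show ?thesis by (subst (asm) integrable_completion) auto
  qed
  have to_borel: "(LINT t|lebesgue. indicator {0..1} t * g t * h t) = (LINT t|lborel. f t * h t)"
    if [measurable]: "h \<in> borel_measurable borel" for h
  proof -
    have "(LINT t|lebesgue. indicator {0..1} t * g t * h t) = (LINT t|lebesgue. f t * h t)"
    proof (rule integral_cong_AE)
      have "h \<in> borel_measurable lebesgue" by (intro measurable_completion) simp
      with borel_measurable_integrable[OF g[unfolded set_integrable_def real_scaleR_def]]
      show "(\<lambda>t. indicator {0..1} t * g t * h t) \<in> borel_measurable lebesgue"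
        by (rule borel_measurable_times)
      show "(\<lambda>t. f t * h t) \<in> borel_measurable lebesgue" by (intro measurable_completion) simp
      show "AE t in lebesgue. indicator {0..1} t * g t * h t = f t * h t"
        using f_eq by eventually_elim simp
    qed
    also have "\<dots> = (LINT t|lborel. f t * h t)" by (rule integral_completion) simp
    finally show ?thesis .
  qed
  obtain C where C: "\<And>x. x \<in> {0..1} \<Longrightarrow> \<bar>\<phi>' x\<bar> \<le> C"
  proof -
    have "compact (\<phi>' ` {0..1})" using c by (intro compact_continuous_image) (auto intro: continuous_on_subset)
    then obtain C where "\<forall>y\<in>\<phi>' ` {0..1}. norm y \<le> C" using compact_imp_bounded bounded_iff by metis
    then show ?thesis by (intro that[of C]) auto
  qed
  \<comment> \<open>the integrand on the triangle, dominated by a product of integrable functions\<close>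
  define F where "F x t = indicator {0..1} x * \<phi>' x * ((if t \<le> x then 1 else 0) * f t)" for x t :: real
  have prod: "integrable (lborel \<Otimes>\<^sub>M lborel) (\<lambda>(x, t). (C * indicator {0..1::real} x) * \<bar>f t\<bar>)"
  proof (rule lborel_pair.Fubini_integrable)
    have "(\<lambda>z. C * indicator {0..1} (fst z)) \<in> borel_measurable ((lborel :: real measure) \<Otimes>\<^sub>M (lborel :: real measure))"
      by (rule measurable_compose[OF measurable_fst]) simp
    moreover have "(\<lambda>z. \<bar>f (snd z)\<bar>) \<in> borel_measurable ((lborel :: real measure) \<Otimes>\<^sub>M lborel)"
      by (rule measurable_compose[OF measurable_snd]) simp
    ultimately show "(\<lambda>(x, t). (C * indicator {0..1::real} x) * \<bar>f t\<bar>) \<in> borel_measurable (lborel \<Otimes>\<^sub>M lborel)"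
      unfolding split_def by (rule borel_measurable_times)
    have "C \<ge> 0" using C[of 0] by simp
    then have "(\<lambda>x. LINT t|lborel. norm (case (x, t) of (x, t) \<Rightarrow> (C * indicator {0..1::real} x) * \<bar>f t\<bar>))
        = (\<lambda>x. (C * (LINT t|lborel. \<bar>f t\<bar>)) * indicator {0..1::real} x)"
      by (auto simp: abs_mult indicator_def)
    then show "integrable lborel (\<lambda>x. LINT t|lborel. norm (case (x, t) of (x, t) \<Rightarrow> (C * indicator {0..1::real} x) * \<bar>f t\<bar>))"
      by simp
    show "AE x in lborel. integrable lborel (\<lambda>t. case (x, t) of (x, t) \<Rightarrow> (C * indicator {0..1::real} x) * \<bar>f t\<bar>)"
      using f_int by simp
  qed
  have F_int: "integrable (lborel \<Otimes>\<^sub>M lborel) (case_prod F)"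
  proof (rule Bochner_Integration.integrable_bound[OF prod])
    show "case_prod F \<in> borel_measurable (lborel \<Otimes>\<^sub>M lborel)" unfolding F_def by measurable
    have "norm (F x t) \<le> norm ((C * indicator {0..1} x) * \<bar>f t\<bar>)" for x t
      using C[of x] by (auto simp: F_def abs_mult indicator_def intro!: mult_right_mono)
    then show "AE z in lborel \<Otimes>\<^sub>M lborel. norm (case_prod F z) \<le> norm (case z of (x, t) \<Rightarrow> (C * indicator {0..1::real} x) * \<bar>f t\<bar>)"
      by (intro AE_I2) (auto split: prod.split)
  qed
  have inner1: "(LINT t|lborel. F x t) = indicator {0..1} x *\<^sub>R ((LINT t:{0..x}|lebesgue. g t) * \<phi>' x)" for x
  proof (cases "x \<in> {0..1}")
    case True
    have "(LINT t:{0..x}|lebesgue. g t) = (LINT t|lebesgue. indicator {0..1} t * g t * (if t \<le> x then 1 else 0))"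
      using True unfolding set_lebesgue_integral_def
      by (intro Bochner_Integration.integral_cong) (auto simp: indicator_def)
    also have "\<dots> = (LINT t|lborel. f t * (if t \<le> x then 1 else 0))" by (rule to_borel) simp
    finally show ?thesis using True unfolding F_def by (simp add: mult.commute)
  qed (simp add: F_def)
  have inner2: "(LINT x|lborel. F x t) = f t * (\<phi> 1 - \<phi> t)" for t
  proof (cases "t \<in> {0..1}")
    case True
    have "(LINT x|lborel. F x t) = (LINT x|lborel. f t * (indicator {t..1} x *\<^sub>R \<phi>' x))"
      using True unfolding F_def by (intro Bochner_Integration.integral_cong) (auto simp: indicator_def)
    also have "\<dots> = f t * (LINT x|lborel. indicator {t..1} x *\<^sub>R \<phi>' x)" by simp
    also have "(LINT x|lborel. indicator {t..1} x *\<^sub>R \<phi>' x) = (LINT x|lebesgue. indicator {t..1} x *\<^sub>R \<phi>' x)"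
      by (rule integral_completion[symmetric]) simp
    also have "\<dots> = \<phi> 1 - \<phi> t"
      using LINT_FTC[of t 1 \<phi>' \<phi>] True D c continuous_on_subset[OF c]
      by (simp add: set_lebesgue_integral_def)
    finally show ?thesis .
  next
    case False
    then show ?thesis by (simp add: F_def f_def)
  qed
  have fphi: "integrable lborel (\<lambda>t. f t * \<phi> t)"
  proof -
    have "set_integrable lebesgue {0..1} (\<lambda>t. \<phi> t * g t)"
      by (intro set_integrable_mult_continuous g contphi)
    then have "integrable lebesgue (\<lambda>t. f t * \<phi> t)"
      unfolding set_integrable_def
    proof (rule integrable_cong_AE_imp)
      show "(\<lambda>t. f t * \<phi> t) \<in> borel_measurable lebesgue" by (intro measurable_completion) simp
      show "AE t in lebesgue. indicator {0..1} t *\<^sub>R (\<phi> t * g t) = f t * \<phi> t"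
        using f_eq
      proof eventually_elim
        case (elim t)
        show ?case by (simp flip: elim)
      qed
    qed
    then show ?thesis by (subst (asm) integrable_completion) auto
  qed
  have "(LINT x:{0..1}|lebesgue. (LINT t:{0..x}|lebesgue. g t) * \<phi>' x)
      = (LINT x|lebesgue. (LINT t|lborel. F x t))"
    unfolding set_lebesgue_integral_def inner1 by simp
  also have "\<dots> = (LINT x|lborel. (LINT t|lborel. F x t))"
    using F_int by (intro integral_completion) (auto simp: lborel_pair.integrable_fst' split_def
       intro!: borel_measurable_integrable lborel_pair.integrable_fst)
  also have "\<dots> = (LINT t|lborel. (LINT x|lborel. F x t))"
    using lborel_pair.Fubini_integral[OF F_int] by simp
  also have "\<dots> = (LINT t|lborel. f t * \<phi> 1 - f t * \<phi> t)"
    unfolding inner2 by (simp add: algebra_simps)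
  also have "\<dots> = (LINT t|lborel. f t * \<phi> 1) - (LINT t|lborel. f t * \<phi> t)"
    using f_int fphi by (intro Bochner_Integration.integral_diff) auto
  also have "(LINT t|lborel. f t * \<phi> 1) = (LINT t:{0..1}|lebesgue. g t) * \<phi> 1"
    using to_borel[of "\<lambda>_. 1"] by (simp add: set_lebesgue_integral_def)
  also have "(LINT t|lborel. f t * \<phi> t) = (LINT t:{0..1}|lebesgue. g t * \<phi> t)"
    using to_borel[of \<phi>] by (simp add: set_lebesgue_integral_def mult.assoc)
  finally show ?thesis .
qed

text \<open>The periodicity of \<open>v\<close> makes the integral of \<open>g\<close> vanish, and with it the boundary term in the
integration by parts.\<close>

lemma weak_grad_primitive:
  assumes per: "periodic1 v" and L2: "L2 g"
    and v: "\<And>x. 0 \<le> x \<Longrightarrow> x \<le> 1 \<Longrightarrow> v x = v 0 + (LINT t:{0..x}|lebesgue. g t)"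
  shows "weak_grad v g"
  unfolding weak_grad_def
proof (intro conjI allI impI)
  note g = L2_integrable[OF L2]
  have "v 1 = v 0" using per unfolding periodic1_def by (metis add_0)
  then have g0: "(LINT t:{0..1}|lebesgue. g t) = 0" using v[of 1] by simp
  fix \<phi> assume "smooth \<phi> \<and> periodic1 \<phi>"
  then have phi: "smooth \<phi>" "periodic1 \<phi>" by auto
  have phi01: "\<phi> 1 = \<phi> 0" using phi(2) unfolding periodic1_def by (metis add_0)
  have cd: "continuous_on S (deriv \<phi>)" for S by (rule smooth_continuous_deriv[OF phi(1)])
  have "(LINT x:{0..1}|lebesgue. v x * deriv \<phi> x)
      = (LINT x:{0..1}|lebesgue. v 0 * deriv \<phi> x + (LINT t:{0..x}|lebesgue. g t) * deriv \<phi> x)"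
  proof (intro set_lebesgue_integral_cong allI impI)
    fix x :: real assume "x \<in> {0..1}"
    then show "v x * deriv \<phi> x = v 0 * deriv \<phi> x + (LINT t:{0..x}|lebesgue. g t) * deriv \<phi> x"
      using v[of x] by (simp add: distrib_right)
  qed auto
  also have "\<dots> = (LINT x:{0..1}|lebesgue. v 0 * deriv \<phi> x)
      + (LINT x:{0..1}|lebesgue. (LINT t:{0..x}|lebesgue. g t) * deriv \<phi> x)"
    by (intro set_integral_add continuous_set_integrable continuous_intros cd continuous_primitive g)
  also have "(LINT x:{0..1}|lebesgue. v 0 * deriv \<phi> x) = 0"
    using LINT_FTC[of 0 1 "deriv \<phi>" \<phi>] smooth_DERIV[OF phi(1)] cd phi01 by simp
  also have "(LINT x:{0..1}|lebesgue. (LINT t:{0..x}|lebesgue. g t) * deriv \<phi> x)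
      = - (LINT t:{0..1}|lebesgue. g t * \<phi> t)"
    using primitive_integration_by_parts[OF g smooth_DERIV[OF phi(1)] cd] g0 by simp
  finally show "(LINT x:{0..1}|lebesgue. v x * deriv \<phi> x) = - (LINT x:{0..1}|lebesgue. g x * \<phi> x)"
    by simp
qed (rule L2)

lemma weak_grad_L2: "weak_grad v g \<Longrightarrow> L2 g"
  unfolding weak_grad_def by (rule conjunct1)

lemma weak_grad_integrable: "weak_grad v g \<Longrightarrow> set_integrable lebesgue {0..1} g"
  unfolding weak_grad_def by (elim conjE) (rule L2_integrable)

lemma weak_gradD:
  assumes "weak_grad v g" "smooth \<phi>" "periodic1 \<phi>"
  shows "(LINT x:{0..1}|lebesgue. v x * deriv \<phi> x) = - (LINT x:{0..1}|lebesgue. g x * \<phi> x)"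
  using assms unfolding weak_grad_def by blast

lemma weak_grad_unique:
  assumes "weak_grad v g" "weak_grad v h"
  shows "AE x in lebesgue. x \<in> {0..1} \<longrightarrow> g x = h x"
proof -
  have g: "set_integrable lebesgue {0..1} g" and h: "set_integrable lebesgue {0..1} h"
    using assms by (auto intro: weak_grad_integrable)
  have "AE x in lebesgue. x \<in> {0..1} \<longrightarrow> g x - h x = 0"
  proof (rule smooth_periodic_separate)
    show "set_integrable lebesgue {0..1} (\<lambda>x. g x - h x)" using g h by (rule set_integral_diff)
    fix \<phi> assume phi: "smooth \<phi>" "periodic1 \<phi>"
    have i: "set_integrable lebesgue {0..1} (\<lambda>x. f x * \<phi> x)" if "set_integrable lebesgue {0..1} f" for f
      using set_integrable_mult_continuous[OF that smooth_continuous[OF phi(1)]] by (simp add: mult.commute)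
    have "(LINT x:{0..1}|lebesgue. g x * \<phi> x - h x * \<phi> x)
        = (LINT x:{0..1}|lebesgue. g x * \<phi> x) - (LINT x:{0..1}|lebesgue. h x * \<phi> x)"
      by (intro set_integral_diff i g h)
    moreover have "- (LINT x:{0..1}|lebesgue. g x * \<phi> x) = - (LINT x:{0..1}|lebesgue. h x * \<phi> x)"
      using weak_gradD[OF assms(1) phi] weak_gradD[OF assms(2) phi] by simp
    ultimately show "(LINT x:{0..1}|lebesgue. (g x - h x) * \<phi> x) = 0" by (simp add: left_diff_distrib)
  qed
  then show ?thesis by simp
qed

text \<open>The lemma of du Bois-Reymond: \<open>v\<close> minus the primitive of \<open>g\<close> is orthogonal to all derivatives of
smooth periodic functions. These are all smooth periodic functions of mean zero, so the difference
is a constant almost everywhere, and everywhere by continuity.\<close>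

lemma weak_grad_FTC_from_0:
  assumes per: "periodic1 v" and cont: "continuous_on UNIV v" and wg: "weak_grad v g"
    and x: "0 \<le> x" "x \<le> 1"
  shows "v x = v 0 + (LINT t:{0..x}|lebesgue. g t)"
proof -
  have g: "set_integrable lebesgue {0..1} g" using wg by (rule weak_grad_integrable)
  \<comment> \<open>test with the constant \<open>1\<close>\<close>
  have g0: "(LINT t:{0..1}|lebesgue. g t) = 0"
  proof -
    have "periodic1 (\<lambda>x. 1)" by (simp add: periodic1_def)
    from weak_gradD[OF wg smooth_const this] show ?thesis by simp
  qed
  define h where "h x = v x - (LINT t:{0..x}|lebesgue. g t)" for x
  have hc: "continuous_on {0..1} h"
    unfolding h_def by (intro continuous_intros continuous_primitive g continuous_on_subset[OF cont]) auto
  have hi: "set_integrable lebesgue {0..1} h" by (rule continuous_set_integrable[OF hc])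
  have orth: "(LINT x:{0..1}|lebesgue. h x * \<psi> x) = 0"
    if psi: "smooth \<psi>" "periodic1 \<psi>" "(LINT x:{0..1}|lebesgue. \<psi> x) = 0" for \<psi>
  proof -
    obtain \<phi> where phi: "smooth \<phi>" "periodic1 \<phi>" "deriv \<phi> = \<psi>"
      using smooth_periodic_antiderivative[OF psi] .
    have cd: "continuous_on S \<psi>" for S by (rule smooth_continuous[OF psi(1)])
    have "(LINT x:{0..1}|lebesgue. h x * \<psi> x) = (LINT x:{0..1}|lebesgue. v x * \<psi> x)
       - (LINT x:{0..1}|lebesgue. (LINT t:{0..x}|lebesgue. g t) * \<psi> x)"
      unfolding h_def left_diff_distrib
      by (intro set_integral_diff continuous_set_integrable continuous_intros cd continuous_primitive g
          continuous_on_subset[OF cont]) auto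
    also have "(LINT x:{0..1}|lebesgue. v x * \<psi> x) = - (LINT x:{0..1}|lebesgue. g x * \<phi> x)"
      using weak_gradD[OF wg phi(1,2)] phi(3) by simp
    also have "(LINT x:{0..1}|lebesgue. (LINT t:{0..x}|lebesgue. g t) * \<psi> x)
        = - (LINT x:{0..1}|lebesgue. g x * \<phi> x)"
      using primitive_integration_by_parts[OF g, of \<phi> \<psi>] smooth_DERIV[OF phi(1)] phi(3) cd g0 by simp
    finally show ?thesis by simp
  qed
  define m where "m = (LINT x:{0..1}|lebesgue. h x)"
  have "AE x in lebesgue. x \<in> {0..1} \<longrightarrow> h x - m = 0"
  proof (rule smooth_periodic_separate)
    show "set_integrable lebesgue {0..1} (\<lambda>x. h x - m)"
      by (intro continuous_set_integrable continuous_intros hc)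
    fix \<psi> assume psi: "smooth \<psi>" "periodic1 \<psi>"
    \<comment> \<open>only \<open>\<psi> - c\<close> is a derivative; subtracting the mean \<open>m\<close> of \<open>h\<close> compensates for \<open>c\<close>\<close>
    define c where "c = (LINT x:{0..1}|lebesgue. \<psi> x)"
    have cp: "continuous_on S \<psi>" for S by (rule smooth_continuous[OF psi(1)])
    have one: "(LINT x:{0..1::real}|lebesgue. k) = k" for k :: real
      by (simp add: set_lebesgue_integral_def)
    have "(LINT x:{0..1}|lebesgue. h x * (\<psi> x - c)) = 0"
    proof (rule orth)
      show "smooth (\<lambda>x. \<psi> x - c)" by (rule smooth_diff_const[OF psi(1)])
      show "periodic1 (\<lambda>x. \<psi> x - c)" using psi(2) by (simp add: periodic1_def)
      have "(LINT x:{0..1}|lebesgue. \<psi> x - c) = (LINT x:{0..1}|lebesgue. \<psi> x) - (LINT x:{0..1::real}|lebesgue. c)"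
        by (intro set_integral_diff continuous_set_integrable continuous_intros cp)
      then show "(LINT x:{0..1}|lebesgue. \<psi> x - c) = 0" by (simp add: one c_def)
    qed
    moreover have "(LINT x:{0..1}|lebesgue. h x * (\<psi> x - c))
        = (LINT x:{0..1}|lebesgue. h x * \<psi> x) - (LINT x:{0..1}|lebesgue. h x * c)"
      unfolding right_diff_distrib
      by (intro set_integral_diff continuous_set_integrable continuous_intros cp hc)
    moreover have "(LINT x:{0..1}|lebesgue. (h x - m) * \<psi> x)
        = (LINT x:{0..1}|lebesgue. h x * \<psi> x) - (LINT x:{0..1}|lebesgue. m * \<psi> x)"
      unfolding left_diff_distrib
      by (intro set_integral_diff continuous_set_integrable continuous_intros cp hc)
    ultimately show "(LINT x:{0..1}|lebesgue. (h x - m) * \<psi> x) = 0"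
      by (simp add: m_def c_def)
  qed
  then have ae: "AE x in lebesgue. x \<in> {0..1} \<longrightarrow> h x - m = 0" .
  have "(LINT x:{0..1}|lebesgue. \<bar>h x - m\<bar>) = (LINT x:{0..1::real}|lebesgue. 0)"
    using ae by (intro LINT_cong_AE) (auto intro!: continuous_set_borel_measurable continuous_intros hc elim: eventually_mono)
  moreover have hmc: "continuous_on {0..1} (\<lambda>x. \<bar>h x - m\<bar>)" by (intro continuous_intros hc)
  ultimately have "integral {0..1} (\<lambda>x. \<bar>h x - m\<bar>) = 0"
    using set_lebesgue_integral_eq_integral(2)[OF continuous_set_integrable[OF hmc]] by simp
  then have "h x = m" "h 0 = m" using integral_eq_0_iff[OF hmc] x by auto
  moreover have "(LINT t:{0..0}|lebesgue. g t) = 0"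
    using set_lebesgue_integral_eq_integral(2)[OF set_integrable_subset[OF g], of "{0..0}"] by simp
  ultimately show ?thesis by (simp add: h_def)
qed

lemma weak_grad_FTC:
  assumes per: "periodic1 v" and cont: "continuous_on UNIV v" and wg: "weak_grad v g"
    and x: "0 \<le> x" "x \<le> y" "y \<le> 1"
  shows "(LINT t:{x..y}|lebesgue. g t) = v y - v x"
proof -
  have "set_integrable lebesgue {0..y} g"
    using x by (intro set_integrable_subset[OF weak_grad_integrable[OF wg]]) auto
  from LINT_combine[OF this x(1,2)] weak_grad_FTC_from_0[OF per cont wg, of x] weak_grad_FTC_from_0[OF per cont wg, of y] x
  show ?thesis by simp
qed

lemma weak_grad_diff:
  assumes u: "weak_grad u g" "continuous_on UNIV u" and v: "weak_grad v h" "continuous_on UNIV v"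
  shows "weak_grad (\<lambda>x. u x - v x) (\<lambda>x. g x - h x)"
  unfolding weak_grad_def
proof (intro conjI allI impI)
  show "L2 (\<lambda>x. g x - h x)" by (intro L2_diff weak_grad_L2[OF u(1)] weak_grad_L2[OF v(1)])
  fix \<phi> assume "smooth \<phi> \<and> periodic1 \<phi>"
  then have phi: "smooth \<phi>" "periodic1 \<phi>" by auto
  have i: "set_integrable lebesgue {0..1} (\<lambda>x. f x * \<phi> x)" if "set_integrable lebesgue {0..1} f" for f
    using set_integrable_mult_continuous[OF that smooth_continuous[OF phi(1)]] by (simp add: mult.commute)
  have "(LINT x:{0..1}|lebesgue. (u x - v x) * deriv \<phi> x)
      = (LINT x:{0..1}|lebesgue. u x * deriv \<phi> x) - (LINT x:{0..1}|lebesgue. v x * deriv \<phi> x)"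
    unfolding left_diff_distrib
    by (intro set_integral_diff continuous_set_integrable continuous_intros smooth_continuous_deriv[OF phi(1)]
        continuous_on_subset[OF u(2)] continuous_on_subset[OF v(2)]) auto
  moreover have "(LINT x:{0..1}|lebesgue. (g x - h x) * \<phi> x)
      = (LINT x:{0..1}|lebesgue. g x * \<phi> x) - (LINT x:{0..1}|lebesgue. h x * \<phi> x)"
    unfolding left_diff_distrib
    by (intro set_integral_diff i weak_grad_integrable[OF u(1)] weak_grad_integrable[OF v(1)])
  ultimately show "(LINT x:{0..1}|lebesgue. (u x - v x) * deriv \<phi> x)
      = - (LINT x:{0..1}|lebesgue. (g x - h x) * \<phi> x)"
    using weak_gradD[OF u(1) phi] weak_gradD[OF v(1) phi] by simp
qed

lemma H1_per_weak_grad: "v \<in> H1_per \<Longrightarrow> weak_grad v (grad v)"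
  unfolding H1_per_def grad_def by (auto intro: someI_ex[of "weak_grad v"])

lemma H1_per_diff:
  assumes "u \<in> H1_per" "v \<in> H1_per" shows "(\<lambda>x. u x - v x) \<in> H1_per"
proof -
  have "weak_grad (\<lambda>x. u x - v x) (\<lambda>x. grad u x - grad v x)"
    using assms by (intro weak_grad_diff H1_per_weak_grad) (auto simp: H1_per_def)
  moreover have "periodic1 (\<lambda>x. u x - v x)" "continuous_on UNIV (\<lambda>x. u x - v x)"
    using assms by (auto simp: H1_per_def periodic1_def intro!: continuous_on_diff)
  ultimately show ?thesis unfolding H1_per_def by blast
qed

lemma grad_diff:
  assumes "u \<in> H1_per" "v \<in> H1_per"
  shows "AE x in lebesgue. x \<in> {0..1} \<longrightarrow> grad (\<lambda>x. u x - v x) x = grad u x - grad v x"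
  using assms by (intro weak_grad_unique[OF H1_per_weak_grad[OF H1_per_diff]] weak_grad_diff H1_per_weak_grad)
    (auto simp: H1_per_def)

lemma H1_per_grad_L2: "v \<in> H1_per \<Longrightarrow> L2 (grad v)"
  by (rule weak_grad_L2[OF H1_per_weak_grad])

lemma H1_per_grad_FTC:
  assumes "v \<in> H1_per" "0 \<le> x" "x \<le> y" "y \<le> 1"
  shows "(LINT t:{x..y}|lebesgue. grad v t) = v y - v x"
proof -
  have "periodic1 v" "continuous_on UNIV v" using assms(1) by (auto simp: H1_per_def)
  from weak_grad_FTC[OF this H1_per_weak_grad[OF assms(1)] assms(2-4)] show ?thesis .
qed

lemma set_borel_measurable_grad:
  assumes "v \<in> H1_per" "{p..q} \<subseteq> {0..1}" shows "set_borel_measurable lebesgue {p..q} (grad v)"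
proof -
  have "set_integrable lebesgue {p..q} (grad v)"
    by (rule set_integrable_subset[OF L2_integrable[OF H1_per_grad_L2[OF assms(1)]]]) (use assms(2) in auto)
  then show ?thesis by (simp add: set_borel_measurable_def set_integrable_def)
qed

section \<open>Periodic primitives\<close>

text \<open>The candidates for the corrector are built in this form: the primitive of \<open>g\<close> on \<open>{0..1}\<close>,
extended periodically.\<close>

definition periodic_primitive :: "(real \<Rightarrow> real) \<Rightarrow> real \<Rightarrow> real" where
  "periodic_primitive g x = (LINT t:{0..frac x}|lebesgue. g t)"

lemma periodic_primitive_unit:
  assumes "(LINT t:{0..1}|lebesgue. g t) = 0" "0 \<le> x" "x \<le> 1"
  shows "periodic_primitive g x = (LINT t:{0..x}|lebesgue. g t)"
proof (cases "x = 1")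
  case True
  then show ?thesis using assms LINT_singleton[of 0 g] by (simp add: periodic_primitive_def)
next
  case False
  then have "frac x = x" using assms by (simp add: frac_eq)
  then show ?thesis by (simp add: periodic_primitive_def)
qed

lemma periodic_periodic_primitive: "periodic1 (periodic_primitive g)"
  by (simp add: periodic1_def periodic_primitive_def frac_1_eq)

lemma periodic1_int: assumes "periodic1 f" shows "f (x + of_int k) = f x"
proof (induction k rule: int_induct[of _ 0])
  case (step1 i)
  then show ?case using assms[unfolded periodic1_def, rule_format, of "x + of_int i"] by (simp add: add.assoc)
next
  case (step2 i)
  then show ?case using assms[unfolded periodic1_def, rule_format, of "x + of_int (i - 1)"]
    by (simp add: algebra_simps)
qed simp

text \<open>Each point is interior to the union of three neighbouring periods, each of which is closed and
carries a translate of \<open>f\<close>.\<close>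

lemma continuous_periodic_extension:
  assumes per: "periodic1 f" and c: "continuous_on {0..1} f"
  shows "continuous_on UNIV f"
proof -
  have cell: "continuous_on {of_int k..of_int k + 1} f" for k :: int
  proof -
    have "continuous_on {of_int k..of_int k + 1} (\<lambda>x. f (x - of_int k))"
      by (intro continuous_on_compose2[OF c] continuous_intros) auto
    moreover have "f (x - of_int k) = f x" for x
      using periodic1_int[OF per, of x "-k"] by simp
    ultimately show ?thesis by simp
  qed
  have "isCont f x" for x
  proof -
    define k where "k = \<lfloor>x\<rfloor>"
    have k: "of_int k \<le> x" "x < of_int k + 1" unfolding k_def by linarith+
    have "continuous_on ({of_int (k - 1)..of_int (k - 1) + 1} \<union> ({of_int k..of_int k + 1}
        \<union> {of_int (k + 1)..of_int (k + 1) + 1})) f"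
      by (intro continuous_on_closed_Un cell closed_Un closed_atLeastAtMost)
    then have "continuous_on {of_int k - 1<..<of_int k + 2} f"
      by (rule continuous_on_subset) auto
    moreover have "x \<in> {of_int k - 1<..<of_int k + 2}" using k by auto
    ultimately show ?thesis by (simp add: continuous_on_eq_continuous_at del: greaterThanLessThan_iff)
  qed
  then show ?thesis by (simp add: continuous_at_imp_continuous_on)
qed

lemma continuous_periodic_primitive:
  assumes "set_integrable lebesgue {0..1} g" "(LINT t:{0..1}|lebesgue. g t) = 0"
  shows "continuous_on UNIV (periodic_primitive g)"
proof (rule continuous_periodic_extension[OF periodic_periodic_primitive])
  show "continuous_on {0..1} (periodic_primitive g)"
    using continuous_primitive[OF assms(1)]
    by (rule continuous_on_eq) (simp add: periodic_primitive_unit[OF assms(2)])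
qed

lemma weak_grad_periodic_primitive:
  assumes "L2 g" "(LINT t:{0..1}|lebesgue. g t) = 0"
  shows "weak_grad (periodic_primitive g) g"
proof (rule weak_grad_primitive[OF periodic_periodic_primitive assms(1)])
  fix x :: real assume "0 \<le> x" "x \<le> 1"
  then show "periodic_primitive g x = periodic_primitive g 0 + (LINT t:{0..x}|lebesgue. g t)"
    using periodic_primitive_unit[OF assms(2), of x] periodic_primitive_unit[OF assms(2), of 0]
      LINT_singleton[of 0 g] by simp
qed

lemma periodic_primitive_H1:
  assumes "L2 g" "(LINT t:{0..1}|lebesgue. g t) = 0"
  shows "periodic_primitive g \<in> H1_per"
  unfolding H1_per_def
  using periodic_periodic_primitive continuous_periodic_primitive[OF L2_integrable[OF assms(1)] assms(2)]
    weak_grad_periodic_primitive[OF assms] by blast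

section \<open>Piecewise affine functions and the coarse mesh\<close>

text \<open>Enough structure to differentiate a piecewise affine function outside finitely many points; the
coarse mesh and every \<open>is_mesh\<close> have it.\<close>

definition interval_cover :: "real set set \<Rightarrow> bool" where
  "interval_cover \<T> \<longleftrightarrow> finite \<T> \<and> {0..1} \<subseteq> \<Union>\<T> \<and> (\<forall>K\<in>\<T>. \<exists>p q. K = {p..q})"

lemma is_mesh_interval_cover: "is_mesh \<T> \<Longrightarrow> interval_cover \<T>"
  unfolding is_mesh_def interval_cover_def division_of_def by (auto simp: cbox_interval)

text \<open>A continuous piecewise affine function is the integral of its derivative, which exists and is
bounded outside the finite set of end points.\<close>

lemma P1_per_H1_deriv:
  assumes cov: "interval_cover \<T>" and v: "v \<in> P1_per \<T>"
  shows "v \<in> H1_per" and "AE x in lebesgue. x \<in> {0..1} \<longrightarrow> grad v x = deriv v x"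
proof -
  have per: "periodic1 v" and cont: "continuous_on UNIV v"
    and aff: "\<forall>K\<in>\<T>. \<exists>c d. \<forall>x\<in>K. v x = c + d * x"
    using v by (auto simp: P1_per_def)
  have fin: "finite \<T>" using cov by (simp add: interval_cover_def)
  from bchoice[OF aff] obtain c where "\<forall>K\<in>\<T>. \<exists>d. \<forall>x\<in>K. v x = c K + d * x" by blast
  from bchoice[OF this] obtain d where cd: "\<And>K x. K \<in> \<T> \<Longrightarrow> x \<in> K \<Longrightarrow> v x = c K + d K * x"
    by blast
  have "\<forall>K\<in>\<T>. \<exists>p q. K = {p..q}" using cov by (simp add: interval_cover_def)
  from bchoice[OF this] obtain l where "\<forall>K\<in>\<T>. \<exists>q. K = {l K..q}" by blast
  from bchoice[OF this] obtain r where lr: "\<And>K. K \<in> \<T> \<Longrightarrow> K = {l K..r K}" by blast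
  define S where "S = l ` \<T> \<union> r ` \<T>"
  have S: "finite S" using fin by (simp add: S_def)
  have D: "\<exists>K\<in>\<T>. (v has_real_derivative d K) (at x)" if x: "x \<in> {0..1} - S" for x
  proof -
    have "{0..1} \<subseteq> \<Union>\<T>" using cov by (simp add: interval_cover_def)
    with x obtain K where K: "K \<in> \<T>" "x \<in> K" by blast
    have "l K \<noteq> x" "r K \<noteq> x" using K x by (auto simp: S_def)
    moreover have mem: "z \<in> K \<longleftrightarrow> l K \<le> z \<and> z \<le> r K" for z
      using eqset_imp_iff[OF lr[OF K(1)], of z] by simp
    moreover have "l K \<le> x" "x \<le> r K" using K(2) by (simp_all add: mem)
    ultimately have xi: "x \<in> {l K<..<r K}" by auto
    have "((\<lambda>x. c K + d K * x) has_real_derivative d K) (at x)"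
      using DERIV_add[OF DERIV_const[of "c K" "at x"] DERIV_cmult_Id[of "d K" x]] by simp
    then have "(v has_real_derivative d K) (at x)"
    proof (rule has_field_derivative_transform_within_open[OF _ _ xi])
      fix y assume "y \<in> {l K<..<r K}"
      then have "y \<in> K" by (simp add: mem)
      then show "c K + d K * y = v y" using cd[OF K(1)] by simp
    qed auto
    then show ?thesis using K(1) by blast
  qed
  \<comment> \<open>at the end points \<open>deriv v\<close> is an unknown number, which could violate the bound\<close>
  define g where "g x = (if x \<in> S then 0 else deriv v x)" for x
  define C where "C = (\<Sum>K\<in>\<T>. \<bar>d K\<bar>)"
  have C0: "C \<ge> 0" unfolding C_def by (intro sum_nonneg) auto
  have bound: "\<bar>g x\<bar> \<le> C" if x01: "x \<in> {0..1}" for x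
  proof (cases "x \<in> S")
    case False
    then obtain K where K: "K \<in> \<T>" "(v has_real_derivative d K) (at x)" using D[of x] x01 by blast
    then have "deriv v x = d K" by (intro DERIV_imp_deriv)
    moreover have "\<bar>d K\<bar> \<le> C"
      unfolding C_def by (rule member_le_sum[OF K(1)]) (simp_all add: fin)
    ultimately show ?thesis using False by (simp add: g_def)
  qed (simp add: g_def C0)
  have hi: "(g has_integral (v x - v 0)) {0..x}" if "0 \<le> x" "x \<le> 1" for x
  proof (rule fundamental_theorem_of_calculus_interior_strong[OF S that(1)])
    fix y assume y: "y \<in> {0<..<x} - S"
    then have "y \<in> {0..1} - S" using that by auto
    then obtain K where "(v has_real_derivative d K) (at y)" using D by blast
    then have "(v has_real_derivative deriv v y) (at y)" using DERIV_imp_deriv by metis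
    then show "(v has_vector_derivative g y) (at y)"
      using y by (simp add: g_def has_real_derivative_iff_has_vector_derivative)
  qed (rule continuous_on_subset[OF cont], simp)
  have gi: "set_integrable lebesgue {0..1} g"
  proof (rule absolutely_integrable_integrable_bound[where g = "\<lambda>_. C"])
    show "g integrable_on {0..1}" by (rule has_integral_integrable[OF hi[of 1]]) simp_all
  qed (auto simp: bound)
  have L2: "L2 g"
    unfolding L2_def
  proof
    show m: "set_borel_measurable lebesgue {0..1} g"
      using gi by (simp add: set_integrable_def set_borel_measurable_def)
    have "set_integrable lebesgue {0..1} (\<lambda>x. g x * g x)"
      using bound by (intro set_integrable_mult_bounded[OF gi m, of C]) auto
    then show "set_integrable lebesgue {0..1} (\<lambda>x. (g x)\<^sup>2)" by (simp add: power2_eq_square)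
  qed
  have wg: "weak_grad v g"
  proof (rule weak_grad_primitive[OF per L2])
    fix x :: real assume x: "0 \<le> x" "x \<le> 1"
    have "set_integrable lebesgue {0..x} g" using x by (intro set_integrable_subset[OF gi]) auto
    then show "v x = v 0 + (LINT t:{0..x}|lebesgue. g t)"
      using hi[OF x] by (simp add: set_lebesgue_integral_eq_integral integral_unique)
  qed
  with per cont show H1: "v \<in> H1_per" unfolding H1_per_def by blast
  have "AE x in lebesgue. x \<notin> S" by (rule AE_avoiding_finite[OF S])
  with weak_grad_unique[OF H1_per_weak_grad[OF H1] wg]
  show "AE x in lebesgue. x \<in> {0..1} \<longrightarrow> grad v x = deriv v x"
    by eventually_elim (simp add: g_def)
qed

lemma P1_per_grad_affine:
  assumes "interval_cover \<T>" "v \<in> P1_per \<T>" "\<And>x. x \<in> {p..q} \<Longrightarrow> v x = c + d * x"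
    and "{p..q} \<subseteq> {0..1}"
  shows "AE x in lebesgue. x \<in> {p..q} \<longrightarrow> grad v x = d"
proof -
  have der: "deriv v x = d" if x: "x \<in> {p<..<q}" for x
  proof -
    have "((\<lambda>x. c + d * x) has_real_derivative d) (at x)"
      using DERIV_add[OF DERIV_const[of c "at x"] DERIV_cmult_Id[of d x]] by simp
    then have "(v has_real_derivative d) (at x)"
      by (rule has_field_derivative_transform_within_open[OF _ _ x]) (auto simp: assms(3))
    then show ?thesis by (rule DERIV_imp_deriv)
  qed
  have "AE x in lebesgue. x \<in> {p..q} \<longrightarrow> x \<in> {p<..<q}"
    by (rule AE_avoiding_finite[of "{p, q}"]) auto
  with P1_per_H1_deriv(2)[OF assms(1,2)] show ?thesis
    by eventually_elim (use assms(4) der in auto)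
qed

lemma P1_per_diff:
  assumes "u \<in> P1_per \<T>" "v \<in> P1_per \<T>" shows "(\<lambda>x. u x - v x) \<in> P1_per \<T>"
proof -
  have "\<exists>c d. \<forall>x\<in>K. u x - v x = c + d * x" if "K \<in> \<T>" for K
  proof -
    from assms that obtain c d c' d' where "\<forall>x\<in>K. u x = c + d * x" "\<forall>x\<in>K. v x = c' + d' * x"
      unfolding P1_per_def by blast
    then show ?thesis
      by (intro exI[of _ "c - c'"] exI[of _ "d - d'"]) (simp add: algebra_simps)
  qed
  then show ?thesis
    using assms by (auto simp: P1_per_def periodic1_def intro!: continuous_on_diff)
qed

lemma periodic_primitive_P1:
  assumes mesh: "is_mesh \<T>" and g: "set_integrable lebesgue {0..1} g" "(LINT t:{0..1}|lebesgue. g t) = 0"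
    and const: "const_on_elements \<T> g"
  shows "periodic_primitive g \<in> P1_per \<T>"
proof -
  have "\<exists>c d. \<forall>x\<in>K. periodic_primitive g x = c + d * x" if K: "K \<in> \<T>" for K
  proof -
    have div: "\<T> division_of {0..1}" using mesh by (simp add: is_mesh_def)
    obtain p q where pq: "K = {p..q}" using division_ofD(4)[OF div K] by (auto simp: cbox_interval)
    have sub: "{p..q} \<subseteq> {0..1}" "p \<le> q" using division_ofD(2,3)[OF div K] pq by auto
    obtain d where d: "AE x in lebesgue. x \<in> K \<longrightarrow> g x = d" using const K by (auto simp: const_on_elements_def)
    have "periodic_primitive g x = (periodic_primitive g p - d * p) + d * x" if x: "x \<in> K" for x
    proof -
      have px: "0 \<le> p" "p \<le> x" "x \<le> 1" "p \<le> 1" using x pq sub by auto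
      have gx: "set_integrable lebesgue {0..x} g" using px by (intro set_integrable_subset[OF g(1)]) auto
      have gpx: "set_integrable lebesgue {p..x} g" using px by (intro set_integrable_subset[OF g(1)]) auto
      have "(LINT t:{p..x}|lebesgue. g t) = (LINT t:{p..x}|lebesgue. d)"
      proof (rule LINT_cong_AE)
        show "set_borel_measurable lebesgue {p..x} g"
          using gpx by (simp add: set_integrable_def set_borel_measurable_def)
        show "set_borel_measurable lebesgue {p..x} (\<lambda>_. d)"
          by (intro continuous_set_borel_measurable continuous_intros)
        show "AE t in lebesgue. t \<in> {p..x} \<longrightarrow> g t = d"
          using d by eventually_elim (use x pq in auto)
      qed
      also have "\<dots> = d * (x - p)" using px by (simp add: set_lebesgue_integral_def)
      finally show ?thesis
        using LINT_combine[OF gx px(1,2)] px periodic_primitive_unit[OF g(2), of x]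
          periodic_primitive_unit[OF g(2), of p] by (simp add: algebra_simps)
    qed
    then show ?thesis by blast
  qed
  then show ?thesis
    using periodic_periodic_primitive continuous_periodic_primitive[OF g] by (simp add: P1_per_def)
qed

lemma const_on_elements_combine:
  assumes "const_on_elements \<T> f" "const_on_elements \<T> g"
  shows "const_on_elements \<T> (\<lambda>x. h (f x) (g x))"
  unfolding const_on_elements_def
proof
  fix K assume "K \<in> \<T>"
  then obtain c d where "AE x in lebesgue. x \<in> K \<longrightarrow> f x = c" "AE x in lebesgue. x \<in> K \<longrightarrow> g x = d"
    using assms unfolding const_on_elements_def by blast
  then have "AE x in lebesgue. x \<in> K \<longrightarrow> h (f x) (g x) = h c d" by eventually_elim simp
  then show "\<exists>e. AE x in lebesgue. x \<in> K \<longrightarrow> h (f x) (g x) = e" by blast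
qed

lemma const_on_elements_const: "const_on_elements \<T> (\<lambda>x. c)"
  unfolding const_on_elements_def by (intro ballI exI[of _ c]) simp

lemma const_on_elements_sum:
  assumes "finite J" "\<forall>j\<in>J. const_on_elements \<T> (f j)"
  shows "const_on_elements \<T> (\<lambda>x. \<Sum>j\<in>J. c j * f j x)"
  using assms
proof (induction J rule: finite_induct)
  case empty
  then show ?case by (simp add: const_on_elements_const)
next
  case (insert j J)
  then have "const_on_elements \<T> (f j)" "const_on_elements \<T> (\<lambda>x. \<Sum>j\<in>J. c j * f j x)" by auto
  from const_on_elements_combine[OF this, of "\<lambda>a b. c j * a + b"]
  show ?case using insert.hyps by simp
qed

lemma const_on_elements_indicator_coarse:
  assumes H: "0 < H" and sub: "\<forall>K\<in>\<T>. \<exists>T\<in>coarse_mesh H. K \<subseteq> T"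
  shows "const_on_elements \<T> (indicat_real {real t * H..real (Suc t) * H})"
  unfolding const_on_elements_def
proof
  let ?T = "{real t * H..real (Suc t) * H}"
  fix K assume "K \<in> \<T>"
  then obtain u where K: "K \<subseteq> {real u * H..real (Suc u) * H}" using sub by (auto simp: coarse_mesh_def)
  have "AE x in lebesgue. x \<in> K \<longrightarrow> indicat_real ?T x = (if u = t then 1 else 0)"
  proof (rule AE_avoiding_finite[of "{real t * H, real (Suc t) * H}"])
    fix x assume x: "x \<notin> {real t * H, real (Suc t) * H}"
    show "x \<in> K \<longrightarrow> indicat_real ?T x = (if u = t then 1 else 0)"
    proof
      assume "x \<in> K"
      then have xu: "real u * H \<le> x" "x \<le> real (Suc u) * H" using K by auto
      show "indicat_real ?T x = (if u = t then 1 else 0)"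
      proof (cases "u = t")
        case False
        have "x \<notin> ?T"
        proof
          assume "x \<in> ?T"
          then have "real t * H < x" "x < real (Suc t) * H" using x by auto
          then have "real u * H < real (Suc t) * H" "real t * H < real (Suc u) * H" using xu by linarith+
          then show False using H False by (simp add: mult_less_cancel_right)
        qed
        then show ?thesis using False by simp
      qed (use xu in auto)
    qed
  qed simp
  then show "\<exists>c. AE x in lebesgue. x \<in> K \<longrightarrow> indicat_real ?T x = c" by blast
qed

lemma coarse_mesh_image:
  assumes "M > 0" "H = 1 / real M"
  shows "coarse_mesh H = (\<lambda>t. {real t * H..real (Suc t) * H}) ` {..<M}"
proof -
  have "real (Suc t) * H \<le> 1 \<longleftrightarrow> t < M" for t
    using assms by (auto simp: divide_le_eq_1 simp del: of_nat_Suc)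
  then show ?thesis unfolding coarse_mesh_def by auto
qed

lemma coarse_mesh_inj:
  assumes "0 < H" shows "inj_on (\<lambda>t. {real t * H..real (Suc t) * H}) A"
proof (rule inj_onI)
  fix t u assume "{real t * H..real (Suc t) * H} = {real u * H..real (Suc u) * H}"
  then have "real t * H = real u * H" using assms by (auto simp: Icc_eq_Icc mult_le_cancel_right)
  then show "t = u" using assms by simp
qed

lemma coarse_mesh_interval_cover:
  assumes "M > 0" "H = 1 / real M" shows "interval_cover (coarse_mesh H)"
  unfolding interval_cover_def
proof (intro conjI)
  note im = coarse_mesh_image[OF assms]
  show "finite (coarse_mesh H)" unfolding im by simp
  show "\<forall>K\<in>coarse_mesh H. \<exists>p q. K = {p..q}" unfolding im by blast
  show "{0..1} \<subseteq> \<Union>(coarse_mesh H)"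
  proof
    fix x :: real assume x: "x \<in> {0..1}"
    show "x \<in> \<Union>(coarse_mesh H)"
    proof (cases "x = 1")
      case True
      have "real (M - 1) * H \<le> 1" "real (Suc (M - 1)) * H = 1"
        using assms by (simp_all add: divide_le_eq_1)
      then have "x \<in> {real (M - 1) * H..real (Suc (M - 1)) * H}" using True by simp
      then show ?thesis unfolding im using assms(1) by (intro UN_I[of "M - 1"]) auto
    next
      case False
      define t where "t = nat \<lfloor>x * real M\<rfloor>"
      have "0 \<le> x * real M" using x by simp
      then have t: "real t \<le> x * real M" "x * real M < real t + 1" unfolding t_def by linarith+
      have "x * real M < real M" using False x assms(1) by simp
      then have "t < M" using t by linarith
      moreover have "x \<in> {real t * H..real (Suc t) * H}"
      proof -
        have H: "0 \<le> H" "x = (x * real M) * H" using assms by auto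
        have "real t * H \<le> (x * real M) * H" using t(1) H(1) by (rule mult_right_mono)
        moreover have "(x * real M) * H \<le> real (Suc t) * H" using t(2) H(1) by (intro mult_right_mono) auto
        ultimately show ?thesis using H(2) by simp
      qed
      ultimately show ?thesis unfolding im by blast
    qed
  qed
qed

lemma V_coarse_slopes:
  assumes M: "M > 0" "H = 1 / real M" and v: "v \<in> V_coarse H"
  obtains s where "v \<in> H1_per"
    "\<And>t. t < M \<Longrightarrow> AE x in lebesgue. x \<in> {real t * H..real (Suc t) * H} \<longrightarrow> grad v x = s t"
proof -
  note cov = coarse_mesh_interval_cover[OF M]
  have v: "v \<in> P1_per (coarse_mesh H)" using v by (simp add: V_coarse_def)
  have "\<forall>t\<in>{..<M}. \<exists>d. AE x in lebesgue. x \<in> {real t * H..real (Suc t) * H} \<longrightarrow> grad v x = d"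
  proof
    fix t assume t: "t \<in> {..<M}"
    have "{real t * H..real (Suc t) * H} \<in> coarse_mesh H" 
      unfolding coarse_mesh_image[OF M] using t by (rule imageI)
    then obtain c d where cd: "\<forall>x\<in>{real t * H..real (Suc t) * H}. v x = c + d * x"
      using v unfolding P1_per_def by blast
    have "0 \<le> H" "real M * H = 1" using M by auto
    then have "0 \<le> real t * H" "real (Suc t) * H \<le> 1"
      using t mult_right_mono[of "real (Suc t)" "real M" H] by auto
    then have "{real t * H..real (Suc t) * H} \<subseteq> {0..1}" by auto
    from P1_per_grad_affine[OF cov v bspec[OF cd] this]
    show "\<exists>d. AE x in lebesgue. x \<in> {real t * H..real (Suc t) * H} \<longrightarrow> grad v x = d" by blast
  qed
  from bchoice[OF this] obtain s where
    "\<forall>t\<in>{..<M}. AE x in lebesgue. x \<in> {real t * H..real (Suc t) * H} \<longrightarrow> grad v x = s t" by blast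
  then show ?thesis by (intro that[OF P1_per_H1_deriv(1)[OF cov v]]) blast
qed

section \<open>The corrector on one coarse element\<close>

text \<open>One element \<open>T = {p..q}\<close> of the coarse mesh, a coefficient \<open>a\<close> on it, and a fine space \<open>W\<close>.
Both choices of \<open>W\<close> are covered by asking for a subset of \<open>H1_per\<close> closed under differences;
that the explicit corrector belongs to \<open>W\<close> is a hypothesis of the lemmas that need it.\<close>

locale coarse_element =
  fixes W :: "(real \<Rightarrow> real) set" and H p q \<alpha> \<beta> :: real and a :: "real \<Rightarrow> real"
  assumes W_H1: "W \<subseteq> H1_per"
    and W_diff: "\<And>u v. u \<in> W \<Longrightarrow> v \<in> W \<Longrightarrow> (\<lambda>x. u x - v x) \<in> W"
    and pq: "0 \<le> p" "p < q" "q \<le> 1"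
    and nodes: "p \<in> coarse_nodes H" "q \<in> coarse_nodes H"
      "\<And>x. x \<in> coarse_nodes H \<Longrightarrow> 0 \<le> x \<and> x \<le> 1 \<and> (x \<le> p \<or> q \<le> x)"
    and a_meas: "a \<in> borel_measurable lebesgue"
    and \<alpha>: "0 < \<alpha>"
    and a_bounds: "AE x in lebesgue. x \<in> {p..q} \<longrightarrow> \<alpha> \<le> a x \<and> a x \<le> \<beta>"

begin

definition element_resistance :: real where "element_resistance = (LINT x:{p..q}|lebesgue. 1 / a x)"

text \<open>The gradient of the corrector of a function with slope \<open>s\<close> on the element. The corrected flux
\<open>a (s - corrector_grad s)\<close> is the constant \<open>s (q - p) / element_resistance\<close>, chosen such that the
gradient has mean zero.\<close>

definition corrector_grad :: "real \<Rightarrow> real \<Rightarrow> real" where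
  "corrector_grad s x = indicator {p..q} x * (s - s * (q - p) / element_resistance / a x)"

lemma element_in_unit: "{p..q} \<subseteq> {0..1}" using pq by auto

lemma inverse_meas: "(\<lambda>x. 1 / a x) \<in> borel_measurable lebesgue"
  using a_meas by (intro borel_measurable_divide) auto

lemma inverse_bound: "AE x in lebesgue. x \<in> {p..q} \<longrightarrow> \<bar>1 / a x\<bar> \<le> 1 / \<alpha>"
  using a_bounds by eventually_elim (use \<alpha> in \<open>auto simp: divide_simps\<close>)

lemma inverse_integrable: "set_integrable lebesgue {p..q} (\<lambda>x. 1 / a x)"
proof -
  have "set_integrable lebesgue {p..q} (\<lambda>x. 1 / a x * 1)"
    by (intro set_integrable_mult_bounded[OF _ _ inverse_bound] continuous_set_integrable
        continuous_intros set_borel_measurable_of_measurable inverse_meas) auto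
  then show ?thesis by simp
qed

lemma element_resistance_lower: "(q - p) / \<beta> \<le> element_resistance"
proof -
  have "(LINT x:{p..q}|lebesgue. 1 / \<beta>) \<le> (LINT x:{p..q}|lebesgue. 1 / a x)"
  proof (rule set_integral_mono_AE)
    show "set_integrable lebesgue {p..q} (\<lambda>x. 1 / \<beta>)"
      by (intro continuous_set_integrable continuous_intros)
    show "AE x\<in>{p..q} in lebesgue. 1 / \<beta> \<le> 1 / a x"
      using a_bounds by eventually_elim (use \<alpha> in \<open>auto simp: frac_le\<close>)
  qed (rule inverse_integrable)
  then show ?thesis using pq by (simp add: LINT_const element_resistance_def)
qed

lemma beta_pos: "0 < \<beta>"
proof (rule ccontr)
  assume "\<not> 0 < \<beta>"
  with a_bounds \<alpha> have "AE x in lebesgue. x \<notin> {p..q}" by (auto elim!: eventually_mono)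
  then have "{p..q} \<in> null_sets lebesgue" by (subst (asm) AE_iff_null_sets[symmetric]) auto
  then show False using pq by (auto simp: null_sets_def)
qed

lemma element_resistance_pos: "0 < element_resistance"
  using element_resistance_lower beta_pos pq divide_pos_pos[of "q - p" \<beta>] by linarith

lemma corrector_grad_measurable: "corrector_grad s \<in> borel_measurable lebesgue"
  unfolding corrector_grad_def using a_meas
  by (intro borel_measurable_times borel_measurable_indicator borel_measurable_diff
      borel_measurable_divide borel_measurable_const) auto

lemma corrector_grad_L2: "L2 (corrector_grad s)"
proof -
  define C where "C = \<bar>s\<bar> + \<bar>s * (q - p) / element_resistance\<bar> * (1 / \<alpha>)"
  have C0: "0 \<le> C" unfolding C_def using \<alpha> by simp
  have bd: "AE x in lebesgue. x \<in> {0..1} \<longrightarrow> \<bar>corrector_grad s x\<bar> \<le> C"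
    using inverse_bound
  proof eventually_elim
    case (elim x)
    show ?case
    proof (cases "x \<in> {p..q}")
      case True
      have "\<bar>corrector_grad s x\<bar> = \<bar>s - s * (q - p) / element_resistance * (1 / a x)\<bar>"
        using True by (simp add: corrector_grad_def)
      also have "\<dots> \<le> \<bar>s\<bar> + \<bar>s * (q - p) / element_resistance * (1 / a x)\<bar>" by (rule abs_triangle_ineq4)
      also have "\<bar>s * (q - p) / element_resistance * (1 / a x)\<bar> = \<bar>s * (q - p) / element_resistance\<bar> * \<bar>1 / a x\<bar>" by (rule abs_mult)
      also have "\<dots> \<le> \<bar>s * (q - p) / element_resistance\<bar> * (1 / \<alpha>)"
        using elim True by (intro mult_left_mono) auto
      finally show ?thesis by (simp add: C_def)
    qed (simp add: corrector_grad_def C0)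
  qed
  have m: "set_borel_measurable lebesgue {0..1} (corrector_grad s)"
    by (intro set_borel_measurable_of_measurable corrector_grad_measurable) auto
  have "set_integrable lebesgue {0..1} (\<lambda>x. corrector_grad s x * 1)"
    by (rule set_integrable_mult_bounded[OF _ m bd]) (intro continuous_set_integrable continuous_intros)
  then have "set_integrable lebesgue {0..1} (corrector_grad s)" by simp
  from set_integrable_mult_bounded[OF this m bd] m show ?thesis
    by (simp add: L2_def power2_eq_square)
qed

lemma corrector_grad_integrable: "set_integrable lebesgue {0..1} (corrector_grad s)"
  by (rule L2_integrable[OF corrector_grad_L2])

lemma corrector_grad_integral_element:
  "(LINT x:{p..q}|lebesgue. corrector_grad s x) = 0"
proof -
  have i: "set_integrable lebesgue {p..q} (\<lambda>x. s * (q - p) / element_resistance * (1 / a x))"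
    by (intro set_integrable_mult_right inverse_integrable)
  have "(LINT x:{p..q}|lebesgue. corrector_grad s x) = (LINT x:{p..q}|lebesgue. s - s * (q - p) / element_resistance * (1 / a x))"
    by (intro set_lebesgue_integral_cong) (auto simp: corrector_grad_def)
  also have "\<dots> = (LINT x:{p..q}|lebesgue. s) - (LINT x:{p..q}|lebesgue. s * (q - p) / element_resistance * (1 / a x))"
    by (intro set_integral_diff i continuous_set_integrable continuous_intros)
  also have "(LINT x:{p..q}|lebesgue. s * (q - p) / element_resistance * (1 / a x)) = s * (q - p) / element_resistance * element_resistance"
    unfolding element_resistance_def by (rule set_integral_mult_right)
  finally show ?thesis using element_resistance_pos pq by (simp add: LINT_const)
qed

lemma corrector_grad_outside:
  assumes "0 \<le> x" "x \<le> y" "y \<le> 1" "y \<le> p \<or> q \<le> x"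
  shows "(LINT t:{x..y}|lebesgue. corrector_grad s t) = 0"
proof -
  have "AE t in lebesgue. indicator {x..y} t *\<^sub>R corrector_grad s t = 0"
    by (rule AE_avoiding_finite[of "{p, q}"]) (use assms(4) in \<open>auto simp: corrector_grad_def indicator_def\<close>)
  then show ?thesis unfolding set_lebesgue_integral_def by (rule integral_eq_zero_AE)
qed

lemma corrector_grad_integral: "(LINT x:{0..1}|lebesgue. corrector_grad s x) = 0"
proof -
  have i: "set_integrable lebesgue {0..q} (corrector_grad s)"
    using pq by (intro set_integrable_subset[OF corrector_grad_integrable]) auto
  have "(LINT x:{0..1}|lebesgue. corrector_grad s x)
      = (LINT x:{0..p}|lebesgue. corrector_grad s x) + (LINT x:{p..q}|lebesgue. corrector_grad s x)
        + (LINT x:{q..1}|lebesgue. corrector_grad s x)"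
    using LINT_combine[OF i, of p] LINT_combine[OF corrector_grad_integrable, of q] pq by simp
  then show ?thesis
    using corrector_grad_outside[of 0 p s] corrector_grad_outside[of q 1 s]
      corrector_grad_integral_element[of s] pq by simp
qed

text \<open>Left of the element nothing has been accumulated, and the mean over the element is zero. In
particular the primitive vanishes at all coarse nodes, as no node lies inside the element.\<close>

lemma corrector_primitive_outside:
  assumes "0 \<le> x" "x \<le> 1" "x \<le> p \<or> q \<le> x"
  shows "periodic_primitive (corrector_grad s) x = 0"
proof -
  have *: "periodic_primitive (corrector_grad s) x = (LINT t:{0..x}|lebesgue. corrector_grad s t)"
    by (rule periodic_primitive_unit[OF corrector_grad_integral assms(1,2)])
  show ?thesis
  proof (cases "x \<le> p")
    case True
    then show ?thesis using * corrector_grad_outside[of 0 x s] assms by simp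
  next
    case False
    then show ?thesis
      using * corrector_grad_outside[of x 1 s] assms LINT_combine[OF corrector_grad_integrable[of s] assms(1,2)]
        corrector_grad_integral[of s] by simp
  qed
qed

lemma grad_of_corrector_primitive:
  "AE x in lebesgue. x \<in> {p..q} \<longrightarrow>
    grad (periodic_primitive (corrector_grad s)) x = s - s * (q - p) / element_resistance / a x"
proof -
  have "AE x in lebesgue. x \<in> {0..1} \<longrightarrow> grad (periodic_primitive (corrector_grad s)) x = corrector_grad s x"
    by (intro weak_grad_unique[OF H1_per_weak_grad] weak_grad_periodic_primitive periodic_primitive_H1
        corrector_grad_L2 corrector_grad_integral)
  then show ?thesis by eventually_elim (use element_in_unit in \<open>auto simp: corrector_grad_def\<close>)
qed

lemma energy_integrable:
  assumes "u \<in> H1_per" "w \<in> H1_per"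
  shows "set_integrable lebesgue {p..q} (\<lambda>x. a x * (grad u x * grad w x))"
proof (rule set_integrable_mult_bounded[where C = \<beta>])
  show "set_integrable lebesgue {p..q} (\<lambda>x. grad u x * grad w x)"
    by (rule set_integrable_subset[OF L2_mult_integrable[OF H1_per_grad_L2[OF assms(1)] H1_per_grad_L2[OF assms(2)]]])
      (use element_in_unit in auto)
  show "set_borel_measurable lebesgue {p..q} a"
    by (intro set_borel_measurable_of_measurable a_meas) auto
  show "AE x in lebesgue. x \<in> {p..q} \<longrightarrow> \<bar>a x\<bar> \<le> \<beta>"
    using a_bounds by eventually_elim (use \<alpha> in auto)
qed

lemma V_fine_zero_ends:
  assumes "u \<in> V_fine W H {p..q}" shows "u p = 0" "u q = 0"
  using assms nodes by (auto simp: V_fine_def)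

lemma V_fine_H1: "u \<in> V_fine W H {p..q} \<Longrightarrow> u \<in> H1_per"
  using W_H1 by (auto simp: V_fine_def)

text \<open>The difference of the two sides is the constant flux times the integral of \<open>grad vf\<close> over the
element, which vanishes because \<open>vf\<close> is zero at both ends.\<close>

lemma corrector_primitive_solves:
  assumes v: "v \<in> H1_per" "AE x in lebesgue. x \<in> {p..q} \<longrightarrow> grad v x = s"
    and vf: "vf \<in> V_fine W H {p..q}"
  shows "(LINT x:{p..q}|lebesgue. a x * grad (periodic_primitive (corrector_grad s)) x * grad vf x)
    = (LINT x:{p..q}|lebesgue. a x * grad v x * grad vf x)"
proof -
  let ?u = "periodic_primitive (corrector_grad s)"
  let ?c = "s * (q - p) / element_resistance"
  have u: "?u \<in> H1_per" by (intro periodic_primitive_H1 corrector_grad_L2 corrector_grad_integral)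
  have f: "vf \<in> H1_per" by (rule V_fine_H1[OF vf])
  have i: "set_integrable lebesgue {p..q} (\<lambda>x. a x * grad v x * grad vf x)"
    using energy_integrable[OF v(1) f] by (simp add: mult.assoc)
  have i': "set_integrable lebesgue {p..q} (\<lambda>x. ?c * grad vf x)"
    by (intro set_integrable_mult_right set_integrable_subset[OF L2_integrable[OF H1_per_grad_L2[OF f]]] element_in_unit) auto
  have "(LINT x:{p..q}|lebesgue. a x * grad ?u x * grad vf x)
      = (LINT x:{p..q}|lebesgue. a x * grad v x * grad vf x - ?c * grad vf x)"
  proof (rule LINT_cong_AE)
    show "set_borel_measurable lebesgue {p..q} (\<lambda>x. a x * grad ?u x * grad vf x)"
      using energy_integrable[OF u f] by (simp add: set_integrable_def set_borel_measurable_def mult.assoc)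
    show "set_borel_measurable lebesgue {p..q} (\<lambda>x. a x * grad v x * grad vf x - ?c * grad vf x)"
      using set_integral_diff(1)[OF i i'] unfolding set_integrable_def set_borel_measurable_def
      by (rule borel_measurable_integrable)
    show "AE x in lebesgue. x \<in> {p..q} \<longrightarrow>
        a x * grad ?u x * grad vf x = a x * grad v x * grad vf x - ?c * grad vf x"
      using grad_of_corrector_primitive[of s] v(2) a_bounds
    proof eventually_elim
      case (elim x)
      show ?case
      proof
        assume x: "x \<in> {p..q}"
        then have "a x \<noteq> 0" using elim \<alpha> by auto
        then have "a x * (s - c / a x) = a x * s - c" for c by (simp add: right_diff_distrib)
        note this[of ?c]
        moreover have "grad ?u x = s - ?c / a x" "grad v x = s" using elim x by blast+
        ultimately have "a x * grad ?u x = a x * grad v x - ?c" by metis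
        then show "a x * grad ?u x * grad vf x = a x * grad v x * grad vf x - ?c * grad vf x"
          by (simp add: left_diff_distrib)
      qed
    qed
  qed
  also have "\<dots> = (LINT x:{p..q}|lebesgue. a x * grad v x * grad vf x)
      - (LINT x:{p..q}|lebesgue. ?c * grad vf x)"
    by (rule set_integral_diff(2)[OF i i'])
  also have "(LINT x:{p..q}|lebesgue. ?c * grad vf x) = ?c * (LINT x:{p..q}|lebesgue. grad vf x)"
    by (rule set_integral_mult_right)
  also have "(LINT x:{p..q}|lebesgue. grad vf x) = 0"
    using H1_per_grad_FTC[OF f, of p q] pq V_fine_zero_ends[OF vf] by simp
  finally show ?thesis by simp
qed

text \<open>Coercivity on the fine-scale space: zero energy forces a zero gradient on the element, and the
function starts from zero at its left end.\<close>

lemma V_fine_energy_zero: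
  assumes e: "e \<in> V_fine W H {p..q}" and z: "(LINT x:{p..q}|lebesgue. a x * (grad e x * grad e x)) = 0"
  shows "e x = 0"
proof -
  have eH: "e \<in> H1_per" by (rule V_fine_H1[OF e])
  have "AE x in lebesgue. indicator {p..q} x *\<^sub>R (a x * (grad e x * grad e x)) = 0"
  proof (subst integral_nonneg_eq_0_iff_AE[symmetric])
    show "integrable lebesgue (\<lambda>x. indicator {p..q} x *\<^sub>R (a x * (grad e x * grad e x)))"
      using energy_integrable[OF eH eH] by (simp add: set_integrable_def)
    show "AE x in lebesgue. 0 \<le> indicator {p..q} x *\<^sub>R (a x * (grad e x * grad e x))"
      using a_bounds by eventually_elim (use \<alpha> in \<open>auto simp: indicator_def\<close>)
    show "(LINT x|lebesgue. indicator {p..q} x *\<^sub>R (a x * (grad e x * grad e x))) = 0"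
      using z by (simp add: set_lebesgue_integral_def)
  qed
  with a_bounds have g0: "AE x in lebesgue. x \<in> {p..q} \<longrightarrow> grad e x = 0"
    by eventually_elim (use \<alpha> in auto)
  have inT: "e y = 0" if y: "y \<in> {p..q}" for y
  proof -
    have "(LINT t:{p..y}|lebesgue. grad e t) = 0"
    proof -
      have "AE t in lebesgue. indicator {p..y} t *\<^sub>R grad e t = 0"
        using g0 by eventually_elim (use y in \<open>auto simp: indicator_def\<close>)
      then show ?thesis unfolding set_lebesgue_integral_def by (rule integral_eq_zero_AE)
    qed
    then show ?thesis
      using H1_per_grad_FTC[OF eH, of p y] y pq V_fine_zero_ends[OF e] by simp
  qed
  have unit: "e y = 0" if "y \<in> {0..1}" for y
    using inT[of y] that e unfolding V_fine_def by blast
  have "e x = e (x + of_int (- \<lfloor>x\<rfloor>))"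
    using eH periodic1_int[of e x "- \<lfloor>x\<rfloor>"] by (simp add: H1_per_def)
  also have "\<dots> = 0"
  proof (rule unit)
    have "0 \<le> x - of_int \<lfloor>x\<rfloor>" "x - of_int \<lfloor>x\<rfloor> \<le> 1" by linarith+
    then show "x + of_int (- \<lfloor>x\<rfloor>) \<in> {0..1}" by simp
  qed
  finally show ?thesis .
qed

text \<open>The corrector is a definite description, so the explicit solution has to be the only one. The
difference of two solutions can be used as a test function and has zero energy.\<close>

lemma corrector_eq:
  assumes v: "v \<in> H1_per" "AE x in lebesgue. x \<in> {p..q} \<longrightarrow> grad v x = s"
    and W: "periodic_primitive (corrector_grad s) \<in> W"
  shows "corrector W H {p..q} a v = periodic_primitive (corrector_grad s)"
  unfolding corrector_def
proof (rule the_equality)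
  let ?u = "periodic_primitive (corrector_grad s)"
  have u: "?u \<in> H1_per" using W W_H1 by blast
  have "?u x = 0" if "x \<in> coarse_nodes H" for x
    using nodes(3)[OF that] by (intro corrector_primitive_outside) auto
  moreover have "?u x = 0" if "x \<in> {0..1} - {p..q}" for x
    using that by (intro corrector_primitive_outside) auto
  ultimately have uV: "?u \<in> V_fine W H {p..q}" using W by (simp add: V_fine_def)
  then show "?u \<in> V_fine W H {p..q} \<and> (\<forall>vf\<in>V_fine W H {p..q}.
      (LINT x:{p..q}|lebesgue. a x * grad ?u x * grad vf x) = (LINT x:{p..q}|lebesgue. a x * grad v x * grad vf x))"
    using corrector_primitive_solves[OF v] by blast
  fix u' assume u': "u' \<in> V_fine W H {p..q} \<and> (\<forall>vf\<in>V_fine W H {p..q}.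
      (LINT x:{p..q}|lebesgue. a x * grad u' x * grad vf x) = (LINT x:{p..q}|lebesgue. a x * grad v x * grad vf x))"
  define e where "e = (\<lambda>x. u' x - ?u x)"
  have e: "e \<in> V_fine W H {p..q}"
    using u' uV W_diff unfolding e_def V_fine_def by auto
  have eH: "e \<in> H1_per" and u'H: "u' \<in> H1_per" using e u' V_fine_H1 by auto
  have ge: "AE x in lebesgue. x \<in> {0..1} \<longrightarrow> grad e x = grad u' x - grad ?u x"
    unfolding e_def by (rule grad_diff[OF u'H u])
  have "(LINT x:{p..q}|lebesgue. a x * (grad e x * grad e x))
      = (LINT x:{p..q}|lebesgue. a x * (grad u' x * grad e x) - a x * (grad ?u x * grad e x))"
  proof (rule LINT_cong_AE)
    show "set_borel_measurable lebesgue {p..q} (\<lambda>x. a x * (grad e x * grad e x))"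
      using energy_integrable[OF eH eH] by (simp add: set_integrable_def set_borel_measurable_def)
    show "set_borel_measurable lebesgue {p..q} (\<lambda>x. a x * (grad u' x * grad e x) - a x * (grad ?u x * grad e x))"
      using set_integral_diff(1)[OF energy_integrable[OF u'H eH] energy_integrable[OF u eH]]
      unfolding set_integrable_def set_borel_measurable_def by (rule borel_measurable_integrable)
    show "AE x in lebesgue. x \<in> {p..q} \<longrightarrow>
        a x * (grad e x * grad e x) = a x * (grad u' x * grad e x) - a x * (grad ?u x * grad e x)"
      using ge
    proof eventually_elim
      case (elim x)
      show ?case
      proof
        assume "x \<in> {p..q}"
        then have "grad e x = grad u' x - grad ?u x" using elim element_in_unit by auto
        then show "a x * (grad e x * grad e x) = a x * (grad u' x * grad e x) - a x * (grad ?u x * grad e x)"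
          by (metis left_diff_distrib right_diff_distrib)
      qed
    qed
  qed
  also have "\<dots> = (LINT x:{p..q}|lebesgue. a x * (grad u' x * grad e x))
      - (LINT x:{p..q}|lebesgue. a x * (grad ?u x * grad e x))"
    by (rule set_integral_diff(2)[OF energy_integrable[OF u'H eH] energy_integrable[OF u eH]])
  also have "\<dots> = 0"
    using bspec[OF conjunct2[OF u'] e] corrector_primitive_solves[OF v e] by (simp add: mult.assoc)
  finally have "e x = 0" for x by (rule V_fine_energy_zero[OF e])
  then show "u' = ?u" by (auto simp: e_def)
qed

text \<open>The integrand is the constant flux times the slope of \<open>w\<close>.\<close>

lemma form_elem_eq:
  assumes v: "v \<in> H1_per" "AE x in lebesgue. x \<in> {p..q} \<longrightarrow> grad v x = s"
    and w: "w \<in> H1_per" "AE x in lebesgue. x \<in> {p..q} \<longrightarrow> grad w x = r"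
    and W: "periodic_primitive (corrector_grad s) \<in> W"
  shows "form_elem W H {p..q} a v w = s * r * (q - p)\<^sup>2 / element_resistance"
proof -
  let ?u = "periodic_primitive (corrector_grad s)"
  have u: "?u \<in> H1_per" using W W_H1 by blast
  have "form_elem W H {p..q} a v w = (LINT x:{p..q}|lebesgue. a x * (grad v x - grad ?u x) * grad w x)"
    unfolding form_elem_def corrector_eq[OF v W] ..
  also have "\<dots> = (LINT x:{p..q}|lebesgue. s * (q - p) / element_resistance * r)"
  proof (rule LINT_cong_AE)
    show "set_borel_measurable lebesgue {p..q} (\<lambda>x. a x * (grad v x - grad ?u x) * grad w x)"
      by (intro set_borel_measurable_mult set_borel_measurable_diff set_borel_measurable_grad
          set_borel_measurable_of_measurable a_meas v w u element_in_unit) auto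
    show "set_borel_measurable lebesgue {p..q} (\<lambda>x. s * (q - p) / element_resistance * r)"
      by (intro continuous_set_borel_measurable continuous_intros)
    show "AE x in lebesgue. x \<in> {p..q} \<longrightarrow> a x * (grad v x - grad ?u x) * grad w x = s * (q - p) / element_resistance * r"
      using grad_of_corrector_primitive[of s] v(2) w(2) a_bounds
    proof eventually_elim
      case (elim x)
      show ?case
      proof
        assume x: "x \<in> {p..q}"
        then have "a x \<noteq> 0" using elim \<alpha> by auto
        moreover have "grad v x - grad ?u x = s * (q - p) / element_resistance / a x" using elim x by simp
        ultimately have "a x * (grad v x - grad ?u x) = s * (q - p) / element_resistance" by simp
        then show "a x * (grad v x - grad ?u x) * grad w x = s * (q - p) / element_resistance * r" using elim x by simp
      qed
    qed
  qed
  also have "\<dots> = s * r * (q - p)\<^sup>2 / element_resistance"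
    using pq by (simp add: LINT_const power2_eq_square)
  finally show ?thesis .
qed

end

section \<open>Resistance of a medium with defects\<close>

lemma cell_affine: "cell Q \<epsilon> k = (\<lambda>y. \<epsilon> *\<^sub>R y + \<epsilon> * real_of_int k) ` Q"
  unfolding cell_def by (intro image_cong) (auto simp: algebra_simps)

lemma measure_cell: "measure lebesgue (cell Q \<epsilon> k) = \<bar>\<epsilon>\<bar> * measure lebesgue Q"
  unfolding cell_affine using measure_lebesgue_affine[of \<epsilon> "\<epsilon> * real_of_int k" Q] by simp

lemma sets_cell:
  assumes "\<epsilon> \<noteq> 0" "Q \<in> sets lebesgue" shows "cell Q \<epsilon> k \<in> sets lebesgue"
proof -
  have m: "(\<lambda>x. - real_of_int k + (1 / \<epsilon>) * x) \<in> lebesgue \<rightarrow>\<^sub>M lebesgue"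
    using lebesgue_affine_measurable[where c = "\<lambda>x::real. 1 / \<epsilon>" and t = "- real_of_int k"] assms(1) by simp
  have "cell Q \<epsilon> k = (\<lambda>x. - real_of_int k + (1 / \<epsilon>) * x) -` Q"
  proof (intro set_eqI iffI)
    fix x assume "x \<in> (\<lambda>x. - real_of_int k + (1 / \<epsilon>) * x) -` Q"
    moreover have "x = \<epsilon> * (real_of_int k + (- real_of_int k + (1 / \<epsilon>) * x))"
      using assms(1) by (simp add: algebra_simps)
    ultimately show "x \<in> cell Q \<epsilon> k" unfolding cell_def by blast
  qed (use assms(1) in \<open>auto simp: cell_def field_simps\<close>)
  then show ?thesis using measurable_sets[OF m assms(2)] by simp
qed

locale defect_medium =
  fixes Aper Bper :: "real \<Rightarrow> real" and Q :: "real set" and \<epsilon> \<alpha> \<beta> :: real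
  assumes eps: "0 < \<epsilon>"
    and A_meas: "Aper \<in> borel_measurable lebesgue" and B_meas: "Bper \<in> borel_measurable lebesgue"
    and alpha: "0 < \<alpha>" and alpha_beta: "\<alpha> \<le> \<beta>"
    and A_bounds: "AE x in lebesgue. \<alpha> \<le> Aper x \<and> Aper x \<le> \<beta>"
    and AB_bounds: "AE x in lebesgue. \<alpha> \<le> Aper x + Bper x \<and> Aper x + Bper x \<le> \<beta>"
    and Q_unit: "Q \<subseteq> {0..1}" and Q_sets: "Q \<in> sets lebesgue" and Q_pos: "measure lebesgue Q > 0"

begin

definition defect_mask :: "int set \<Rightarrow> (int \<Rightarrow> real) \<Rightarrow> real \<Rightarrow> real" where
  "defect_mask J c x = (\<Sum>j\<in>J. c j * indicator (cell Q \<epsilon> j) x)"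

text \<open>The true coefficient is the case \<open>J = cells_in Q \<epsilon> {0..1}\<close>; the offline coefficients are the
cases \<open>J = {}\<close> and \<open>J = {j}\<close>. One formula for their resistances serves all of them.\<close>

definition masked_coeff :: "int set \<Rightarrow> (int \<Rightarrow> real) \<Rightarrow> real \<Rightarrow> real" where
  "masked_coeff J c x = rescale Aper \<epsilon> x + defect_mask J c x * rescale Bper \<epsilon> x"

definition jump :: "real \<Rightarrow> real" where
  "jump x = 1 / (rescale Aper \<epsilon> x + rescale Bper \<epsilon> x) - 1 / rescale Aper \<epsilon> x"

definition cell_jump :: "int \<Rightarrow> real" where
  "cell_jump j = (LINT x:cell Q \<epsilon> j|lebesgue. jump x)"

lemma rescale_meas:
  assumes "f \<in> borel_measurable lebesgue" shows "rescale f \<epsilon> \<in> borel_measurable lebesgue"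
proof -
  have "(\<lambda>x. f ((1 / \<epsilon>) *\<^sub>R x)) \<in> borel_measurable lebesgue"
    by (rule measurable_compose[OF lebesgue_measurable_scaling assms])
  then show ?thesis by (simp add: rescale_def[abs_def])
qed

lemma rescale_AE:
  assumes "AE x in lebesgue. P (Aper x) (Bper x)"
  shows "AE x in lebesgue. P (rescale Aper \<epsilon> x) (rescale Bper \<epsilon> x)"
  using AE_lebesgue_rescale[of "1 / \<epsilon>", OF _ assms] eps by (simp add: rescale_def)

lemma rescaled_bounds:
  "AE x in lebesgue. \<alpha> \<le> rescale Aper \<epsilon> x \<and> rescale Aper \<epsilon> x \<le> \<beta> \<and>
    \<alpha> \<le> rescale Aper \<epsilon> x + rescale Bper \<epsilon> x \<and> rescale Aper \<epsilon> x + rescale Bper \<epsilon> x \<le> \<beta>"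
  using rescale_AE[of "\<lambda>a b. \<alpha> \<le> a \<and> a \<le> \<beta>", OF A_bounds]
    rescale_AE[of "\<lambda>a b. \<alpha> \<le> a + b \<and> a + b \<le> \<beta>", OF AB_bounds]
  by eventually_elim blast

lemma cell_sets: "cell Q \<epsilon> j \<in> sets lebesgue"
  using eps Q_sets by (intro sets_cell) auto

lemma cell_subset: "cell Q \<epsilon> j \<subseteq> {\<epsilon> * of_int j..\<epsilon> * (of_int j + 1)}"
  using eps Q_unit by (force simp: cell_def intro!: mult_left_mono)

lemma cell_lmeasurable: "cell Q \<epsilon> j \<in> lmeasurable"
  by (rule fmeasurableI2[OF _ cell_subset cell_sets]) simp

text \<open>Cells with different indices overlap at most in grid points, which form a null set. Away from the
grid, a point determines the index of the only cell that can contain it.\<close>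

lemma cell_index_AE:
  "AE x in lebesgue. \<epsilon> * of_int \<lfloor>x / \<epsilon>\<rfloor> < x \<and> x < \<epsilon> * (of_int \<lfloor>x / \<epsilon>\<rfloor> + 1) \<and>
    (\<forall>j. x \<in> cell Q \<epsilon> j \<longrightarrow> j = \<lfloor>x / \<epsilon>\<rfloor>)"
proof -
  have "countable (range (\<lambda>k::int. \<epsilon> * of_int k))" by simp
  then have "range (\<lambda>k::int. \<epsilon> * of_int k) \<in> null_sets lebesgue"
    by (intro null_sets_completionI countable_imp_null_set_lborel)
  then have "AE x in lebesgue. x \<notin> range (\<lambda>k::int. \<epsilon> * of_int k)" by (rule AE_not_in)
  then show ?thesis
  proof eventually_elim
    case (elim x)
    define k where "k = \<lfloor>x / \<epsilon>\<rfloor>"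
    have "of_int k \<le> x / \<epsilon>" "x / \<epsilon> < of_int k + 1" unfolding k_def by linarith+
    then have k: "\<epsilon> * of_int k \<le> x" "x < \<epsilon> * (of_int k + 1)"
      using eps by (simp_all add: field_simps)
    moreover have "\<epsilon> * of_int k \<noteq> x" using elim by auto
    moreover have "j = k" if j: "x \<in> cell Q \<epsilon> j" for j
    proof -
      have "\<epsilon> * of_int j \<le> x" "x \<le> \<epsilon> * (of_int j + 1)" using j cell_subset[of j] by auto
      moreover have "\<epsilon> * of_int (j + 1) \<noteq> x" using elim by blast
      ultimately have "\<epsilon> * of_int j < \<epsilon> * (of_int k + 1)" "\<epsilon> * of_int k < \<epsilon> * (of_int j + 1)"
        using k by auto
      then have "real_of_int j < of_int k + 1" "real_of_int k < of_int j + 1"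
        using eps by (simp_all only: mult_less_cancel_left_pos)
      then show ?thesis by linarith
    qed
    ultimately show ?case unfolding k_def[symmetric] by (simp add: order.strict_iff_order)
  qed
qed

text \<open>At most one summand of the mask is nonzero.\<close>

lemma defect_mask_cases:
  assumes J: "finite J" "\<forall>j\<in>J. c j \<in> {0, 1}"
  shows "AE x in lebesgue. defect_mask J c x \<in> {0, 1}"
  using cell_index_AE
proof eventually_elim
  case (elim x)
  define k where "k = \<lfloor>x / \<epsilon>\<rfloor>"
  have z: "c j * indicator (cell Q \<epsilon> j) x = (if j = k then c k * indicator (cell Q \<epsilon> k) x else 0)" for j
    using elim by (auto simp: k_def indicator_def)
  have "defect_mask J c x = (if k \<in> J then c k * indicator (cell Q \<epsilon> k) x else 0)"
    unfolding defect_mask_def by (subst z) (simp add: J(1))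
  then show ?case using J(2) by (auto simp: indicator_def)
qed

text \<open>As the mask takes the values \<open>0\<close> and \<open>1\<close> only, the reciprocal of the coefficient is affine in it.
This makes the resistance additive over the defects.\<close>

lemma masked_coeff_AE:
  assumes "finite J" "\<forall>j\<in>J. c j \<in> {0, 1}"
  shows "AE x in lebesgue. \<alpha> \<le> masked_coeff J c x \<and> masked_coeff J c x \<le> \<beta> \<and>
    1 / masked_coeff J c x = 1 / rescale Aper \<epsilon> x + defect_mask J c x * jump x"
  using defect_mask_cases[OF assms] rescaled_bounds
  by eventually_elim (auto simp: masked_coeff_def jump_def)

lemma defect_mask_meas: "finite J \<Longrightarrow> defect_mask J c \<in> borel_measurable lebesgue"
  unfolding defect_mask_def
  by (intro borel_measurable_sum borel_measurable_times borel_measurable_const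
      borel_measurable_indicator cell_sets)

lemma masked_coeff_meas: "finite J \<Longrightarrow> masked_coeff J c \<in> borel_measurable lebesgue"
  unfolding masked_coeff_def[abs_def]
  by (intro borel_measurable_add borel_measurable_times defect_mask_meas rescale_meas A_meas B_meas)

lemma jump_meas: "jump \<in> borel_measurable lebesgue"
  unfolding jump_def[abs_def]
  by (intro borel_measurable_diff borel_measurable_divide borel_measurable_add borel_measurable_const
      rescale_meas A_meas B_meas)

lemma jump_bound: "AE x in lebesgue. \<bar>jump x\<bar> \<le> (\<beta> - \<alpha>) / (\<alpha> * \<beta>)"
  using rescaled_bounds
proof eventually_elim
  case (elim x)
  have *: "1 / \<beta> \<le> 1 / y \<and> 1 / y \<le> 1 / \<alpha>" if "\<alpha> \<le> y" "y \<le> \<beta>" for y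
    using that alpha by (simp add: frac_le)
  have "(\<beta> - \<alpha>) / (\<alpha> * \<beta>) = 1 / \<alpha> - 1 / \<beta>"
    using alpha alpha_beta by (simp add: field_simps)
  then show ?case
    using *[of "rescale Aper \<epsilon> x"] *[of "rescale Aper \<epsilon> x + rescale Bper \<epsilon> x"] elim
    unfolding jump_def by linarith
qed

lemma jump_integrable: assumes "S \<in> lmeasurable" shows "set_integrable lebesgue S jump"
proof -
  have "set_integrable lebesgue S (\<lambda>x. jump x * 1)"
  proof (rule set_integrable_mult_bounded)
    show "set_integrable lebesgue S (\<lambda>x. 1 :: real)"
      by (rule set_integrable_const_lmeasurable[OF assms])
    show "set_borel_measurable lebesgue S jump"
      using assms by (intro set_borel_measurable_of_measurable jump_meas) auto
    show "AE x in lebesgue. x \<in> S \<longrightarrow> \<bar>jump x\<bar> \<le> (\<beta> - \<alpha>) / (\<alpha> * \<beta>)"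
      using jump_bound by eventually_elim simp
  qed
  then show ?thesis by simp
qed

lemma cell_jump_bound: "\<bar>cell_jump j\<bar> \<le> \<epsilon> * measure lebesgue Q * ((\<beta> - \<alpha>) / (\<alpha> * \<beta>))"
proof -
  let ?d = "(\<beta> - \<alpha>) / (\<alpha> * \<beta>)"
  have i: "set_integrable lebesgue (cell Q \<epsilon> j) jump" by (rule jump_integrable[OF cell_lmeasurable])
  have ic: "set_integrable lebesgue (cell Q \<epsilon> j) (\<lambda>x. ?d)"
    by (rule set_integrable_const_lmeasurable[OF cell_lmeasurable])
  have "\<bar>cell_jump j\<bar> \<le> (LINT x:cell Q \<epsilon> j|lebesgue. \<bar>jump x\<bar>)"
    using set_integral_norm_bound[OF i] by (simp add: cell_jump_def)
  also have "\<dots> \<le> (LINT x:cell Q \<epsilon> j|lebesgue. ?d)"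
  proof (rule set_integral_mono_AE[OF set_integrable_abs[OF i] ic])
    show "AE x\<in>cell Q \<epsilon> j in lebesgue. \<bar>jump x\<bar> \<le> ?d"
      using jump_bound by eventually_elim simp
  qed
  also have "\<dots> = measure lebesgue (cell Q \<epsilon> j) * ?d"
    unfolding set_lebesgue_integral_def using cell_sets by simp
  also have "\<dots> = \<epsilon> * measure lebesgue Q * ?d" using eps by (simp add: measure_cell)
  finally show ?thesis .
qed

lemma inverse_A_integrable: "set_integrable lebesgue {p..q} (\<lambda>x. 1 / rescale Aper \<epsilon> x)"
proof -
  have "set_integrable lebesgue {p..q} (\<lambda>x. 1 / rescale Aper \<epsilon> x * 1)"
  proof (rule set_integrable_mult_bounded)
    show "set_integrable lebesgue {p..q} (\<lambda>x. 1 :: real)" by (intro continuous_set_integrable continuous_intros)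
    show "set_borel_measurable lebesgue {p..q} (\<lambda>x. 1 / rescale Aper \<epsilon> x)"
      by (intro set_borel_measurable_of_measurable borel_measurable_divide borel_measurable_const
          rescale_meas A_meas) auto
    show "AE x in lebesgue. x \<in> {p..q} \<longrightarrow> \<bar>1 / rescale Aper \<epsilon> x\<bar> \<le> 1 / \<alpha>"
      using rescaled_bounds by eventually_elim (use alpha in \<open>auto simp: frac_le\<close>)
  qed
  then show ?thesis by simp
qed

text \<open>A cell that meets the interior of an interval with end points on the grid lies in it. So the
cells outside \<open>J\<^sub>T\<close> contribute nothing to integrals over \<open>T\<close>.\<close>

lemma cell_in_grid_interval:
  assumes "x \<in> cell Q \<epsilon> j" "x \<in> {\<epsilon> * of_int k..\<epsilon> * of_int l}"
    and "\<epsilon> * of_int \<lfloor>x / \<epsilon>\<rfloor> < x" "x < \<epsilon> * (of_int \<lfloor>x / \<epsilon>\<rfloor> + 1)" "j = \<lfloor>x / \<epsilon>\<rfloor>"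
  shows "cell Q \<epsilon> j \<subseteq> {\<epsilon> * of_int k..\<epsilon> * of_int l}"
proof -
  have "\<epsilon> * of_int k < \<epsilon> * (of_int j + 1)" "\<epsilon> * of_int j < \<epsilon> * of_int l"
    using assms by auto
  then have "real_of_int k < of_int j + 1" "real_of_int j < of_int l"
    using eps by (simp_all only: mult_less_cancel_left_pos)
  then have "k \<le> j" "j + 1 \<le> l" by linarith+
  then have "real_of_int k \<le> of_int j" "real_of_int j + 1 \<le> of_int l" by linarith+
  then have "\<epsilon> * of_int k \<le> \<epsilon> * of_int j" "\<epsilon> * (of_int j + 1) \<le> \<epsilon> * of_int l"
    using eps by (auto intro: mult_left_mono)
  then show ?thesis using cell_subset[of j] by auto
qed

text \<open>By additivity, each cell of \<open>J\<close> contained in \<open>T\<close> contributes its own change of resistance; the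
other cells meet \<open>T\<close> in a null set.\<close>

lemma masked_resistance:
  assumes J: "finite J" "\<forall>j\<in>J. c j \<in> {0, 1}"
    and T: "T = {\<epsilon> * of_int k..\<epsilon> * of_int l}"
  shows "(LINT x:T|lebesgue. 1 / masked_coeff J c x)
    = (LINT x:T|lebesgue. 1 / rescale Aper \<epsilon> x) + (\<Sum>j\<in>J \<inter> cells_in Q \<epsilon> T. c j * cell_jump j)"
proof -
  have Tl: "T \<in> lmeasurable" "T \<in> sets lebesgue" unfolding T by auto
  have cellint: "(LINT x:T|lebesgue. indicator (cell Q \<epsilon> j) x * jump x)
      = (if j \<in> cells_in Q \<epsilon> T then cell_jump j else 0)" for j
  proof (cases "j \<in> cells_in Q \<epsilon> T")
    case True
    then have "(LINT x:T|lebesgue. indicator (cell Q \<epsilon> j) x * jump x) = cell_jump j"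
      unfolding cell_jump_def set_lebesgue_integral_def
      by (intro Bochner_Integration.integral_cong) (auto simp: indicator_def cells_in_def)
    then show ?thesis using True by simp
  next
    case False
    have "AE x in lebesgue. indicator T x *\<^sub>R (indicator (cell Q \<epsilon> j) x * jump x) = 0"
      using cell_index_AE
    proof eventually_elim
      case (elim x)
      have "\<not> (x \<in> T \<and> x \<in> cell Q \<epsilon> j)"
      proof
        assume x: "x \<in> T \<and> x \<in> cell Q \<epsilon> j"
        with elim have "cell Q \<epsilon> j \<subseteq> T"
          unfolding T by (intro cell_in_grid_interval[of x]) blast+
        then show False using False by (simp add: cells_in_def)
      qed
      then show ?case by (auto simp: indicator_def)
    qed
    then have "(LINT x:T|lebesgue. indicator (cell Q \<epsilon> j) x * jump x) = 0"
      unfolding set_lebesgue_integral_def by (rule integral_eq_zero_AE)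
    then show ?thesis using False by simp
  qed
  have ij: "set_integrable lebesgue T (\<lambda>x. indicator (cell Q \<epsilon> j) x * jump x)" for j
    using cell_sets by (intro set_integrable_mult_bounded[OF jump_integrable[OF Tl(1)], of _ 1]
        set_borel_measurable_of_measurable Tl(2) borel_measurable_indicator) (auto simp: indicator_def)
  have im: "set_integrable lebesgue T (\<lambda>x. defect_mask J c x * jump x)"
    and mi: "(LINT x:T|lebesgue. defect_mask J c x * jump x)
      = (\<Sum>j\<in>J. c j * (LINT x:T|lebesgue. indicator (cell Q \<epsilon> j) x * jump x))"
  proof -
    have eq: "(\<lambda>x. indicator T x *\<^sub>R (defect_mask J c x * jump x))
        = (\<lambda>x. \<Sum>j\<in>J. c j * (indicator T x *\<^sub>R (indicator (cell Q \<epsilon> j) x * jump x)))"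
      by (auto simp: defect_mask_def sum_distrib_left sum_distrib_right mult_ac)
    have i: "integrable lebesgue (\<lambda>x. c j * (indicator T x *\<^sub>R (indicator (cell Q \<epsilon> j) x * jump x)))" for j
      using ij[of j] unfolding set_integrable_def by (rule integrable_mult_right)
    show "set_integrable lebesgue T (\<lambda>x. defect_mask J c x * jump x)"
      unfolding set_integrable_def eq by (intro Bochner_Integration.integrable_sum i)
    show "(LINT x:T|lebesgue. defect_mask J c x * jump x)
        = (\<Sum>j\<in>J. c j * (LINT x:T|lebesgue. indicator (cell Q \<epsilon> j) x * jump x))"
      unfolding set_lebesgue_integral_def eq
      by (subst Bochner_Integration.integral_sum[OF i]) simp
  qed
  have iA: "set_integrable lebesgue T (\<lambda>x. 1 / rescale Aper \<epsilon> x)" unfolding T by (rule inverse_A_integrable)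
  have "(LINT x:T|lebesgue. 1 / masked_coeff J c x)
      = (LINT x:T|lebesgue. 1 / rescale Aper \<epsilon> x + defect_mask J c x * jump x)"
  proof (rule LINT_cong_AE)
    show "set_borel_measurable lebesgue T (\<lambda>x. 1 / masked_coeff J c x)"
      by (intro set_borel_measurable_of_measurable Tl(2) borel_measurable_divide borel_measurable_const
          masked_coeff_meas J(1))
    show "set_borel_measurable lebesgue T (\<lambda>x. 1 / rescale Aper \<epsilon> x + defect_mask J c x * jump x)"
      using set_integral_add(1)[OF iA im] unfolding set_integrable_def set_borel_measurable_def
      by (rule borel_measurable_integrable)
    show "AE x in lebesgue. x \<in> T \<longrightarrow> 1 / masked_coeff J c x = 1 / rescale Aper \<epsilon> x + defect_mask J c x * jump x"
      using masked_coeff_AE[OF J] by eventually_elim blast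
  qed
  also have "\<dots> = (LINT x:T|lebesgue. 1 / rescale Aper \<epsilon> x) + (LINT x:T|lebesgue. defect_mask J c x * jump x)"
    by (rule set_integral_add(2)[OF iA im])
  also have "(LINT x:T|lebesgue. defect_mask J c x * jump x) = (\<Sum>j\<in>J \<inter> cells_in Q \<epsilon> T. c j * cell_jump j)"
    unfolding mi cellint by (subst sum.inter_restrict[OF J(1)]) (intro sum.cong, auto)
  finally show ?thesis .
qed

text \<open>An infinite index set would make the sum in the coefficient vanish. It is finite because the cells
contain a point: \<open>Q\<close> has positive measure.\<close>

lemma finite_cells_in: "finite (cells_in Q \<epsilon> {0..1})"
proof -
  have "Q \<noteq> {}" using Q_pos by auto
  then obtain y where yQ: "y \<in> Q" by blast
  then have y: "y \<in> Q" "0 \<le> y" "y \<le> 1" using Q_unit by auto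
  have "cells_in Q \<epsilon> {0..1} \<subseteq> {-1..\<lceil>1 / \<epsilon>\<rceil>}"
  proof
    fix k assume "k \<in> cells_in Q \<epsilon> {0..1}"
    then have "0 \<le> \<epsilon> * (of_int k + y)" "\<epsilon> * (of_int k + y) \<le> 1"
      using y(1) by (auto simp: cells_in_def cell_def)
    then have "0 \<le> of_int k + y" "of_int k + y \<le> 1 / \<epsilon>"
      using eps by (simp_all add: zero_le_mult_iff pos_le_divide_eq mult.commute)
    then show "k \<in> {-1..\<lceil>1 / \<epsilon>\<rceil>}" using y by (auto simp: le_ceiling_iff)
  qed
  then show ?thesis by (rule finite_subset) simp
qed

lemma element_grid:
  assumes "H = real N * \<epsilon>"
  shows "{real t * H..real (Suc t) * H} = {\<epsilon> * of_int (int (t * N))..\<epsilon> * of_int (int (Suc t * N))}"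
proof -
  have "real k * H = \<epsilon> * of_int (int (k * N))" for k using assms by (simp add: mult_ac)
  then show ?thesis by (simp only:)
qed

definition fine_space :: "real \<Rightarrow> (real \<Rightarrow> real) set \<Rightarrow> bool" where
  "fine_space H W \<longleftrightarrow> W = H1_per \<or> (\<exists>\<T>. resolving_refinement Aper Bper Q \<epsilon> H \<T> \<and> W = P1_per \<T>)"

lemma fine_space_H1: "fine_space H W \<Longrightarrow> W \<subseteq> H1_per"
  unfolding fine_space_def resolving_refinement_def
  using P1_per_H1_deriv(1)[OF is_mesh_interval_cover] by auto

lemma fine_space_diff: "fine_space H W \<Longrightarrow> u \<in> W \<Longrightarrow> v \<in> W \<Longrightarrow> (\<lambda>x. u x - v x) \<in> W"
  unfolding fine_space_def using H1_per_diff P1_per_diff by blast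

text \<open>On a resolving mesh, a function of the coefficient that is cut off to a coarse element is constant
on each element of the mesh.\<close>

lemma fine_space_primitive:
  assumes W: "fine_space H W" and H: "0 < H" and J: "finite J" "J \<subseteq> cells_in Q \<epsilon> {0..1}"
    and g: "L2 g" "(LINT x:{0..1}|lebesgue. g x) = 0"
      "g = (\<lambda>x. indicator {real t * H..real (Suc t) * H} x * h (masked_coeff J c x))"
  shows "periodic_primitive g \<in> W"
  using W unfolding fine_space_def
proof
  assume "W = H1_per" then show ?thesis using periodic_primitive_H1[OF g(1,2)] by simp
next
  assume "\<exists>\<T>. resolving_refinement Aper Bper Q \<epsilon> H \<T> \<and> W = P1_per \<T>"
  then obtain \<T> where T: "resolving_refinement Aper Bper Q \<epsilon> H \<T>" "W = P1_per \<T>" by blast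
  have cA: "const_on_elements \<T> (rescale Aper \<epsilon>)" and cB: "const_on_elements \<T> (rescale Bper \<epsilon>)"
    and cI: "\<forall>j\<in>J. const_on_elements \<T> (indicat_real (cell Q \<epsilon> j))"
    and mesh: "is_mesh \<T>" and sub: "\<forall>K\<in>\<T>. \<exists>T\<in>coarse_mesh H. K \<subseteq> T"
    using T(1) J(2) unfolding resolving_refinement_def by blast+
  have "const_on_elements \<T> (defect_mask J c)"
    unfolding defect_mask_def[abs_def] by (rule const_on_elements_sum[OF J(1) cI])
  from const_on_elements_combine[OF this cB, of "(*)"]
  have "const_on_elements \<T> (\<lambda>x. defect_mask J c x * rescale Bper \<epsilon> x)" .
  from const_on_elements_combine[OF cA this, of "(+)"]
  have "const_on_elements \<T> (masked_coeff J c)" unfolding masked_coeff_def[abs_def] .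
  from const_on_elements_combine[OF const_on_elements_indicator_coarse[OF H sub, of t] this, of "\<lambda>i a. i * h a"]
  have "const_on_elements \<T> g" unfolding g(3) .
  then show ?thesis
    unfolding T(2) by (rule periodic_primitive_P1[OF mesh L2_integrable[OF g(1)] g(2)])
qed

definition resistance :: "real set \<Rightarrow> int set \<Rightarrow> (int \<Rightarrow> real) \<Rightarrow> real" where
  "resistance T J c = (LINT x:T|lebesgue. 1 / rescale Aper \<epsilon> x) + (\<Sum>j\<in>J \<inter> cells_in Q \<epsilon> T. c j * cell_jump j)"

lemma form_elem_masked:
  assumes W: "fine_space H W" and H: "0 < H" "H = real N * \<epsilon>"
    and T: "T = {real t * H..real (Suc t) * H}" "real (Suc t) * H \<le> 1"
    and J: "finite J" "J \<subseteq> cells_in Q \<epsilon> {0..1}" "\<forall>j\<in>J. c j \<in> {0, 1}"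
    and v: "v \<in> H1_per" "AE x in lebesgue. x \<in> T \<longrightarrow> grad v x = s"
    and w: "w \<in> H1_per" "AE x in lebesgue. x \<in> T \<longrightarrow> grad w x = r"
  shows "form_elem W H T (masked_coeff J c) v w = s * r * H\<^sup>2 / resistance T J c"
    and "H / \<beta> \<le> resistance T J c"
proof -
  have len: "real (Suc t) * H - real t * H = H" by (simp add: algebra_simps)
  interpret E: coarse_element W H "real t * H" "real (Suc t) * H" \<alpha> \<beta> "masked_coeff J c"
  proof
    show "W \<subseteq> H1_per" by (rule fine_space_H1[OF W])
    show "(\<lambda>x. u x - v x) \<in> W" if "u \<in> W" "v \<in> W" for u v by (rule fine_space_diff[OF W that])
    show "0 \<le> real t * H" "real t * H < real (Suc t) * H" using H(1) by auto
    show "real (Suc t) * H \<le> 1" by (rule T(2))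
    then have tH: "real t * H \<le> 1" using len H(1) by linarith
    show "real t * H \<in> coarse_nodes H" using tH unfolding coarse_nodes_def by blast
    show "real (Suc t) * H \<in> coarse_nodes H" using T(2) unfolding coarse_nodes_def by blast
    show "0 \<le> x \<and> x \<le> 1 \<and> (x \<le> real t * H \<or> real (Suc t) * H \<le> x)" if x: "x \<in> coarse_nodes H" for x
    proof -
      obtain u where u: "x = real u * H" "real u * H \<le> 1" using x unfolding coarse_nodes_def by blast
      have "u \<le> t \<or> Suc t \<le> u" by linarith
      then have "real u \<le> real t \<or> real (Suc t) \<le> real u" by (simp only: of_nat_le_iff)
      then have "real u * H \<le> real t * H \<or> real (Suc t) * H \<le> real u * H"
        using H(1) by (auto intro: mult_right_mono simp del: of_nat_Suc)
      then show ?thesis using u H(1) by auto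
    qed
    show "masked_coeff J c \<in> borel_measurable lebesgue" by (rule masked_coeff_meas[OF J(1)])
    show "0 < \<alpha>" by (rule alpha)
    show "AE x in lebesgue. x \<in> {real t * H..real (Suc t) * H} \<longrightarrow>
        \<alpha> \<le> masked_coeff J c x \<and> masked_coeff J c x \<le> \<beta>"
      using masked_coeff_AE[OF J(1,3)] by eventually_elim blast
  qed
  have R: "E.element_resistance = resistance T J c"
    unfolding E.element_resistance_def resistance_def T(1)[symmetric]
    by (rule masked_resistance[OF J(1,3) trans[OF T(1) element_grid[OF H(2)]]])
  have "periodic_primitive (E.corrector_grad s) \<in> W"
  proof (rule fine_space_primitive[OF W H(1) J(1,2) E.corrector_grad_L2 E.corrector_grad_integral])
    show "E.corrector_grad s = (\<lambda>x. indicator {real t * H..real (Suc t) * H} x *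
        (\<lambda>a. s - s * (real (Suc t) * H - real t * H) / E.element_resistance / a) (masked_coeff J c x))"
      unfolding E.corrector_grad_def[abs_def] ..
  qed
  from E.form_elem_eq[OF v(1) v(2)[unfolded T(1)] w(1) w(2)[unfolded T(1)] this]
  show "form_elem W H T (masked_coeff J c) v w = s * r * H\<^sup>2 / resistance T J c"
    unfolding len R T(1)[symmetric] .
  show "H / \<beta> \<le> resistance T J c" using E.element_resistance_lower unfolding R len .
qed

text \<open>On each element the gradient is the slope and the coefficient is at least \<open>\<alpha>\<close>.\<close>

lemma energy_lower_bound:
  assumes M: "M > 0" "H = 1 / real M" and J: "finite J" "\<forall>j\<in>J. c j \<in> {0, 1}"
    and v: "v \<in> H1_per" "\<And>t. t < M \<Longrightarrow> AE x in lebesgue. x \<in> {real t * H..real (Suc t) * H} \<longrightarrow> grad v x = s t"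
  shows "\<alpha> * (\<Sum>t<M. H * (s t)\<^sup>2) \<le> (LINT x:{0..1}|lebesgue. masked_coeff J c x * (grad v x)\<^sup>2)"
proof -
  have H: "0 \<le> H" "real M * H = 1" using M by auto
  have f: "set_integrable lebesgue {0..1} (\<lambda>x. masked_coeff J c x * (grad v x)\<^sup>2)"
  proof (rule set_integrable_mult_bounded[where C = \<beta>])
    show "set_integrable lebesgue {0..1} (\<lambda>x. (grad v x)\<^sup>2)"
      using H1_per_grad_L2[OF v(1)] by (simp add: L2_def)
    show "set_borel_measurable lebesgue {0..1} (masked_coeff J c)"
      by (intro set_borel_measurable_of_measurable masked_coeff_meas J(1)) auto
    show "AE x in lebesgue. x \<in> {0..1} \<longrightarrow> \<bar>masked_coeff J c x\<bar> \<le> \<beta>"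
      using masked_coeff_AE[OF J] by eventually_elim (use alpha in auto)
  qed
  have "\<alpha> * (H * (s t)\<^sup>2) \<le> (LINT x:{real t * H..real (Suc t) * H}|lebesgue. masked_coeff J c x * (grad v x)\<^sup>2)"
    if t: "t < M" for t
  proof -
    have tH: "0 \<le> real t * H" "real t * H \<le> real (Suc t) * H" "real (Suc t) * H \<le> real M * H"
      using H(1) t by (auto intro: mult_right_mono simp del: of_nat_Suc)
    have "\<alpha> * (H * (s t)\<^sup>2) = (LINT x:{real t * H..real (Suc t) * H}|lebesgue. \<alpha> * (s t)\<^sup>2)"
      unfolding LINT_const[OF tH(2)] by (simp add: algebra_simps)
    also have "\<dots> \<le> (LINT x:{real t * H..real (Suc t) * H}|lebesgue. masked_coeff J c x * (grad v x)\<^sup>2)"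
    proof (rule set_integral_mono_AE)
      show "set_integrable lebesgue {real t * H..real (Suc t) * H} (\<lambda>x. \<alpha> * (s t)\<^sup>2)"
        by (intro continuous_set_integrable continuous_intros)
      show "set_integrable lebesgue {real t * H..real (Suc t) * H} (\<lambda>x. masked_coeff J c x * (grad v x)\<^sup>2)"
        by (rule set_integrable_subset[OF f]) (use tH H(2) in auto)
      show "AE x\<in>{real t * H..real (Suc t) * H} in lebesgue. \<alpha> * (s t)\<^sup>2 \<le> masked_coeff J c x * (grad v x)\<^sup>2"
        using masked_coeff_AE[OF J] v(2)[OF t] by eventually_elim (auto intro: mult_right_mono)
    qed
    finally show ?thesis .
  qed
  then have "\<alpha> * (\<Sum>t<M. H * (s t)\<^sup>2)
      \<le> (\<Sum>t<M. LINT x:{real t * H..real (Suc t) * H}|lebesgue. masked_coeff J c x * (grad v x)\<^sup>2)"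
    unfolding sum_distrib_left by (intro sum_mono) simp
  also have "\<dots> = (LINT x:{0..1}|lebesgue. masked_coeff J c x * (grad v x)\<^sup>2)"
    using LINT_uniform_partition[OF f H(1), of M] H(2) by simp
  finally show ?thesis .
qed

end

section \<open>The error of the offline-online form\<close>

text \<open>With \<open>D\<close> the sum of the \<open>b i * d i\<close>, the expression equals the sum of
\<open>b i * d i * (D - d i) / (R * (R + d i) * (R + D))\<close>. If \<open>b i = 1\<close>, then \<open>D - d i\<close> is the
contribution of the other defects and is at most the number of defects times \<open>\<delta>\<close>.\<close>

lemma resistance_expansion_error:
  fixes b d :: "'i \<Rightarrow> real" and R \<rho> \<delta> :: real
  assumes I: "finite I" and b: "\<And>i. i \<in> I \<Longrightarrow> b i \<in> {0, 1}" and d: "\<And>i. i \<in> I \<Longrightarrow> \<bar>d i\<bar> \<le> \<delta>"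
    and \<rho>: "0 < \<rho>" "\<rho> \<le> R" "\<rho> \<le> R + (\<Sum>i\<in>I. b i * d i)" "\<And>i. i \<in> I \<Longrightarrow> \<rho> \<le> R + d i"
  shows "\<bar>1 / (R + (\<Sum>i\<in>I. b i * d i)) - ((1 - (\<Sum>i\<in>I. b i)) / R + (\<Sum>i\<in>I. b i / (R + d i)))\<bar>
    \<le> (\<Sum>i\<in>I. b i)\<^sup>2 * \<delta>\<^sup>2 / \<rho> ^ 3"
proof -
  define D where "D = (\<Sum>i\<in>I. b i * d i)"
  define k where "k = (\<Sum>i\<in>I. b i)"
  have pos: "0 < R" "0 < R + D" using \<rho> by (auto simp: D_def)
  have b0: "0 \<le> b i" if "i \<in> I" for i using b[OF that] by auto
  have k0: "0 \<le> k" unfolding k_def by (intro sum_nonneg b0)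
  have summand: "b i * (1 / R - 1 / (R + d i)) - b i * d i / (R * (R + D))
      = b i * (d i * (D - d i) / (R * (R + d i) * (R + D)))" if i: "i \<in> I" for i
  proof -
    have p: "0 < R + d i" using \<rho>(1) \<rho>(4)[OF i] by linarith
    have "(1 / R - 1 / (R + d i)) - d i / (R * (R + D)) = d i * (D - d i) / (R * (R + d i) * (R + D))"
      using p pos by (simp add: divide_simps) (simp add: algebra_simps)
    then show ?thesis by (metis right_diff_distrib times_divide_eq_right)
  qed
  have bound: "\<bar>b i * (d i * (D - d i) / (R * (R + d i) * (R + D)))\<bar> \<le> b i * (\<delta> * (k * \<delta>) / \<rho> ^ 3)"
    if i: "i \<in> I" for i
  proof (cases "b i = 0")
    case False
    then have b1: "b i = 1" using b[OF i] by auto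
    have \<delta>0: "0 \<le> \<delta>" using d[OF i] by linarith
    have "D = b i * d i + (\<Sum>j\<in>I - {i}. b j * d j)" unfolding D_def by (rule sum.remove[OF I i])
    then have "\<bar>D - d i\<bar> = \<bar>\<Sum>j\<in>I - {i}. b j * d j\<bar>" using b1 by simp
    also have "\<dots> \<le> (\<Sum>j\<in>I - {i}. \<bar>b j * d j\<bar>)" by (rule sum_abs)
    also have "\<dots> \<le> (\<Sum>j\<in>I - {i}. b j * \<delta>)"
      using b0 d by (intro sum_mono) (auto simp: abs_mult intro!: mult_left_mono)
    also have "\<dots> \<le> (\<Sum>j\<in>I. b j * \<delta>)"
      using I b0 \<delta>0 by (intro sum_mono2) auto
    also have "\<dots> = k * \<delta>" by (simp add: k_def sum_distrib_right)
    finally have Dd: "\<bar>D - d i\<bar> \<le> k * \<delta>" .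
    have den: "\<rho> ^ 3 \<le> R * (R + d i) * (R + D)"
    proof -
      have "\<rho> * \<rho> * \<rho> \<le> R * (R + d i) * (R + D)"
        using \<rho>(1,2,3) \<rho>(4)[OF i] pos unfolding D_def[symmetric] by (intro mult_mono) auto
      then show ?thesis by (simp add: power3_eq_cube)
    qed
    have num: "\<bar>d i\<bar> * \<bar>D - d i\<bar> \<le> \<delta> * (k * \<delta>)"
      using d[OF i] Dd \<delta>0 k0 by (intro mult_mono) auto
    have "\<rho> ^ 3 > 0" using \<rho>(1) by simp
    with den have den_pos: "0 < R * (R + d i) * (R + D)" by linarith
    have "\<bar>d i * (D - d i) / (R * (R + d i) * (R + D))\<bar> = \<bar>d i\<bar> * \<bar>D - d i\<bar> / (R * (R + d i) * (R + D))"
      by (simp only: abs_divide abs_mult[of "d i"] abs_of_pos[OF den_pos])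
    also have "\<dots> \<le> \<delta> * (k * \<delta>) / \<rho> ^ 3"
      using num den \<open>\<rho> ^ 3 > 0\<close> \<delta>0 k0 by (intro frac_le) auto
    finally show ?thesis using b1 by simp
  qed simp
  have "1 / (R + D) - ((1 - k) / R + (\<Sum>i\<in>I. b i / (R + d i)))
      = (\<Sum>i\<in>I. b i * (1 / R - 1 / (R + d i)) - b i * d i / (R * (R + D)))"
  proof -
    have "(\<Sum>i\<in>I. b i * (1 / R - 1 / (R + d i)) - b i * d i / (R * (R + D)))
        = (\<Sum>i\<in>I. b i / R) - (\<Sum>i\<in>I. b i / (R + d i)) - (\<Sum>i\<in>I. b i * d i / (R * (R + D)))"
      by (simp add: sum_subtractf right_diff_distrib)
    also have "\<dots> = k / R - (\<Sum>i\<in>I. b i / (R + d i)) - D / (R * (R + D))"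
      by (simp add: k_def D_def sum_divide_distrib)
    also have "D / (R * (R + D)) = 1 / R - 1 / (R + D)"
      using pos by (simp add: divide_simps)
    finally show ?thesis by (simp add: diff_divide_distrib)
  qed
  then have "\<bar>1 / (R + D) - ((1 - k) / R + (\<Sum>i\<in>I. b i / (R + d i)))\<bar>
      = \<bar>\<Sum>i\<in>I. b i * (1 / R - 1 / (R + d i)) - b i * d i / (R * (R + D))\<bar>" by simp
  also have "\<dots> \<le> (\<Sum>i\<in>I. \<bar>b i * (1 / R - 1 / (R + d i)) - b i * d i / (R * (R + D))\<bar>)"
    by (rule sum_abs)
  also have "\<dots> \<le> (\<Sum>i\<in>I. b i * (\<delta> * (k * \<delta>) / \<rho> ^ 3))"
  proof (rule sum_mono)
    fix i assume i: "i \<in> I"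
    show "\<bar>b i * (1 / R - 1 / (R + d i)) - b i * d i / (R * (R + D))\<bar> \<le> b i * (\<delta> * (k * \<delta>) / \<rho> ^ 3)"
      unfolding summand[OF i] by (rule bound[OF i])
  qed
  also have "\<dots> = k * (\<delta> * (k * \<delta>) / \<rho> ^ 3)" by (simp only: k_def sum_distrib_right)
  also have "\<dots> = k\<^sup>2 * \<delta>\<^sup>2 / \<rho> ^ 3" by (simp add: power2_eq_square)
  finally show ?thesis unfolding D_def k_def .
qed

text \<open>The expansion \<open>resistance_expansion_error\<close> with \<open>\<rho> = H / \<beta>\<close> and the bound
\<open>\<epsilon> |Q| (\<beta> - \<alpha>) / (\<alpha> \<beta>)\<close> for the change of resistance by one defect; \<open>\<epsilon> = H / N\<close> turns the number of defects into their fraction.\<close>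

lemma (in defect_medium) element_error:
  assumes W: "fine_space H W" and H: "0 < H" "H = real N * \<epsilon>"
    and T: "T = {real t * H..real (Suc t) * H}" "real (Suc t) * H \<le> 1"
    and b: "\<forall>j\<in>cells_in Q \<epsilon> {0..1}. b j \<in> {0, 1}"
    and v: "v \<in> H1_per" "AE x in lebesgue. x \<in> T \<longrightarrow> grad v x = s"
    and w: "w \<in> H1_per" "AE x in lebesgue. x \<in> T \<longrightarrow> grad w x = r"
  defines "k \<equiv> \<Sum>j\<in>cells_in Q \<epsilon> T. b j"
  shows "\<bar>form_elem W H T (masked_coeff (cells_in Q \<epsilon> {0..1}) b) v w
      - ((1 - k) * form_elem W H T (masked_coeff {} (\<lambda>_. 1)) v w
        + (\<Sum>j\<in>cells_in Q \<epsilon> T. b j * form_elem W H T (masked_coeff {j} (\<lambda>_. 1)) v w))\<bar>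
    \<le> \<beta> * ((\<beta> - \<alpha>) / \<alpha>)\<^sup>2 * (measure lebesgue Q)\<^sup>2 * (k / real N)\<^sup>2 * (H * \<bar>s\<bar> * \<bar>r\<bar>)"
proof -
  let ?I = "cells_in Q \<epsilon> T" and ?A = "cells_in Q \<epsilon> {0..1}"
  let ?\<delta> = "\<epsilon> * measure lebesgue Q * ((\<beta> - \<alpha>) / (\<alpha> * \<beta>))"
  define R where "R = (LINT x:T|lebesgue. 1 / rescale Aper \<epsilon> x)"
  have "T \<subseteq> {0..1}"
  proof
    fix x assume "x \<in> T"
    then have "real t * H \<le> x" "x \<le> real (Suc t) * H" unfolding T(1) by auto
    moreover have "0 \<le> real t * H" using H(1) by simp
    ultimately show "x \<in> {0..1}" using T(2) unfolding atLeastAtMost_iff by linarith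
  qed
  then have IA: "?I \<subseteq> ?A" unfolding cells_in_def by blast
  have fI: "finite ?I" by (rule finite_subset[OF IA finite_cells_in])
  note fe = form_elem_masked[OF W H T _ _ _ v w]
  have one: "?I \<inter> {j} = {j}" "{j} \<inter> ?I = {j}" if "j \<in> ?I" for j using that by auto
  have res: "resistance T ?A b = R + (\<Sum>j\<in>?I. b j * cell_jump j)"
    "resistance T {} (\<lambda>_. 1) = R"
    using IA by (simp_all add: resistance_def R_def Int_absorb1)
  have res1: "resistance T {j} (\<lambda>_. 1) = R + cell_jump j" if "j \<in> ?I" for j
    using one[OF that] by (simp add: resistance_def R_def)
  have c1: "\<forall>j\<in>J. (1::real) \<in> {0, 1}" for J :: "int set" by simp
  have sub1: "{j} \<subseteq> ?A" if "j \<in> ?I" for j using that IA by blast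
  have f0: "form_elem W H T (masked_coeff ?A b) v w = s * r * H\<^sup>2 / (R + (\<Sum>j\<in>?I. b j * cell_jump j))"
    using fe(1)[OF finite_cells_in order_refl b] by (simp only: res)
  have f1: "form_elem W H T (masked_coeff {} (\<lambda>_. 1)) v w = s * r * H\<^sup>2 / R"
    using fe(1)[OF finite.emptyI empty_subsetI c1] by (simp only: res)
  have f2: "form_elem W H T (masked_coeff {j} (\<lambda>_. 1)) v w = s * r * H\<^sup>2 / (R + cell_jump j)" if j: "j \<in> ?I" for j
    using fe(1)[OF finite.insertI[OF finite.emptyI] sub1[OF j] c1] by (simp only: res1[OF j])
  have beta: "0 < \<beta>" using alpha alpha_beta by linarith
  have err: "\<bar>1 / (R + (\<Sum>j\<in>?I. b j * cell_jump j)) - ((1 - k) / R + (\<Sum>j\<in>?I. b j / (R + cell_jump j)))\<bar>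
      \<le> k\<^sup>2 * ?\<delta>\<^sup>2 / (H / \<beta>) ^ 3"
    unfolding k_def
  proof (rule resistance_expansion_error[OF fI])
    show "b j \<in> {0, 1}" if "j \<in> ?I" for j using that IA b by blast
    show "\<bar>cell_jump j\<bar> \<le> ?\<delta>" for j by (rule cell_jump_bound)
    show "0 < H / \<beta>" using H(1) beta by simp
    show "H / \<beta> \<le> R" using fe(2)[OF finite.emptyI empty_subsetI c1] by (simp only: res)
    show "H / \<beta> \<le> R + (\<Sum>j\<in>?I. b j * cell_jump j)"
      using fe(2)[OF finite_cells_in order_refl b] by (simp only: res)
    show "H / \<beta> \<le> R + cell_jump j" if j: "j \<in> ?I" for j
      using fe(2)[OF finite.insertI[OF finite.emptyI] sub1[OF j] c1] by (simp only: res1[OF j])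
  qed
  have "form_elem W H T (masked_coeff ?A b) v w
      - ((1 - k) * form_elem W H T (masked_coeff {} (\<lambda>_. 1)) v w
        + (\<Sum>j\<in>?I. b j * form_elem W H T (masked_coeff {j} (\<lambda>_. 1)) v w))
    = s * r * H\<^sup>2 * (1 / (R + (\<Sum>j\<in>?I. b j * cell_jump j)) - ((1 - k) / R + (\<Sum>j\<in>?I. b j / (R + cell_jump j))))"
  proof -
    have "(\<Sum>j\<in>?I. b j * form_elem W H T (masked_coeff {j} (\<lambda>_. 1)) v w)
        = (\<Sum>j\<in>?I. s * r * H\<^sup>2 * (b j / (R + cell_jump j)))"
      by (intro sum.cong refl) (simp only: f2, simp)
    also have "\<dots> = s * r * H\<^sup>2 * (\<Sum>j\<in>?I. b j / (R + cell_jump j))"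
      by (simp only: sum_distrib_left)
    finally show ?thesis unfolding f0 f1 by (simp add: right_diff_distrib distrib_left mult_ac)
  qed
  then have "\<bar>form_elem W H T (masked_coeff ?A b) v w
      - ((1 - k) * form_elem W H T (masked_coeff {} (\<lambda>_. 1)) v w
        + (\<Sum>j\<in>?I. b j * form_elem W H T (masked_coeff {j} (\<lambda>_. 1)) v w))\<bar>
    = \<bar>s * r * H\<^sup>2\<bar> * \<bar>1 / (R + (\<Sum>j\<in>?I. b j * cell_jump j)) - ((1 - k) / R + (\<Sum>j\<in>?I. b j / (R + cell_jump j)))\<bar>"
    by (simp only: abs_mult)
  also have "\<dots> \<le> \<bar>s * r * H\<^sup>2\<bar> * (k\<^sup>2 * ?\<delta>\<^sup>2 / (H / \<beta>) ^ 3)"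
    by (rule mult_left_mono[OF err abs_ge_zero])
  also have "\<bar>s * r * H\<^sup>2\<bar> = \<bar>s\<bar> * \<bar>r\<bar> * H\<^sup>2" by (simp add: abs_mult)
  also have "\<bar>s\<bar> * \<bar>r\<bar> * H\<^sup>2 * (k\<^sup>2 * ?\<delta>\<^sup>2 / (H / \<beta>) ^ 3)
      = \<beta> * ((\<beta> - \<alpha>) / \<alpha>)\<^sup>2 * (measure lebesgue Q)\<^sup>2 * (k / real N)\<^sup>2 * (H * \<bar>s\<bar> * \<bar>r\<bar>)"
  proof -
    have N: "real N \<noteq> 0" using H by (cases N) auto
    have e: "\<epsilon> = H / real N" using H N by simp
    show ?thesis
      unfolding e using N H(1) beta alpha
      by (simp add: field_simps power2_eq_square power3_eq_cube)
  qed
  finally show ?thesis .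
qed

lemma weighted_Cauchy_Schwarz:
  fixes s r :: "nat \<Rightarrow> real"
  assumes "0 \<le> H"
  shows "(\<Sum>t<M. H * \<bar>s t\<bar> * \<bar>r t\<bar>) \<le> sqrt (\<Sum>t<M. H * (s t)\<^sup>2) * sqrt (\<Sum>t<M. H * (r t)\<^sup>2)"
proof -
  have "(\<Sum>t<M. H * \<bar>s t\<bar> * \<bar>r t\<bar>) = (\<Sum>t<M. \<bar>sqrt H * s t\<bar> * \<bar>sqrt H * r t\<bar>)"
    using assms by (intro sum.cong) (auto simp: abs_mult)
  also have "\<dots> \<le> L2_set (\<lambda>t. sqrt H * s t) {..<M} * L2_set (\<lambda>t. sqrt H * r t) {..<M}"
    by (rule L2_set_mult_ineq)
  also have "\<dots> = sqrt (\<Sum>t<M. H * (s t)\<^sup>2) * sqrt (\<Sum>t<M. H * (r t)\<^sup>2)"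
    using assms by (simp add: L2_set_def power_mult_distrib)
  finally show ?thesis .
qed

theorem theorem4p1:
  fixes n M N :: nat
    and \<epsilon> H \<alpha> \<beta> :: real
    and Aper Bper :: "real \<Rightarrow> real"
    and Q :: "real set"
    and bhat :: "int \<Rightarrow> real"
    and W :: "(real \<Rightarrow> real) set"
    and \<sigma> :: "real set \<Rightarrow> nat \<Rightarrow> int"
    and v w :: "real \<Rightarrow> real"
  assumes "n > 0" and "\<epsilon> = 1 / real n"
    and "M > 0" and "H = 1 / real M" and "H = real N * \<epsilon>"
    and "L_infty Aper" and "L_infty Bper"
    and "AE x in lebesgue. Aper (x + 1) = Aper x"
    and "AE x in lebesgue. Bper (x + 1) = Bper x"
    and "0 < \<alpha>" and "\<alpha> \<le> \<beta>"
    and "AE x in lebesgue. \<alpha> \<le> Aper x \<and> Aper x \<le> \<beta>"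
    and "AE x in lebesgue. \<alpha> \<le> Aper x + Bper x \<and> Aper x + Bper x \<le> \<beta>"
    and "Q \<subseteq> {0..1}" and "Q \<in> sets lebesgue" and "measure lebesgue Q > 0"
    and "\<forall>j\<in>cells_in Q \<epsilon> {0..1}. bhat j \<in> {0, 1}"
    and "W = H1_per \<or> (\<exists>\<T>. resolving_refinement Aper Bper Q \<epsilon> H \<T> \<and> W = P1_per \<T>)"
    and "\<forall>T\<in>coarse_mesh H. bij_betw (\<sigma> T) {1..N} (cells_in Q \<epsilon> T)"
    and "v \<in> V_coarse H" and "w \<in> V_coarse H"
  defines "A \<equiv> coeff Aper Bper Q \<epsilon> bhat"
    and "\<theta> \<equiv> max_defect_frac N bhat \<sigma> H"
  shows "\<bar>form_lod W H A v w - form_offon Aper Bper Q \<epsilon> bhat \<sigma> N W H v w\<bar>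
    \<le> \<beta> / \<alpha> * ((\<beta> - \<alpha>) / \<alpha>)\<^sup>2 * (measure lebesgue Q)\<^sup>2 * (\<epsilon> / H * \<theta> + 2 * \<theta>\<^sup>2)
        * energy_norm A v * energy_norm A w"
proof -
  have eps: "0 < \<epsilon>" using assms(1,2) by simp
  have H: "0 < H" using assms(3,4) by simp
  interpret defect_medium Aper Bper Q \<epsilon> \<alpha> \<beta>
    using eps assms(6,7,10-16) by unfold_locales (auto simp: L_infty_def)
  let ?C = "cells_in Q \<epsilon> {0..1}"
  let ?T = "\<lambda>t. {real t * H..real (Suc t) * H}"
  note mesh = coarse_mesh_image[OF assms(3,4)]
  have W: "fine_space H W" using assms(18) by (simp add: fine_space_def)
  have A: "A = masked_coeff ?C bhat"
    by (simp add: A_def fun_eq_iff coeff_def masked_coeff_def defect_mask_def sum_distrib_right)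
  obtain s where v: "v \<in> H1_per" and s: "\<And>t. t < M \<Longrightarrow> AE x in lebesgue. x \<in> ?T t \<longrightarrow> grad v x = s t"
    using V_coarse_slopes[OF assms(3,4,20)] by blast
  obtain r where w: "w \<in> H1_per" and r: "\<And>t. t < M \<Longrightarrow> AE x in lebesgue. x \<in> ?T t \<longrightarrow> grad w x = r t"
    using V_coarse_slopes[OF assms(3,4,21)] by blast
  define K where "K = \<beta> * ((\<beta> - \<alpha>) / \<alpha>)\<^sup>2 * (measure lebesgue Q)\<^sup>2"
  have K0: "0 \<le> K" unfolding K_def using alpha alpha_beta by simp
  define err where "err T = form_elem W H T A v w
    - (\<Sum>i=0..N. offline_weight N bhat \<sigma> T i * form_elem W H T (offline_coeff Aper Bper Q \<epsilon> \<sigma> T i) v w)" for T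
  have err_bound: "\<bar>err (?T t)\<bar> \<le> K * \<theta>\<^sup>2 * (H * \<bar>s t\<bar> * \<bar>r t\<bar>)" and theta0: "0 \<le> \<theta>" if t: "t < M" for t
  proof -
    let ?D = "cells_in Q \<epsilon> (?T t)"
    define k where "k = (\<Sum>j\<in>?D. bhat j)"
    have inmesh: "?T t \<in> coarse_mesh H" unfolding mesh using t by blast
    have bij: "bij_betw (\<sigma> (?T t)) {1..N} ?D" using assms(19) inmesh by blast
    have reindex: "(\<Sum>i=1..N. f (\<sigma> (?T t) i)) = (\<Sum>j\<in>?D. f j)" for f :: "int \<Rightarrow> real"
      by (rule sum.reindex_bij_betw[OF bij])
    have kdef: "n_defects N bhat \<sigma> (?T t) = k" unfolding n_defects_def k_def by (rule reindex)
    have T1: "real (Suc t) * H \<le> 1"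
    proof -
      have "real (Suc t) * H \<le> real M * H" using t H by (intro mult_right_mono) auto
      then show ?thesis using assms(3,4) by simp
    qed
    have "0 \<le> real t * H" using H by simp
    then have "?T t \<subseteq> {0..1}" using T1 by auto
    then have D_sub: "?D \<subseteq> ?C" unfolding cells_in_def by blast
    have k0: "0 \<le> k" unfolding k_def using D_sub assms(17) by (intro sum_nonneg) fastforce
    have fin: "finite ((\<lambda>T. n_defects N bhat \<sigma> T / real N) ` coarse_mesh H)" unfolding mesh by simp
    have kt: "k / real N \<le> \<theta>"
      unfolding \<theta>_def max_defect_frac_def kdef[symmetric] by (rule Max_ge[OF fin]) (use inmesh in blast)
    have kN0: "0 \<le> k / real N" using k0 by simp
    show "0 \<le> \<theta>" using kN0 kt by linarith
    have off0: "offline_coeff Aper Bper Q \<epsilon> \<sigma> (?T t) 0 = masked_coeff {} (\<lambda>_. 1)"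
      by (simp add: fun_eq_iff offline_coeff_def masked_coeff_def defect_mask_def)
    have offi: "offline_coeff Aper Bper Q \<epsilon> \<sigma> (?T t) i = masked_coeff {\<sigma> (?T t) i} (\<lambda>_. 1)" if "i \<in> {1..N}" for i
      using that by (auto simp: fun_eq_iff offline_coeff_def masked_coeff_def defect_mask_def)
    have "(\<Sum>i=0..N. offline_weight N bhat \<sigma> (?T t) i * form_elem W H (?T t) (offline_coeff Aper Bper Q \<epsilon> \<sigma> (?T t) i) v w)
        = offline_weight N bhat \<sigma> (?T t) 0 * form_elem W H (?T t) (offline_coeff Aper Bper Q \<epsilon> \<sigma> (?T t) 0) v w
          + (\<Sum>i=1..N. offline_weight N bhat \<sigma> (?T t) i * form_elem W H (?T t) (offline_coeff Aper Bper Q \<epsilon> \<sigma> (?T t) i) v w)"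
      by (simp add: sum.atLeast_Suc_atMost)
    also have "(\<Sum>i=1..N. offline_weight N bhat \<sigma> (?T t) i * form_elem W H (?T t) (offline_coeff Aper Bper Q \<epsilon> \<sigma> (?T t) i) v w)
        = (\<Sum>i=1..N. bhat (\<sigma> (?T t) i) * form_elem W H (?T t) (masked_coeff {\<sigma> (?T t) i} (\<lambda>_. 1)) v w)"
    proof (rule sum.cong[OF refl])
      fix i assume i: "i \<in> {1..N}"
      then have "offline_weight N bhat \<sigma> (?T t) i = bhat (\<sigma> (?T t) i)" by (simp add: offline_weight_def)
      then show "offline_weight N bhat \<sigma> (?T t) i * form_elem W H (?T t) (offline_coeff Aper Bper Q \<epsilon> \<sigma> (?T t) i) v w
          = bhat (\<sigma> (?T t) i) * form_elem W H (?T t) (masked_coeff {\<sigma> (?T t) i} (\<lambda>_. 1)) v w"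
        by (simp only: offi[OF i])
    qed
    also have "\<dots> = (\<Sum>j\<in>?D. bhat j * form_elem W H (?T t) (masked_coeff {j} (\<lambda>_. 1)) v w)"
      by (rule reindex)
    also have "offline_weight N bhat \<sigma> (?T t) 0 = 1 - k" by (simp add: offline_weight_def kdef del: of_nat_Suc)
    finally have err_eq: "err (?T t) = form_elem W H (?T t) (masked_coeff ?C bhat) v w
        - ((1 - k) * form_elem W H (?T t) (masked_coeff {} (\<lambda>_. 1)) v w
          + (\<Sum>j\<in>?D. bhat j * form_elem W H (?T t) (masked_coeff {j} (\<lambda>_. 1)) v w))"
      unfolding err_def A off0 by (simp only:)
    have "\<bar>err (?T t)\<bar> \<le> K * (k / real N)\<^sup>2 * (H * \<bar>s t\<bar> * \<bar>r t\<bar>)"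
      unfolding err_eq K_def k_def
      by (rule element_error[OF W H assms(5) refl T1 assms(17) v s[OF t] w r[OF t]])
    also have "\<dots> \<le> K * \<theta>\<^sup>2 * (H * \<bar>s t\<bar> * \<bar>r t\<bar>)"
      using K0 H power_mono[OF kt kN0, of 2] by (intro mult_right_mono mult_left_mono) auto
    finally show "\<bar>err (?T t)\<bar> \<le> K * \<theta>\<^sup>2 * (H * \<bar>s t\<bar> * \<bar>r t\<bar>)" .
  qed
  have \<theta>: "0 \<le> \<theta>" by (rule theta0[OF assms(3)])
  have energy: "sqrt (\<Sum>t<M. H * (g t)\<^sup>2) \<le> energy_norm A u / sqrt \<alpha>"
    if u: "u \<in> H1_per" "\<And>t. t < M \<Longrightarrow> AE x in lebesgue. x \<in> ?T t \<longrightarrow> grad u x = g t" for u g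
  proof -
    have "\<alpha> * (\<Sum>t<M. H * (g t)\<^sup>2) \<le> (LINT x:{0..1}|lebesgue. A x * (grad u x)\<^sup>2)"
      unfolding A by (rule energy_lower_bound[OF assms(3,4) finite_cells_in assms(17) u])
    then have "(\<Sum>t<M. H * (g t)\<^sup>2) \<le> (LINT x:{0..1}|lebesgue. A x * (grad u x)\<^sup>2) / \<alpha>"
      using alpha by (simp add: pos_le_divide_eq mult.commute)
    then have "sqrt (\<Sum>t<M. H * (g t)\<^sup>2) \<le> sqrt ((LINT x:{0..1}|lebesgue. A x * (grad u x)\<^sup>2) / \<alpha>)"
      by (rule real_sqrt_le_mono)
    then show ?thesis by (simp only: energy_norm_def real_sqrt_divide)
  qed
  have "form_lod W H A v w - form_offon Aper Bper Q \<epsilon> bhat \<sigma> N W H v w = (\<Sum>T\<in>coarse_mesh H. err T)"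
    unfolding form_lod_def form_offon_def err_def by (simp only: sum_subtractf)
  also have "\<dots> = (\<Sum>t<M. err (?T t))"
    unfolding mesh by (rule sum.reindex[OF coarse_mesh_inj[OF H], unfolded o_def])
  finally have "\<bar>form_lod W H A v w - form_offon Aper Bper Q \<epsilon> bhat \<sigma> N W H v w\<bar> = \<bar>\<Sum>t<M. err (?T t)\<bar>"
    by (simp only:)
  also have "\<dots> \<le> (\<Sum>t<M. \<bar>err (?T t)\<bar>)" by (rule sum_abs)
  also have "\<dots> \<le> (\<Sum>t<M. K * \<theta>\<^sup>2 * (H * \<bar>s t\<bar> * \<bar>r t\<bar>))"
    by (rule sum_mono) (rule err_bound, simp)
  also have "\<dots> = K * \<theta>\<^sup>2 * (\<Sum>t<M. H * \<bar>s t\<bar> * \<bar>r t\<bar>)" by (simp only: sum_distrib_left)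
  also have "\<dots> \<le> K * \<theta>\<^sup>2 * (energy_norm A v / sqrt \<alpha> * (energy_norm A w / sqrt \<alpha>))"
  proof (rule mult_left_mono)
    have "(\<Sum>t<M. H * \<bar>s t\<bar> * \<bar>r t\<bar>) \<le> sqrt (\<Sum>t<M. H * (s t)\<^sup>2) * sqrt (\<Sum>t<M. H * (r t)\<^sup>2)"
      using H by (intro weighted_Cauchy_Schwarz) simp
    also have "\<dots> \<le> energy_norm A v / sqrt \<alpha> * (energy_norm A w / sqrt \<alpha>)"
    proof (rule mult_mono[OF energy[OF v s] energy[OF w r]])
      have "0 \<le> sqrt (\<Sum>t<M. H * (s t)\<^sup>2)" using H by (intro real_sqrt_ge_zero sum_nonneg) auto
      then show "0 \<le> energy_norm A v / sqrt \<alpha>" using energy[OF v s] by linarith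
      show "0 \<le> sqrt (\<Sum>t<M. H * (r t)\<^sup>2)" using H by (intro real_sqrt_ge_zero sum_nonneg) auto
    qed
    finally show "(\<Sum>t<M. H * \<bar>s t\<bar> * \<bar>r t\<bar>) \<le> energy_norm A v / sqrt \<alpha> * (energy_norm A w / sqrt \<alpha>)" .
    show "0 \<le> K * \<theta>\<^sup>2" using K0 by simp
  qed
  also have "\<dots> = K / \<alpha> * \<theta>\<^sup>2 * (energy_norm A v * energy_norm A w)"
  proof -
    have "sqrt \<alpha> * sqrt \<alpha> = \<alpha>" using alpha by simp
    then show ?thesis by (simp only: times_divide_eq_left times_divide_eq_right divide_divide_eq_left mult_ac)
  qed
  also have "\<dots> \<le> K / \<alpha> * (\<epsilon> / H * \<theta> + 2 * \<theta>\<^sup>2) * (energy_norm A v * energy_norm A w)"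
  proof (intro mult_right_mono mult_left_mono)
    have "0 \<le> \<epsilon> / H * \<theta>" using eps H \<theta> by simp
    then show "\<theta>\<^sup>2 \<le> \<epsilon> / H * \<theta> + 2 * \<theta>\<^sup>2" using zero_le_power2[of \<theta>] by linarith
    show "0 \<le> K / \<alpha>" using K0 alpha by simp
    have nn: "0 \<le> energy_norm A u" if u: "u \<in> H1_per" "\<And>t. t < M \<Longrightarrow> AE x in lebesgue. x \<in> ?T t \<longrightarrow> grad u x = g t" for u g
    proof -
      have "0 \<le> sqrt (\<Sum>t<M. H * (g t)\<^sup>2)" using H by (intro real_sqrt_ge_zero sum_nonneg) auto
      then have "0 \<le> energy_norm A u / sqrt \<alpha>" using energy[OF u] by linarith
      then show ?thesis using alpha by (simp add: zero_le_divide_iff)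
    qed
    show "0 \<le> energy_norm A v * energy_norm A w" by (intro mult_nonneg_nonneg nn[OF v s] nn[OF w r])
  qed
  also have "\<dots> = \<beta> / \<alpha> * ((\<beta> - \<alpha>) / \<alpha>)\<^sup>2 * (measure lebesgue Q)\<^sup>2 * (\<epsilon> / H * \<theta> + 2 * \<theta>\<^sup>2)
        * energy_norm A v * energy_norm A w"
    by (simp add: K_def)
  finally show ?thesis .
qed

end
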